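(* Let $G:\Lambda\times\mathbb R\times\mathbb R^d\times\mathbb S^d\to\mathbb R$ and $g:\Omega\to\mathbb R$ satisfy: (A.i) $G(\cdot,0,\mathbf 0,\mathbf 0)$ and $g$ are bounded; (A.ii) $G$ is continuous in $(t,\omega)$ and uniformly Lipschitz continuous in $(y,z,\gamma)$, and $g$ is uniformly continuous in $\omega$; (A.iii) $G$ is nondecreasing in $\gamma$; (A.iv) the comparison principle holds for the PPDE in the class of bounded viscosity solutions: if $u_1,u_2$ are respectively a bounded viscosity subsolution and a bounded viscosity supersolution of the PPDE and $u_1(T,\cdot)\le g\le u_2(T,\cdot)$, then $u_1\le u_2$ on $\Lambda$; (B) $G$ is differentiable in $(z,\gamma)$ and the parameters $\mu_i>0,\sigma_i>0$ ($i=1,\dots,d$) are chosen so that, for some $\varepsilon_0\in(0,1)$, everywhere and for all $i,j$, $$\partial_{z_i}G\ge0,\quad \partial_{\gamma_{ij}}G\ge0,\quad \frac{2\,\partial_{\gamma_{ii}}G}{\sigma_i}\ge\sum_{j\ne i}\frac{\partial_{\gamma_{ij}}G+\partial_{\gamma_{ji}}G}{\sigma_j},\quad \sum_{i=1}^d\frac{\partial_{z_i}G}{\mu_i}+\sum_{i=1}^d\frac{2\,\partial_{\gamma_{ii}}G}{\sigma_i^2}-\sum_{i\ne j}\frac{\partial_{\gamma_{ij}}G}{\sigma_i\sigma_j}\le1-\varepsilon_0;$$ (C) $G$ and $g$ are uniformly Lipschitz continuous in $\omega$. Assume that the PPDE with terminal condition $u(T,\cdot)=g$ has a classical solution $u\in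 C^{2,4}_b(\Lambda)$. Let $u^h$ ($h=T/n$, $t_i=ih$) be the discrete approximation generated by the scheme $\mathbb T^{t,\omega}_h$ defined in the context with these parameters. Then there is a constant $C$, independent of $h$, $i$ and $\omega$, such that $$|u^h(t_i,\omega)-u(t_i,\omega)|\le Ch,\qquad i=0,\dots,n,\ \omega\in\Omega.$$
   Context: Spaces. Fix $T>0$, $d\ge1$. $\mathbb S^d$ is the set of symmetric $d\times d$ matrices; $\gamma:\gamma'=\mathrm{Trace}[\gamma\gamma']$; $|\cdot|$ is the Euclidean (Frobenius) norm; $\mathbf 0$ denotes zero vectors, matrices or paths. For $t\in[0,T]$: $\Omega^t=\{\omega\in C([t,T],\mathbb R^d):\omega_t=\mathbf 0\}$, $B^t$ is its canonical process, $\mathbb F^t=(\mathcal F^t_s)_{t\le s\le T}$ the filtration generated by $B^t$, $\Lambda^t=[t,T]\times\Omega^t$; the superscript is dropped when $t=0$. Put $\|\omega\|_s=\sup_{t\le r\le s}|\omega_r|$ and $\mathbf d((s,\omega),(s',\omega'))=\sqrt{|s-s'|}+\|\omega_{\cdot\wedge s}-\omega'_{\cdot\wedge s'}\|_T$ on $\Lambda^t$; continuity in $(t,\omega)$ is with respect to $\mathbf d$. Lipschitz continuity of $G(t,\cdot,y,z,\gamma)$ in $\omega$ is with respect to $\|\cdot\|_t$ (uniformly in the other variables), that of $g$ with respect to $\|\cdot\|_T$. $L^0(\mathcal F^t_s)$: $\mathcal F^t_s$-measurable random variables; $L^0(\Lambda^t)$: $\mathbb F^t$-progressively measurable processes; $C^0(\Lambda^t)$,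 $UC(\Lambda^t)$: its elements that are continuous, uniformly continuous under $\mathbf d$; subscript $b$: bounded ones. Range spaces are indicated as in $C^0(\Lambda^t,\mathbb R^d)$. A modulus of continuity is a continuous nondecreasing $\rho:[0,\infty)\to[0,\infty)$ with $\rho(0)=0$. For $s\le t$, $\omega\in\Omega^s$, $\omega'\in\Omega^t$: $(\omega\otimes_t\omega')(r)=\omega_r\mathbf 1_{[s,t)}(r)+(\omega_t+\omega'_r)\mathbf 1_{[t,T]}(r)$; for a random variable $\xi$ or a process $X$ on $\Omega^s$, $\xi^{t,\omega}(\omega')=\xi(\omega\otimes_t\omega')$, $X^{t,\omega}(r,\omega')=X(r,\omega\otimes_t\omega')$ (similarly $G^{t,\omega}$). Stopping times and nonlinear expectation. $\mathcal T^t$: $\mathbb F^t$-stopping times. $\mathcal H^t\subset\mathcal T^t$: hitting times $H=\inf\{s\ge t:B^t_s\notin O\}\wedge t_0$ with $t<t_0\le T$ and $O\subset\mathbb R^d$ open convex containing $\mathbf 0$. For $L>0$, $\mathcal P^t_L$ is the set of probability measures $\mathbb P$ on $\Omega^t$ for which there are $\alpha^{\mathbb P}\in L^0(\Lambda^t,\mathbb R^d)$ and $\mathbf 0\le\beta^{\mathbb P}\in L^0(\Lambda^t,\mathbb S^d)$ with $|\alpha^{\mathbb P}|\le L$, $|\beta^{\mathbb P}|\le\sqrt{2L}$, such that $M^{\mathbb P}=B^t-\int_t^\cdot\alpha^{\mathbb P}_rdr$ is a $\mathbb P$-martingale with $d\langle M^{\mathbb P}\rangle_r=(\beta^{\mathbb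 P}_r)^2dr$, $\mathbb P$-a.s.; $\mathcal P^t_\infty=\bigcup_{L>0}\mathcal P^t_L$. For $\xi\in L^0(\mathcal F^t_T)$ with $\sup_{\mathbb P\in\mathcal P^t_L}\mathbb E^{\mathbb P}[|\xi|]<\infty$: $\overline{\mathcal E}^L_t[\xi]=\sup_{\mathbb P\in\mathcal P^t_L}\mathbb E^{\mathbb P}[\xi]$, $\underline{\mathcal E}^L_t[\xi]=\inf_{\mathbb P\in\mathcal P^t_L}\mathbb E^{\mathbb P}[\xi]$. Path derivatives. $u\in C^{1,2}(\Lambda^t)$ if $u\in C^0(\Lambda^t)$ and there exist $\partial_tu\in C^0(\Lambda^t)$, $\partial_\omega u\in C^0(\Lambda^t,\mathbb R^d)$, $\partial^2_{\omega\omega}u\in C^0(\Lambda^t,\mathbb S^d)$ (then unique) such that for every $\mathbb P\in\mathcal P^t_\infty$, $u$ is a local $\mathbb P$-semimartingale and $du=\partial_tu\,ds+\partial_\omega u\cdot dB^t_s+\frac12\partial^2_{\omega\omega}u:d\langle B^t\rangle_s$, $\mathbb P$-a.s. $C^{1,2}_b$: those $u\in C^{1,2}$ such that $u,\partial_tu,\partial_\omega u,\partial^2_{\omega\omega}u$ are bounded. $C^{2,4}_b:=\{u\in C^{1,2}_b:\partial_tu,\partial_\omega u,\partial^2_{\omega\omega}u\in C^{1,2}_b\}$ (componentwise). PPDE. $\mathcal Lu(t,\omega):=-\partial_tu(t,\omega)-G(t,\omega,u,\partial_\omega u,\partial^2_{\omega\omega}u)=0$ for $0\le t<T$, $\omega\in\Omega$,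 with $G=G(t,\omega,y,z,\gamma)$ and terminal condition $u(T,\omega)=g(\omega)$. A classical solution is $u\in C^{1,2}(\Lambda)$ with $\mathcal Lu=0$ on $[0,T)\times\Omega$. For $\varphi\in C^{1,2}(\Lambda^t)$: $\mathcal L^{t,\omega}\varphi(t,\mathbf 0)=[-\partial_t\varphi-G^{t,\omega}(\cdot,\varphi,\partial_\omega\varphi,\partial^2_{\omega\omega}\varphi)](t,\mathbf 0)$. $\partial_\gamma G=(\partial_{\gamma_{ij}}G)$ is the gradient of $G$ in $\gamma\in\mathbb S^d$ with respect to the inner product $:$. Viscosity solutions. $\underline{\mathcal U}$: the set of $u\in L^0(\Lambda)$ that are bounded from above, right continuous (for every $(t,\omega)$, $\varepsilon>0$ there is $\delta>0$ with $|u^{t,\omega}(s,\tilde\omega)-u(t,\omega)|\le\varepsilon$ whenever $(s,\tilde\omega)\in\Lambda^t$, $\mathbf d((s,\tilde\omega),(t,\mathbf 0))\le\delta$), and for some modulus of continuity $\rho$ satisfy $u(t,\omega)-u(t',\omega')\le\rho(\mathbf d((t,\omega),(t',\omega')))$ whenever $t\le t'$. $\overline{\mathcal U}=\{u:-u\in\underline{\mathcal U}\}$. Let $\underline{\mathcal A}^Lu(t,\omega)$ be the set of $\varphi\in C^{1,2}(\Lambda^t)$ for which there is $H\in\mathcal H^t$ with $(\varphi-u^{t,\omega})_t=0=\inf_{\tau\in\mathcal T^t}\underline{\mathcal E}^L_t[(\varphi-u^{t,\omega})_{\tau\wedge H}]$, and $\overline{\mathcal A}^Lu(t,\omega)$ the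 set of those for which there is $H\in\mathcal H^t$ with $(\varphi-u^{t,\omega})_t=0=\sup_{\tau\in\mathcal T^t}\overline{\mathcal E}^L_t[(\varphi-u^{t,\omega})_{\tau\wedge H}]$. $u\in\underline{\mathcal U}$ (resp. $\overline{\mathcal U}$) is a viscosity $L$-subsolution (resp. $L$-supersolution) if $\mathcal L^{t,\omega}\varphi(t,\mathbf 0)\le0$ (resp. $\ge0$) for all $(t,\omega)\in[0,T)\times\Omega$ and $\varphi\in\underline{\mathcal A}^Lu(t,\omega)$ (resp. $\overline{\mathcal A}^Lu(t,\omega)$); it is a viscosity sub-(super-)solution if this holds for some $L>0$. The scheme. Let $\mu_i,\sigma_i>0$, $e_i$ the canonical basis of $\mathbb R^d$. For $t\in[0,T)$ consider on $\Omega^t$ the laws, for $s\in[t,T]$ and $W$ a one-dimensional Brownian motion: $\mathbb P^0$: of the zero path; $\mathbb P^i$: of $s\mapsto\mu_i(s-t)e_i$; $\mathbb P^{ii}$: of $s\mapsto\sigma_iW_{s-t}e_i$; $\mathbb P^{ij}$ ($i\ne j$): of $s\mapsto W_{s-t}(\sigma_ie_i+\sigma_je_j)$. For $h\in(0,T-t]$ and $\varphi\in L^0(\mathcal F^t_{t+h})$ put $$\mathbb T^{t,\omega}_h[\varphi]=\mathcal D^{(0)}\varphi+hG(t,\omega,\mathcal D^{(0)}\varphi,\mathcal D^{(1)}\varphi,\mathcal D^{(2)}\varphi),$$ $$\mathcal D^{(0)}\varphi=\mathbb E^{\mathbb P^0}[\varphi],\quad \mathcal D^{(1)}_i\varphi=\frac{\mathbb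 E^{\mathbb P^i}[\varphi]-\mathbb E^{\mathbb P^0}[\varphi]}{\mu_ih},\quad \mathcal D^{(2)}_{i,i}\varphi=\frac{\mathbb E^{\mathbb P^{ii}}[\varphi]-\mathbb E^{\mathbb P^0}[\varphi]}{\sigma_i^2h/2},$$ $$\mathcal D^{(2)}_{i,j}\varphi=\frac{\mathbb E^{\mathbb P^{ij}}[\varphi]-\mathbb E^{\mathbb P^{ii}}[\varphi]-\mathbb E^{\mathbb P^{jj}}[\varphi]+\mathbb E^{\mathbb P^0}[\varphi]}{\sigma_i\sigma_jh}\quad(i\ne j).$$ Discrete approximation: for $n\ge1$, $h=T/n$, $t_i=ih$: $u^h(t_n,\omega)=g(\omega)$ and $u^h(t,\omega)=\mathbb T^{t,\omega}_{t_i-t}\big[(u^h(t_i,\cdot))^{t,\omega}\big]$ for $t\in[t_{i-1},t_i)$, $i=n,\dots,1$. *)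

theory Defs
  imports "HOL-Probability.Probability"
begin

section \<open>Path spaces\<close>

text \<open>
  The horizon \<open>T\<close> is an explicit argument throughout, and the dimension \<open>d\<close> is \<open>CARD('d)\<close>.
  A path on \<open>[t, T]\<close> is a total function that is \<^term>\<open>undefined\<close> outside \<open>[t, T]\<close>, so that
  \<open>Omega T t\<close> is exactly the set of continuous functions on \<open>[t, T]\<close> starting from \<open>0\<close>.
  The canonical process is evaluation, \<open>\<lambda>s \<omega>. \<omega> s\<close>.  A process on
  \<open>Lambda T t = [t, T] \<times> Omega T t\<close> is a curried function of time and path,
  and its values outside \<open>Lambda T t\<close> are irrelevant.
\<close>

type_synonym 'd path = "real \<Rightarrow> real ^ 'd"
type_synonym ('d, 'b) process = "real \<Rightarrow> 'd path \<Rightarrow> 'b"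

definition Omega :: "real \<Rightarrow> real \<Rightarrow> 'd::finite path set" where
  "Omega T t = {\<omega> \<in> extensional {t..T}. continuous_on {t..T} \<omega> \<and> \<omega> t = 0}"

definition Lambda :: "real \<Rightarrow> real \<Rightarrow> (real \<times> 'd::finite path) set" where
  "Lambda T t = {t..T} \<times> Omega T t"

definition zero_path :: "real \<Rightarrow> real \<Rightarrow> 'd::finite path" where
  "zero_path T t = (\<lambda>r\<in>{t..T}. 0)"

definition Filt :: "real \<Rightarrow> real \<Rightarrow> real \<Rightarrow> 'd::finite path measure" where
  "Filt T t s = sigma (Omega T t)
     {(\<lambda>\<omega>. \<omega> r) -` A \<inter> Omega T t | r A. r \<in> {t..s} \<and> A \<in> sets borel}"

definition path_norm :: "real \<Rightarrow> real \<Rightarrow> 'd::finite path \<Rightarrow> real" where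
  "path_norm t s \<omega> = (SUP r\<in>{t..s}. norm (\<omega> r))"

definition path_dist :: "real \<Rightarrow> real \<Rightarrow> real \<times> 'd::finite path \<Rightarrow> real \<times> 'd path \<Rightarrow> real" where
  "path_dist T t = (\<lambda>(s, \<omega>) (s', \<omega>').
     sqrt \<bar>s - s'\<bar> + path_norm t T (\<lambda>r. \<omega> (min r s) - \<omega>' (min r s')))"

definition concat_path :: "real \<Rightarrow> real \<Rightarrow> real \<Rightarrow> 'd::finite path \<Rightarrow> 'd path \<Rightarrow> 'd path" where
  "concat_path T s t \<omega> \<omega>' = (\<lambda>r\<in>{s..T}. if r < t then \<omega> r else \<omega> t + \<omega>' r)"

definition shift_rv ::
  "real \<Rightarrow> real \<Rightarrow> real \<Rightarrow> 'd::finite path \<Rightarrow> ('d path \<Rightarrow> 'b) \<Rightarrow> 'd path \<Rightarrow> 'b" where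
  "shift_rv T s t \<omega> \<xi> = (\<lambda>\<omega>'. \<xi> (concat_path T s t \<omega> \<omega>'))"

definition shift_proc ::
  "real \<Rightarrow> real \<Rightarrow> real \<Rightarrow> 'd::finite path \<Rightarrow> ('d, 'b) process \<Rightarrow> ('d, 'b) process" where
  "shift_proc T s t \<omega> X = (\<lambda>r. shift_rv T s t \<omega> (X r))"

definition progressive :: "real \<Rightarrow> real \<Rightarrow> ('d::finite, 'b::euclidean_space) process \<Rightarrow> bool" where
  "progressive T t X \<longleftrightarrow> (\<forall>s\<in>{t..T}.
     (\<lambda>(r, \<omega>). X r \<omega>) \<in> borel_measurable (restrict_space borel {t..s} \<Otimes>\<^sub>M Filt T t s))"

definition continuous_proc :: "real \<Rightarrow> real \<Rightarrow> ('d::finite, 'b::euclidean_space) process \<Rightarrow> bool" where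
  "continuous_proc T t X \<longleftrightarrow> (\<forall>(s, \<omega>)\<in>Lambda T t. \<forall>\<epsilon>>0. \<exists>\<delta>>0. \<forall>(s', \<omega>')\<in>Lambda T t.
     path_dist T t (s, \<omega>) (s', \<omega>') < \<delta> \<longrightarrow> dist (X s \<omega>) (X s' \<omega>') < \<epsilon>)"

definition C0 :: "real \<Rightarrow> real \<Rightarrow> ('d::finite, 'b::euclidean_space) process set" where
  "C0 T t = {X. progressive T t X \<and> continuous_proc T t X}"

definition bounded_proc :: "real \<Rightarrow> real \<Rightarrow> ('d::finite, 'b::euclidean_space) process \<Rightarrow> bool" where
  "bounded_proc T t X \<longleftrightarrow> (\<exists>C. \<forall>(s, \<omega>)\<in>Lambda T t. norm (X s \<omega>) \<le> C)"

definition modulus_of_continuity :: "(real \<Rightarrow> real) \<Rightarrow> bool" where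
  "modulus_of_continuity \<rho> \<longleftrightarrow>
     continuous_on {0..} \<rho> \<and> mono_on {0..} \<rho> \<and> (\<forall>x\<ge>0. 0 \<le> \<rho> x) \<and> \<rho> 0 = 0"


section \<open>Symmetric matrices\<close>

text \<open>
  On symmetric matrices the library's inner product on \<^typ>\<open>real ^ 'd ^ 'd\<close> is
  \<open>trace (\<gamma> ** \<gamma>')\<close>, and the library's norm is the Frobenius norm.
\<close>

definition Sym :: "(real ^ 'd ^ 'd) set" where
  "Sym = {\<gamma>. transpose \<gamma> = \<gamma>}"

definition psd :: "real ^ 'd ^ 'd::finite \<Rightarrow> bool" where
  "psd \<gamma> \<longleftrightarrow> (\<forall>x. 0 \<le> x \<bullet> (\<gamma> *v x))"


section \<open>Martingales, quadratic variation and stochastic integrals\<close>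

definition is_martingale ::
  "real \<Rightarrow> real \<Rightarrow> 'd::finite path measure \<Rightarrow> ('d, real) process \<Rightarrow> bool" where
  "is_martingale T t P M \<longleftrightarrow>
     (\<forall>s\<in>{t..T}. M s \<in> borel_measurable (Filt T t s) \<and> integrable P (M s)) \<and>
     (\<forall>s\<in>{t..T}. \<forall>r\<in>{s..T}. AE \<omega> in P. real_cond_exp P (Filt T t s) (M r) \<omega> = M s \<omega>)"

definition stopping_times :: "real \<Rightarrow> real \<Rightarrow> ('d::finite path \<Rightarrow> real) set" where
  "stopping_times T t = {\<tau>. stopping_time (Filt T t) \<tau> \<and> (\<forall>\<omega>\<in>Omega T t. \<tau> \<omega> \<in> {t..T})}"

definition is_local_martingale ::
  "real \<Rightarrow> real \<Rightarrow> 'd::finite path measure \<Rightarrow> ('d, real) process \<Rightarrow> bool" where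
  "is_local_martingale T t P M \<longleftrightarrow>
     (\<forall>s\<in>{t..T}. M s \<in> borel_measurable (Filt T t s)) \<and>
     (\<exists>\<tau> :: nat \<Rightarrow> 'd path \<Rightarrow> real. (\<forall>n. \<tau> n \<in> stopping_times T t) \<and>
        (AE \<omega> in P. incseq (\<lambda>n. \<tau> n \<omega>) \<and> (\<forall>\<^sub>F n in sequentially. \<tau> n \<omega> = T)) \<and>
        (\<forall>n. is_martingale T t P (\<lambda>s \<omega>. M (min s (\<tau> n \<omega>)) \<omega> - M t \<omega>)))"

definition bounded_variation :: "real \<Rightarrow> real \<Rightarrow> (real \<Rightarrow> real) \<Rightarrow> bool" where
  "bounded_variation t T f \<longleftrightarrow> (\<exists>C. \<forall>(m::nat) p.
     (\<forall>k<m. p k \<le> p (Suc k)) \<and> t \<le> p 0 \<and> p m \<le> T \<longrightarrow>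
     (\<Sum>k<m. \<bar>f (p (Suc k)) - f (p k)\<bar>) \<le> C)"

definition continuous_semimartingale ::
  "real \<Rightarrow> real \<Rightarrow> 'd::finite path measure \<Rightarrow> ('d, real) process \<Rightarrow> bool" where
  "continuous_semimartingale T t P X \<longleftrightarrow> (\<exists>A M.
     (\<forall>s\<in>{t..T}. A s \<in> borel_measurable (Filt T t s)) \<and> is_local_martingale T t P M \<and>
     (AE \<omega> in P. continuous_on {t..T} (\<lambda>s. A s \<omega>) \<and> continuous_on {t..T} (\<lambda>s. M s \<omega>) \<and>
        bounded_variation t T (\<lambda>s. A s \<omega>) \<and> (\<forall>s\<in>{t..T}. X s \<omega> = A s \<omega> + M s \<omega>)))"

definition fine_partition :: "real \<Rightarrow> real \<Rightarrow> real \<Rightarrow> nat \<Rightarrow> (nat \<Rightarrow> real) \<Rightarrow> bool" where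
  "fine_partition t s \<delta> N p \<longleftrightarrow>
     p 0 = t \<and> p N = s \<and> (\<forall>k<N. p k \<le> p (Suc k) \<and> p (Suc k) - p k < \<delta>)"

text \<open>\<open>S N p\<close> converges to \<open>I\<close> in probability as the mesh of the partition \<open>p\<close> of \<open>[t, s]\<close>
  tends to \<open>0\<close>.\<close>

definition mesh_limit :: "'d::finite path measure \<Rightarrow> real \<Rightarrow> real \<Rightarrow>
    (nat \<Rightarrow> (nat \<Rightarrow> real) \<Rightarrow> 'd path \<Rightarrow> 'b::euclidean_space) \<Rightarrow> ('d path \<Rightarrow> 'b) \<Rightarrow> bool" where
  "mesh_limit P t s S I \<longleftrightarrow> I \<in> borel_measurable P \<and>
     (\<forall>\<epsilon>>0. \<exists>\<delta>>0. \<forall>N p. fine_partition t s \<delta> N p \<longrightarrow>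
        measure P {\<omega> \<in> space P. norm (S N p \<omega> - I \<omega>) > \<epsilon>} < \<epsilon>)"

text \<open>
  \<open>quad_variation T t P Y Q\<close>: the continuous process \<open>Q\<close> is the (matrix valued) quadratic
  variation \<open>\<langle>Y\<rangle>\<close> of \<open>Y\<close> under \<open>P\<close>.
  \<open>stoch_integral T t P X Y J\<close>: the continuous process \<open>J\<close> is \<open>\<integral> X \<cdot> dY\<close> under \<open>P\<close>.
  It is used for continuous adapted integrands \<open>X\<close> only, and for \<open>Y\<close> either the canonical
  process under a semimartingale measure or its quadratic variation.  For these the limit of the
  left-endpoint sums exists and is the Ito integral, respectively the Stieltjes integral.
\<close>

definition quad_variation :: "real \<Rightarrow> real \<Rightarrow> 'd::finite path measure \<Rightarrow>
    ('d, real ^ 'd) process \<Rightarrow> ('d, real ^ 'd ^ 'd) process \<Rightarrow> bool" where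
  "quad_variation T t P Y Q \<longleftrightarrow>
     (AE \<omega> in P. continuous_on {t..T} (\<lambda>s. Q s \<omega>)) \<and>
     (\<forall>s\<in>{t..T}. mesh_limit P t s
        (\<lambda>N p \<omega>. \<Sum>k<N. \<chi> i j. (Y (p (Suc k)) \<omega> - Y (p k) \<omega>) $ i *
                                  (Y (p (Suc k)) \<omega> - Y (p k) \<omega>) $ j) (Q s))"

definition stoch_integral :: "real \<Rightarrow> real \<Rightarrow> 'd::finite path measure \<Rightarrow>
    ('d, 'b::euclidean_space) process \<Rightarrow> ('d, 'b) process \<Rightarrow> ('d, real) process \<Rightarrow> bool" where
  "stoch_integral T t P X Y J \<longleftrightarrow>
     (AE \<omega> in P. continuous_on {t..T} (\<lambda>s. J s \<omega>)) \<and>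
     (\<forall>s\<in>{t..T}. mesh_limit P t s
        (\<lambda>N p \<omega>. \<Sum>k<N. X (p k) \<omega> \<bullet> (Y (p (Suc k)) \<omega> - Y (p k) \<omega>)) (J s))"

definition PL :: "real \<Rightarrow> real \<Rightarrow> real \<Rightarrow> 'd::finite path measure set" where
  "PL T t L = {P. prob_space P \<and> sets P = sets (Filt T t T) \<and>
     (\<exists>(\<alpha> :: ('d, real ^ 'd) process) (\<beta> :: ('d, real ^ 'd ^ 'd) process).
        progressive T t \<alpha> \<and> progressive T t \<beta> \<and>
        (\<forall>(s, \<omega>)\<in>Lambda T t. norm (\<alpha> s \<omega>) \<le> L \<and>
           \<beta> s \<omega> \<in> Sym \<and> psd (\<beta> s \<omega>) \<and> norm (\<beta> s \<omega>) \<le> sqrt (2 * L)) \<and>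
        (let M = (\<lambda>s \<omega>. \<omega> s - (LINT r:{t..s}|lborel. \<alpha> r \<omega>)) in
           (\<forall>i. is_martingale T t P (\<lambda>s \<omega>. M s \<omega> $ i)) \<and>
           quad_variation T t P M (\<lambda>s \<omega>. LINT r:{t..s}|lborel. \<beta> r \<omega> ** \<beta> r \<omega>)))}"

definition Pinf :: "real \<Rightarrow> real \<Rightarrow> 'd::finite path measure set" where
  "Pinf T t = (\<Union>L\<in>{0<..}. PL T t L)"


section \<open>Nonlinear expectation\<close>

text \<open>The two expectations are meaningful for \<open>\<xi> \<in> expectation_domain T t L\<close> only.\<close>

definition expectation_domain :: "real \<Rightarrow> real \<Rightarrow> real \<Rightarrow> ('d::finite path \<Rightarrow> real) set" where
  "expectation_domain T t L = {\<xi>. \<xi> \<in> borel_measurable (Filt T t T) \<and>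
     (SUP P\<in>PL T t L. \<integral>\<^sup>+ \<omega>. ennreal \<bar>\<xi> \<omega>\<bar> \<partial>P) < \<infinity>}"

definition upper_expectation :: "real \<Rightarrow> real \<Rightarrow> real \<Rightarrow> ('d::finite path \<Rightarrow> real) \<Rightarrow> real" where
  "upper_expectation T t L \<xi> = (SUP P\<in>PL T t L. LINT \<omega>|P. \<xi> \<omega>)"

definition lower_expectation :: "real \<Rightarrow> real \<Rightarrow> real \<Rightarrow> ('d::finite path \<Rightarrow> real) \<Rightarrow> real" where
  "lower_expectation T t L \<xi> = (INF P\<in>PL T t L. LINT \<omega>|P. \<xi> \<omega>)"

definition hitting_times :: "real \<Rightarrow> real \<Rightarrow> ('d::finite path \<Rightarrow> real) set" where
  "hitting_times T t = {\<lambda>\<omega>. Inf ({s \<in> {t..T}. \<omega> s \<notin> D} \<union> {t\<^sub>0}) | D t\<^sub>0.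
     t < t\<^sub>0 \<and> t\<^sub>0 \<le> T \<and> open D \<and> convex D \<and> 0 \<in> D}"


section \<open>Path derivatives\<close>

text \<open>\<open>path_derivs T t u a p q\<close>: \<open>u \<in> C\<^sup>1\<^sup>,\<^sup>2\<close> on \<open>Lambda T t\<close> with
  \<open>\<partial>\<^sub>t u = a\<close>, \<open>\<partial>\<^sub>\<omega> u = p\<close>, \<open>\<partial>\<^sup>2\<^sub>\<omega>\<^sub>\<omega> u = q\<close>; the process \<open>Q\<close> is \<open>\<langle>B\<rangle>\<close>
  under \<open>P\<close>.\<close>

definition path_derivs :: "real \<Rightarrow> real \<Rightarrow> ('d::finite, real) process \<Rightarrow> ('d, real) process \<Rightarrow>
    ('d, real ^ 'd) process \<Rightarrow> ('d, real ^ 'd ^ 'd) process \<Rightarrow> bool" where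
  "path_derivs T t u a p q \<longleftrightarrow>
     u \<in> C0 T t \<and> a \<in> C0 T t \<and> p \<in> C0 T t \<and> q \<in> C0 T t \<and>
     (\<forall>(s, \<omega>)\<in>Lambda T t. q s \<omega> \<in> Sym) \<and>
     (\<forall>P\<in>Pinf T t. continuous_semimartingale T t P u \<and>
        (\<exists>Q J K. quad_variation T t P (\<lambda>s \<omega>. \<omega> s) Q \<and>
           stoch_integral T t P p (\<lambda>s \<omega>. \<omega> s) J \<and> stoch_integral T t P q Q K \<and>
           (AE \<omega> in P. \<forall>s\<in>{t..T}.
              u s \<omega> - u t \<omega> = (LINT r:{t..s}|lborel. a r \<omega>) + J s \<omega> + 1/2 * K s \<omega>)))"

definition C12b_derivs :: "real \<Rightarrow> real \<Rightarrow> ('d::finite, real) process \<Rightarrow> ('d, real) process \<Rightarrow>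
    ('d, real ^ 'd) process \<Rightarrow> ('d, real ^ 'd ^ 'd) process \<Rightarrow> bool" where
  "C12b_derivs T t u a p q \<longleftrightarrow> path_derivs T t u a p q \<and>
     bounded_proc T t u \<and> bounded_proc T t a \<and> bounded_proc T t p \<and> bounded_proc T t q"

definition C12b :: "real \<Rightarrow> real \<Rightarrow> ('d::finite, real) process set" where
  "C12b T t = {u. \<exists>a p q. C12b_derivs T t u a p q}"

definition C24b :: "real \<Rightarrow> real \<Rightarrow> ('d::finite, real) process set" where
  "C24b T t = {u. \<exists>a p q. C12b_derivs T t u a p q \<and> a \<in> C12b T t \<and>
     (\<forall>i. (\<lambda>s \<omega>. p s \<omega> $ i) \<in> C12b T t) \<and> (\<forall>i j. (\<lambda>s \<omega>. q s \<omega> $ i $ j) \<in> C12b T t)}"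


section \<open>The PPDE\<close>

type_synonym 'd generator =
  "real \<Rightarrow> 'd path \<Rightarrow> real \<Rightarrow> real ^ 'd \<Rightarrow> real ^ 'd ^ 'd \<Rightarrow> real"

definition classical_solution :: "real \<Rightarrow> 'd::finite generator \<Rightarrow> ('d, real) process \<Rightarrow> bool" where
  "classical_solution T G u \<longleftrightarrow> (\<exists>a p q. path_derivs T 0 u a p q \<and>
     (\<forall>t\<in>{0..<T}. \<forall>\<omega>\<in>Omega T 0. - a t \<omega> - G t \<omega> (u t \<omega>) (p t \<omega>) (q t \<omega>) = 0))"

definition U_lower :: "real \<Rightarrow> ('d::finite, real) process set" where
  "U_lower T = {u. progressive T 0 u \<and>
     (\<exists>C. \<forall>(t, \<omega>)\<in>Lambda T 0. u t \<omega> \<le> C) \<and>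
     (\<forall>(t, \<omega>)\<in>Lambda T 0. \<forall>\<epsilon>>0. \<exists>\<delta>>0. \<forall>(s, \<omega>')\<in>Lambda T t.
        path_dist T t (s, \<omega>') (t, zero_path T t) \<le> \<delta> \<longrightarrow>
        \<bar>shift_proc T 0 t \<omega> u s \<omega>' - u t \<omega>\<bar> \<le> \<epsilon>) \<and>
     (\<exists>\<rho>. modulus_of_continuity \<rho> \<and>
        (\<forall>(t, \<omega>)\<in>Lambda T 0. \<forall>(t', \<omega>')\<in>Lambda T 0. t \<le> t' \<longrightarrow>
           u t \<omega> - u t' \<omega>' \<le> \<rho> (path_dist T 0 (t, \<omega>) (t', \<omega>'))))}"

definition U_upper :: "real \<Rightarrow> ('d::finite, real) process set" where
  "U_upper T = {u. (\<lambda>t \<omega>. - u t \<omega>) \<in> U_lower T}"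

text \<open>The infimum and supremum over stopping times are taken in \<^typ>\<open>ereal\<close>, since an unbounded
  infimum in \<^typ>\<open>real\<close> is an arbitrary number.\<close>

definition A_lower :: "real \<Rightarrow> real \<Rightarrow> ('d::finite, real) process \<Rightarrow> real \<Rightarrow> 'd path \<Rightarrow>
    ('d, real) process set" where
  "A_lower T L u t \<omega> = {\<phi>. (\<exists>a p q. path_derivs T t \<phi> a p q) \<and>
     (let Y = (\<lambda>s \<omega>'. \<phi> s \<omega>' - shift_proc T 0 t \<omega> u s \<omega>') in
      \<exists>H\<in>hitting_times T t. (\<forall>\<omega>'\<in>Omega T t. Y t \<omega>' = 0) \<and>
        (\<forall>\<tau>\<in>stopping_times T t.
           (\<lambda>\<omega>'. Y (min (\<tau> \<omega>') (H \<omega>')) \<omega>') \<in> expectation_domain T t L) \<and>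
        (INF \<tau>\<in>stopping_times T t.
           ereal (lower_expectation T t L (\<lambda>\<omega>'. Y (min (\<tau> \<omega>') (H \<omega>')) \<omega>'))) = 0)}"

definition A_upper :: "real \<Rightarrow> real \<Rightarrow> ('d::finite, real) process \<Rightarrow> real \<Rightarrow> 'd path \<Rightarrow>
    ('d, real) process set" where
  "A_upper T L u t \<omega> = {\<phi>. (\<exists>a p q. path_derivs T t \<phi> a p q) \<and>
     (let Y = (\<lambda>s \<omega>'. \<phi> s \<omega>' - shift_proc T 0 t \<omega> u s \<omega>') in
      \<exists>H\<in>hitting_times T t. (\<forall>\<omega>'\<in>Omega T t. Y t \<omega>' = 0) \<and>
        (\<forall>\<tau>\<in>stopping_times T t.
           (\<lambda>\<omega>'. Y (min (\<tau> \<omega>') (H \<omega>')) \<omega>') \<in> expectation_domain T t L) \<and>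
        (SUP \<tau>\<in>stopping_times T t.
           ereal (upper_expectation T t L (\<lambda>\<omega>'. Y (min (\<tau> \<omega>') (H \<omega>')) \<omega>'))) = 0)}"

text \<open>\<open>\<L>\<^sup>t\<^sup>,\<^sup>\<omega> \<phi> (t, 0)\<close>, where \<open>a\<close>, \<open>p\<close>, \<open>q\<close> are the path derivatives of \<open>\<phi>\<close>.\<close>

definition L_op :: "real \<Rightarrow> 'd::finite generator \<Rightarrow> real \<Rightarrow> 'd path \<Rightarrow> ('d, real) process \<Rightarrow>
    ('d, real) process \<Rightarrow> ('d, real ^ 'd) process \<Rightarrow> ('d, real ^ 'd ^ 'd) process \<Rightarrow> real" where
  "L_op T G t \<omega> \<phi> a p q = (let z = zero_path T t in
     - a t z - shift_proc T 0 t \<omega> G t z (\<phi> t z) (p t z) (q t z))"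

definition viscosity_subsolution ::
  "real \<Rightarrow> 'd::finite generator \<Rightarrow> ('d, real) process \<Rightarrow> bool" where
  "viscosity_subsolution T G u \<longleftrightarrow> u \<in> U_lower T \<and>
     (\<exists>L>0. \<forall>t\<in>{0..<T}. \<forall>\<omega>\<in>Omega T 0. \<forall>\<phi>\<in>A_lower T L u t \<omega>. \<forall>a p q.
        path_derivs T t \<phi> a p q \<longrightarrow> L_op T G t \<omega> \<phi> a p q \<le> 0)"

definition viscosity_supersolution ::
  "real \<Rightarrow> 'd::finite generator \<Rightarrow> ('d, real) process \<Rightarrow> bool" where
  "viscosity_supersolution T G u \<longleftrightarrow> u \<in> U_upper T \<and>
     (\<exists>L>0. \<forall>t\<in>{0..<T}. \<forall>\<omega>\<in>Omega T 0. \<forall>\<phi>\<in>A_upper T L u t \<omega>. \<forall>a p q.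
        path_derivs T t \<phi> a p q \<longrightarrow> L_op T G t \<omega> \<phi> a p q \<ge> 0)"

definition comparison_principle ::
  "real \<Rightarrow> 'd::finite generator \<Rightarrow> ('d path \<Rightarrow> real) \<Rightarrow> bool" where
  "comparison_principle T G g \<longleftrightarrow> (\<forall>u\<^sub>1 u\<^sub>2.
     viscosity_subsolution T G u\<^sub>1 \<and> bounded_proc T 0 u\<^sub>1 \<and>
     viscosity_supersolution T G u\<^sub>2 \<and> bounded_proc T 0 u\<^sub>2 \<and>
     (\<forall>\<omega>\<in>Omega T 0. u\<^sub>1 T \<omega> \<le> g \<omega> \<and> g \<omega> \<le> u\<^sub>2 T \<omega>) \<longrightarrow>
     (\<forall>(t, \<omega>)\<in>Lambda T 0. u\<^sub>1 t \<omega> \<le> u\<^sub>2 t \<omega>))"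

text \<open>\<open>c\<close> and \<open>\<Gamma>\<close> are the gradients of \<open>G\<close> in \<open>z\<close> and in the symmetric matrix \<open>\<gamma>\<close>.  The latter is
  the symmetric matrix representing the derivative along symmetric directions.\<close>

definition has_gradients :: "'d::finite generator \<Rightarrow> real \<Rightarrow> 'd path \<Rightarrow> real \<Rightarrow> real ^ 'd \<Rightarrow>
    real ^ 'd ^ 'd \<Rightarrow> real ^ 'd \<Rightarrow> real ^ 'd ^ 'd \<Rightarrow> bool" where
  "has_gradients G t \<omega> y z \<gamma> c \<Gamma> \<longleftrightarrow> \<Gamma> \<in> Sym \<and>
     ((\<lambda>(z, \<gamma>). G t \<omega> y z \<gamma>) has_derivative (\<lambda>(z', \<gamma>'). c \<bullet> z' + \<Gamma> \<bullet> \<gamma>'))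
       (at (z, \<gamma>) within UNIV \<times> Sym)"


section \<open>The scheme\<close>

text \<open>All paths of a Brownian motion are required to be continuous, so that the laws below are
  measures on \<open>Omega T t\<close>.\<close>

definition brownian_motion :: "'w measure \<Rightarrow> (real \<Rightarrow> 'w \<Rightarrow> real) \<Rightarrow> bool" where
  "brownian_motion N W \<longleftrightarrow> prob_space N \<and>
     (\<forall>s\<ge>0. W s \<in> borel_measurable N) \<and>
     (\<forall>x\<in>space N. W 0 x = 0 \<and> continuous_on {0..} (\<lambda>s. W s x)) \<and>
     (\<forall>s r. 0 \<le> s \<and> s < r \<longrightarrow>
        distributed N lborel (\<lambda>x. W r x - W s x) (normal_density 0 (sqrt (r - s)))) \<and>
     (\<forall>(m::nat) \<theta>. 0 \<le> \<theta> 0 \<and> (\<forall>k<m. \<theta> k \<le> \<theta> (Suc k)) \<longrightarrow>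
        prob_space.indep_vars N (\<lambda>_. borel) (\<lambda>k x. W (\<theta> (Suc k)) x - W (\<theta> k) x) {..<m})"

definition law_drift :: "real \<Rightarrow> real \<Rightarrow> real ^ 'd::finite \<Rightarrow> 'd path measure" where
  "law_drift T t v = return (Filt T t T) (\<lambda>s\<in>{t..T}. (s - t) *\<^sub>R v)"

definition law_BM :: "'w measure \<Rightarrow> (real \<Rightarrow> 'w \<Rightarrow> real) \<Rightarrow> real \<Rightarrow> real \<Rightarrow> real ^ 'd::finite \<Rightarrow>
    'd path measure" where
  "law_BM N W T t v = distr N (Filt T t T) (\<lambda>x. \<lambda>s\<in>{t..T}. W (s - t) x *\<^sub>R v)"

definition D0 :: "real \<Rightarrow> real \<Rightarrow> ('d::finite path \<Rightarrow> real) \<Rightarrow> real" where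
  "D0 T t \<phi> = (LINT \<omega>|return (Filt T t T) (zero_path T t). \<phi> \<omega>)"

definition D1 :: "('d::finite \<Rightarrow> real) \<Rightarrow> real \<Rightarrow> real \<Rightarrow> real \<Rightarrow> ('d path \<Rightarrow> real) \<Rightarrow> real ^ 'd" where
  "D1 \<mu> T t h \<phi> = (\<chi> i. ((LINT \<omega>|law_drift T t (\<mu> i *\<^sub>R axis i 1). \<phi> \<omega>) - D0 T t \<phi>) / (\<mu> i * h))"

definition D2 :: "('d::finite \<Rightarrow> real) \<Rightarrow> 'w measure \<Rightarrow> (real \<Rightarrow> 'w \<Rightarrow> real) \<Rightarrow> real \<Rightarrow> real \<Rightarrow> real \<Rightarrow>
    ('d path \<Rightarrow> real) \<Rightarrow> real ^ 'd ^ 'd" where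
  "D2 \<sigma> N W T t h \<phi> = (let
     E1 = (\<lambda>i. LINT \<omega>|law_BM N W T t (\<sigma> i *\<^sub>R axis i 1). \<phi> \<omega>);
     E2 = (\<lambda>i j. LINT \<omega>|law_BM N W T t (\<sigma> i *\<^sub>R axis i 1 + \<sigma> j *\<^sub>R axis j 1). \<phi> \<omega>) in
     (\<chi> i j. if i = j then (E1 i - D0 T t \<phi>) / ((\<sigma> i)\<^sup>2 * h / 2)
             else (E2 i j - E1 i - E1 j + D0 T t \<phi>) / (\<sigma> i * \<sigma> j * h)))"

definition scheme :: "'d::finite generator \<Rightarrow> ('d \<Rightarrow> real) \<Rightarrow> ('d \<Rightarrow> real) \<Rightarrow> 'w measure \<Rightarrow>
    (real \<Rightarrow> 'w \<Rightarrow> real) \<Rightarrow> real \<Rightarrow> real \<Rightarrow> 'd path \<Rightarrow> real \<Rightarrow> ('d path \<Rightarrow> real) \<Rightarrow> real" where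
  "scheme G \<mu> \<sigma> N W T t \<omega> h \<phi> =
     D0 T t \<phi> + h * G t \<omega> (D0 T t \<phi>) (D1 \<mu> T t h \<phi>) (D2 \<sigma> N W T t h \<phi>)"

definition grid :: "real \<Rightarrow> nat \<Rightarrow> nat \<Rightarrow> real" where
  "grid T n i = real i * (T / real n)"

text \<open>The backward recursion below determines \<open>uh\<close> on \<open>Lambda T 0\<close>.\<close>

definition discrete_approximation :: "'d::finite generator \<Rightarrow> ('d path \<Rightarrow> real) \<Rightarrow>
    ('d \<Rightarrow> real) \<Rightarrow> ('d \<Rightarrow> real) \<Rightarrow> 'w measure \<Rightarrow> (real \<Rightarrow> 'w \<Rightarrow> real) \<Rightarrow> real \<Rightarrow> nat \<Rightarrow>
    ('d, real) process \<Rightarrow> bool" where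
  "discrete_approximation G g \<mu> \<sigma> N W T n uh \<longleftrightarrow> (\<forall>\<omega>\<in>Omega T 0.
     uh (grid T n n) \<omega> = g \<omega> \<and>
     (\<forall>i\<in>{1..n}. \<forall>t\<in>{grid T n (i - 1)..<grid T n i}.
        uh t \<omega> = scheme G \<mu> \<sigma> N W T t \<omega> (grid T n i - t) (shift_rv T 0 t \<omega> (uh (grid T n i)))))"

end

theory Submission
  imports Defs "HOL-Real_Asymp.Real_Asymp"
begin

text \<open>
  The expectations in the scheme are taken under the laws of \<open>s \<mapsto> (s - t) b + W\<^sub>s\<^sub>-\<^sub>t v\<close>.  For a smooth path \<open>l\<close> on
  \<open>[0, t]\<close>, the law of \<open>l\<close> followed by this process belongs to \<open>\<P>\<^sub>\<infinity>\<close>, so the definition of the path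
  derivatives provides an Ito formula along it; taking expectations and approximating an arbitrary
  continuous path by polynomials yields
  \<open>\<bar>E u(s, \<omega> \<otimes>\<^sub>t \<cdot>) - u(t, \<omega>) - (s - t) (\<partial>\<^sub>t u + \<partial>\<^sub>\<omega> u \<cdot> b + \<partial>\<^sup>2\<^sub>\<omega>\<^sub>\<omega> u : v v\<^sup>T / 2)(t, \<omega>)\<bar> \<le> C (s - t)\<^sup>2\<close>,
  where the remainder is controlled because the derivatives of \<open>u\<close> have path derivatives themselves.
  The difference quotients of the scheme are exact on such expansions, whence a local error of order \<open>h\<^sup>2\<close>.
  By the mean value theorem and the monotonicity condition, a step of the scheme applied to a difference
  is a convex combination of expectations up to a factor \<open>1 + L h\<close>, so the local errors add up to \<open>O(h)\<close>.
  Linearity of the expectations requires the discrete approximation to be measurable, which follows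
  from its Lipschitz continuity in the path.
\<close>

section \<open>Path spaces\<close>

text \<open>Path derivatives are specified only by the formula for du under measures with bounded
  drift and volatility on paths starting at time 0. A fixed initial segment can be part of such a
  law only if it is the integral of a bounded drift; this is the obstacle behind the approximation
  of \<omega>, and the reason why every constant has to be uniform in the initial segment: only then
  does it survive the limit. No general stochastic integral is constructed. It enters as a limit in
  probability of left-endpoint sums, whose zero mean and L2 bounds come from the independence of
  Brownian increments. The zero mean passes to the limit by uniform integrability, which is where
  boundedness of u and its derivatives enters. The classical solution and the \<open>C24b\<close>
  regularity each assert that some derivatives exist, not the same ones. That they agree before T is
  extracted from the Ito formula by varying b and v. The second-order quotients divide by h. An
  error h^2 in the expectations therefore becomes h in the arguments of G, and the factor h in front
  of G restores h^2.\<close>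

lemma space_Filt [simp]: "space (Filt T t s) = Omega T t"
  unfolding Filt_def by (rule space_measure_of) auto

lemma sets_Filt: "sets (Filt T t s) = sigma_sets (Omega T t)
     {(\<lambda>\<omega>. \<omega> r) -` A \<inter> Omega T t | r A. r \<in> {t..s} \<and> A \<in> sets borel}"
  unfolding Filt_def by (rule sets_measure_of) auto

lemma measurable_eval_Filt:
  assumes "r \<in> {t..s}"
  shows "(\<lambda>\<omega>. \<omega> r) \<in> borel_measurable (Filt T t s)"
proof (rule measurableI)
  fix A :: "(real ^ 'a) set" assume "A \<in> sets borel"
  then show "(\<lambda>\<omega>. \<omega> r) -` A \<inter> space (Filt T t s) \<in> sets (Filt T t s)"
    unfolding space_Filt sets_Filt using assms
    by (intro sigma_sets.Basic CollectI exI[of _ r] exI[of _ A] conjI refl)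
qed simp

lemma measurable_into_Filt:
  fixes X :: "'a \<Rightarrow> 'd::finite path"
  assumes "\<And>x. x \<in> space M \<Longrightarrow> X x \<in> Omega T t"
    and "\<And>r. r \<in> {t..s} \<Longrightarrow> (\<lambda>x. X x r) \<in> borel_measurable M"
  shows "X \<in> measurable M (Filt T t s)"
  unfolding Filt_def
proof (rule measurable_measure_of)
  show "X \<in> space M \<rightarrow> Omega T t" using assms(1) by auto
  fix Y assume "Y \<in> {(\<lambda>\<omega>::'d path. \<omega> r) -` A \<inter> Omega T t | r A. r \<in> {t..s} \<and> A \<in> sets borel}"
  then obtain r A where r: "r \<in> {t..s}" "A \<in> sets borel"
    and Y: "Y = (\<lambda>\<omega>. \<omega> r) -` A \<inter> Omega T t" by blast
  have "X -` Y \<inter> space M = (\<lambda>x. X x r) -` A \<inter> space M"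
    using assms(1) by (auto simp: Y)
  then show "X -` Y \<inter> space M \<in> sets M"
    using measurable_sets[OF assms(2)[OF r(1)] r(2)] by simp
qed auto

lemma sets_Filt_mono:
  assumes "s \<le> s'"
  shows "sets (Filt T t s) \<subseteq> sets (Filt T t s')"
  unfolding sets_Filt
proof (rule sigma_sets_mono')
  have "r \<in> {t..s'}" if "r \<in> {t..s}" for r using that assms by auto
  then show "{(\<lambda>\<omega>. \<omega> r) -` A \<inter> Omega T t | r A. r \<in> {t..s} \<and> A \<in> sets borel}
    \<subseteq> {(\<lambda>\<omega>. \<omega> r) -` A \<inter> Omega T t | r A. r \<in> {t..s'} \<and> A \<in> sets borel}"
    by (intro Collect_mono impI) metis
qed

lemma Filt_measurable_mono:
  assumes "f \<in> borel_measurable (Filt T t s)" "s \<le> s'"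
  shows "f \<in> borel_measurable (Filt T t s')"
  using measurable_mono[OF order_refl refl sets_Filt_mono[OF assms(2), of T t]] assms(1) by auto

lemma progressive_measurable:
  assumes "progressive T t Y" "s \<in> {t..T}"
  shows "Y s \<in> borel_measurable (Filt T t s)"
proof -
  have "(\<lambda>\<omega>. (s, \<omega>)) \<in> measurable (Filt T t s) (restrict_space borel {t..s} \<Otimes>\<^sub>M Filt T t s)"
    using assms(2) by (intro measurable_Pair measurable_const measurable_ident_sets refl) (auto simp: space_restrict_space)
  moreover have "(\<lambda>(r, \<omega>). Y r \<omega>) \<in> borel_measurable (restrict_space borel {t..s} \<Otimes>\<^sub>M Filt T t s)"
    using assms unfolding progressive_def by blast
  ultimately show ?thesis by (auto dest: measurable_compose)
qed

lemma OmegaD: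
  assumes "\<omega> \<in> Omega T t"
  shows "\<omega> \<in> extensional {t..T}" "continuous_on {t..T} \<omega>" "\<omega> t = 0"
  using assms by (auto simp: Omega_def)

section \<open>Sup norm of paths and processes that are continuous under the path distance\<close>

lemma path_norm_leI:
  assumes "t \<le> s" "\<And>r. r \<in> {t..s} \<Longrightarrow> norm (\<omega> r) \<le> c"
  shows "path_norm t s \<omega> \<le> c"
  unfolding path_norm_def using assms by (intro cSUP_least) auto

lemma norm_le_path_norm:
  assumes "continuous_on {t..s} \<omega>" "r \<in> {t..s}"
  shows "norm (\<omega> r) \<le> path_norm t s \<omega>"
  unfolding path_norm_def
proof (rule cSUP_upper)
  have "compact ((\<lambda>r. norm (\<omega> r)) ` {t..s})"
    using assms(1) by (intro compact_continuous_image continuous_intros) auto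
  then show "bdd_above ((\<lambda>r. norm (\<omega> r)) ` {t..s})"
    by (intro bounded_imp_bdd_above compact_imp_bounded)
qed (use assms in auto)

lemma continuous_procD:
  assumes "continuous_proc T t Y" "s \<in> {t..T}" "\<omega> \<in> Omega T t" "\<epsilon> > 0"
  shows "\<exists>\<delta>>0. \<forall>s'\<in>{t..T}. \<forall>\<omega>'\<in>Omega T t.
     path_dist T t (s, \<omega>) (s', \<omega>') < \<delta> \<longrightarrow> dist (Y s \<omega>) (Y s' \<omega>') < \<epsilon>"
proof -
  have "\<forall>\<epsilon>>0. \<exists>\<delta>>0. \<forall>(s', \<omega>')\<in>Lambda T t.
     path_dist T t (s, \<omega>) (s', \<omega>') < \<delta> \<longrightarrow> dist (Y s \<omega>) (Y s' \<omega>') < \<epsilon>"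
    using assms(1-3) unfolding continuous_proc_def by (auto simp: Lambda_def)
  then show ?thesis using assms(4) by (simp add: Lambda_def)
qed

lemma path_dist_same_time_le:
  assumes "t \<le> T" "s \<in> {t..T}" "\<And>r. r \<in> {t..s} \<Longrightarrow> norm (\<omega> r - \<omega>' r) \<le> c"
  shows "path_dist T t (s, \<omega>) (s, \<omega>') \<le> c"
  unfolding path_dist_def using assms by (auto intro!: path_norm_leI)

text \<open>At equal times \<open>path_dist\<close> compares the paths stopped at s, so paths that
  agree up to s are at distance 0, and continuity cannot separate their values.\<close>

lemma continuous_proc_nonanticipative:
  fixes Y :: "('d::finite, 'b::euclidean_space) process"
  assumes "continuous_proc T t Y" "s \<in> {t..T}" "\<omega> \<in> Omega T t" "\<omega>' \<in> Omega T t"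
    and "\<And>r. r \<in> {t..s} \<Longrightarrow> \<omega> r = \<omega>' r"
  shows "Y s \<omega> = Y s \<omega>'"
proof -
  have "dist (Y s \<omega>) (Y s \<omega>') < \<epsilon>" if pos: "\<epsilon> > 0" for \<epsilon>
  proof -
    obtain \<delta> where "\<delta> > 0" and \<delta>: "\<And>s' \<omega>'. s' \<in> {t..T} \<Longrightarrow> \<omega>' \<in> Omega T t \<Longrightarrow>
     path_dist T t (s, \<omega>) (s', \<omega>') < \<delta> \<Longrightarrow> dist (Y s \<omega>) (Y s' \<omega>') < \<epsilon>"
      using continuous_procD[OF assms(1-3) pos] by blast
    have "path_dist T t (s, \<omega>) (s, \<omega>') \<le> 0"
      using assms by (intro path_dist_same_time_le) auto
    then show ?thesis using \<delta>[OF assms(2,4)] \<open>\<delta> > 0\<close> by simp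
  qed
  then show ?thesis by (metis dist_pos_lt less_irrefl)
qed

text \<open>Uniform closeness is asked on [t, s] only: what the approximating paths do after s is
  invisible to the process at time s.\<close>

lemma continuous_proc_tendsto:
  fixes Y :: "('d::finite, 'b::euclidean_space) process"
  assumes "continuous_proc T t Y" "s \<in> {t..T}" "\<omega> \<in> Omega T t" "\<And>m. \<omega>' m \<in> Omega T t"
    and "\<And>m r. r \<in> {t..s} \<Longrightarrow> norm (\<omega> r - \<omega>' m r) \<le> e m" "e \<longlonglongrightarrow> 0"
  shows "(\<lambda>m. Y s (\<omega>' m)) \<longlonglongrightarrow> Y s \<omega>"
proof (rule metric_LIMSEQ_I)
  fix \<epsilon> :: real assume "\<epsilon> > 0"
  obtain \<delta> where "\<delta> > 0" and \<delta>: "\<And>s' \<omega>'. s' \<in> {t..T} \<Longrightarrow> \<omega>' \<in> Omega T t \<Longrightarrow>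
     path_dist T t (s, \<omega>) (s', \<omega>') < \<delta> \<Longrightarrow> dist (Y s \<omega>) (Y s' \<omega>') < \<epsilon>"
    using continuous_procD[OF assms(1-3) \<open>\<epsilon> > 0\<close>] by blast
  have "\<forall>\<^sub>F m in sequentially. e m < \<delta>" using assms(6) \<open>\<delta> > 0\<close> by (rule order_tendstoD)
  then obtain m0 where m0: "\<And>m. m \<ge> m0 \<Longrightarrow> e m < \<delta>" by (auto simp: eventually_sequentially)
  have "dist (Y s (\<omega>' m)) (Y s \<omega>) < \<epsilon>" if "m \<ge> m0" for m
  proof -
    have "path_dist T t (s, \<omega>) (s, \<omega>' m) \<le> e m"
      using assms by (intro path_dist_same_time_le) auto
    then show ?thesis using \<delta>[OF assms(2,4), of m] m0[OF that] by (simp add: dist_commute)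
  qed
  then show "\<exists>no. \<forall>n\<ge>no. dist (Y s (\<omega>' n)) (Y s \<omega>) < \<epsilon>" by blast
qed

lemma continuous_proc_continuous_on_time:
  fixes Y :: "('d::finite, 'b::euclidean_space) process"
  assumes "continuous_proc T t Y" "\<omega> \<in> Omega T t"
  shows "continuous_on {t..T} (\<lambda>s. Y s \<omega>)"
  unfolding continuous_on_iff
proof (intro ballI allI impI)
  fix s and \<epsilon> :: real assume s: "s \<in> {t..T}" and "\<epsilon> > 0"
  obtain \<delta> where "\<delta> > 0" and \<delta>: "\<And>s' \<omega>'. s' \<in> {t..T} \<Longrightarrow> \<omega>' \<in> Omega T t \<Longrightarrow>
     path_dist T t (s, \<omega>) (s', \<omega>') < \<delta> \<Longrightarrow> dist (Y s \<omega>) (Y s' \<omega>') < \<epsilon>"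
    using continuous_procD[OF assms(1) s assms(2) \<open>\<epsilon> > 0\<close>] by blast
  have "uniformly_continuous_on {t..T} \<omega>"
    using OmegaD[OF assms(2)] by (intro compact_uniformly_continuous) auto
  moreover have "\<delta> / 3 > 0" using \<open>\<delta> > 0\<close> by simp
  ultimately obtain \<eta> where "\<eta> > 0" and \<eta>: "\<And>x y. x \<in> {t..T} \<Longrightarrow> y \<in> {t..T} \<Longrightarrow>
      dist x y < \<eta> \<Longrightarrow> dist (\<omega> x) (\<omega> y) < \<delta> / 3"
    unfolding uniformly_continuous_on_def by metis
  \<comment> \<open>The bound \<eta> makes the displacement of the stopped path at most \<delta>/3,
    and (\<delta>/3)^2 does the same for the square root of the time difference.\<close>
  define \<kappa> where "\<kappa> = min \<eta> ((\<delta> / 3)\<^sup>2)"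
  have "\<kappa> > 0" using \<open>\<eta> > 0\<close> \<open>\<delta> > 0\<close> by (simp add: \<kappa>_def)
  moreover have "dist (Y s' \<omega>) (Y s \<omega>) < \<epsilon>" if s': "s' \<in> {t..T}" "dist s' s < \<kappa>" for s'
  proof -
    have "path_norm t T (\<lambda>r. \<omega> (min r s) - \<omega> (min r s')) \<le> \<delta> / 3"
    proof (rule path_norm_leI)
      fix r assume "r \<in> {t..T}"
      moreover have "dist (min r s) (min r s') \<le> dist s' s"
        by (auto simp: dist_real_def min_def)
      ultimately have "dist (\<omega> (min r s)) (\<omega> (min r s')) < \<delta> / 3"
        using s s' by (intro \<eta>) (auto simp: \<kappa>_def)
      then show "norm (\<omega> (min r s) - \<omega> (min r s')) \<le> \<delta> / 3" by (simp add: dist_norm)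
    qed (use s in simp)
    moreover have "sqrt \<bar>s - s'\<bar> < \<delta> / 3"
      using s'(2) \<open>\<delta> > 0\<close> by (intro real_less_lsqrt) (auto simp: \<kappa>_def dist_real_def)
    ultimately have "path_dist T t (s, \<omega>) (s', \<omega>) < \<delta>"
      unfolding path_dist_def using \<open>\<delta> > 0\<close> by simp
    then show ?thesis using \<delta>[OF s'(1) assms(2)] by (simp add: dist_commute)
  qed
  ultimately show "\<exists>d>0. \<forall>x'\<in>{t..T}. dist x' s < d \<longrightarrow> dist (Y x' \<omega>) (Y s \<omega>) < \<epsilon>" by blast
qed

section \<open>Lipschitz functionals are measurable\<close>

text \<open>Restricts a functional on path space to a family with finitely many parameters. The
  coefficient with index 0 is overwritten by 0, so the path starts at 0 whatever x is.\<close>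

definition bernstein_path :: "real \<Rightarrow> nat \<Rightarrow> (nat \<Rightarrow> real ^ 'd) \<Rightarrow> 'd::finite path" where
  "bernstein_path T n x = (\<lambda>s\<in>{0..T}. \<Sum>k\<le>n. Bernstein n k (s / T) *\<^sub>R (if k = 0 then 0 else x k))"

lemma bernstein_path_in_Omega:
  assumes "T > 0"
  shows "bernstein_path T n x \<in> Omega T 0"
proof -
  have "continuous_on {0..T} (\<lambda>s. \<Sum>k\<le>n. Bernstein n k (s / T) *\<^sub>R (if k = 0 then 0 else x k))"
    unfolding Bernstein_def by (intro continuous_intros) (use assms in auto)
  then have "continuous_on {0..T} (bernstein_path T n x)"
    by (rule continuous_on_eq) (simp add: bernstein_path_def)
  moreover have "(\<Sum>k\<le>n. Bernstein n k 0 *\<^sub>R (if k = 0 then 0 else x k)) = 0"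
    by (intro sum.neutral) (auto simp: Bernstein_def)
  ultimately show ?thesis
    using assms by (simp add: Omega_def bernstein_path_def)
qed

lemma Bernstein_le_1:
  assumes "0 \<le> x" "x \<le> 1" "k \<le> n"
  shows "Bernstein n k x \<le> 1"
  using member_le_sum[of k "{..n}" "\<lambda>k. Bernstein n k x"] assms by (auto simp: Bernstein_nonneg)

lemma norm_bernstein_path_diff:
  assumes "T > 0" "s \<in> {0..T}"
  shows "norm (bernstein_path T n x s - bernstein_path T n y s) \<le> (\<Sum>k\<le>n. norm (x k - y k))"
proof -
  have "bernstein_path T n x s - bernstein_path T n y s =
     (\<Sum>k\<le>n. Bernstein n k (s / T) *\<^sub>R (if k = 0 then 0 else x k - y k))"
    using assms unfolding bernstein_path_def
    by (simp add: sum_subtractf[symmetric]) (intro sum.cong; simp add: scaleR_diff_right)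
  also have "norm \<dots> \<le> (\<Sum>k\<le>n. norm (x k - y k))"
  proof (intro sum_norm_le)
    fix k assume "k \<in> {..n}"
    then have "\<bar>Bernstein n k (s / T)\<bar> \<le> 1"
      using assms Bernstein_le_1[of "s / T" k n] Bernstein_nonneg[of "s / T" n k] by (auto simp: field_simps)
    then show "norm (Bernstein n k (s / T) *\<^sub>R (if k = 0 then 0 else x k - y k)) \<le> norm (x k - y k)"
      by (auto intro: mult_left_le_one_le)
  qed
  finally show ?thesis .
qed

lemma bernstein_path_approximates:
  fixes \<omega> :: "'d::finite path"
  assumes "T > 0" "\<omega> \<in> Omega T 0" "\<epsilon> > 0"
  shows "\<exists>n0. \<forall>n\<ge>n0. \<forall>s\<in>{0..T}. norm (\<omega> s - bernstein_path T n (\<lambda>k. \<omega> (real k / real n * T)) s) \<le> \<epsilon>"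
proof -
  \<comment> \<open>Bernstein approximation is applied to each coordinate; the Euclidean norm is at
    most the sum of the coordinate errors, so each may use an equal share of \<epsilon>.\<close>
  define c where "c = \<epsilon> / real CARD('d)"
  have "c > 0" using assms(3) by (simp add: c_def)
  have "\<forall>i. \<exists>n0. \<forall>n y. n0 \<le> n \<and> y \<in> {0..1} \<longrightarrow>
     \<bar>\<omega> (y * T) $ i - (\<Sum>k\<le>n. \<omega> (real k / real n * T) $ i * Bernstein n k y)\<bar> < c"
  proof
    fix i
    have "continuous_on {0..1} (\<lambda>y. \<omega> (y * T))"
    proof (rule continuous_on_compose2[OF OmegaD(2)[OF assms(2)]])
      have "y * T \<le> T" if "y \<le> 1" for y using that assms(1) by simp
      then show "(\<lambda>y. y * T) ` {0..1} \<subseteq> {0..T}" using assms(1) by auto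
    qed (intro continuous_intros)
    then have "continuous_on {0..1} (\<lambda>y. \<omega> (y * T) $ i)"
      by (intro continuous_intros)
    from Bernstein_Weierstrass[OF this \<open>c > 0\<close>]
    show "\<exists>n0. \<forall>n y. n0 \<le> n \<and> y \<in> {0..1} \<longrightarrow>
      \<bar>\<omega> (y * T) $ i - (\<Sum>k\<le>n. \<omega> (real k / real n * T) $ i * Bernstein n k y)\<bar> < c" .
  qed
  from choice[OF this] obtain n0 where n0: "\<And>i n y. n \<ge> n0 i \<Longrightarrow> y \<in> {0..1} \<Longrightarrow>
     \<bar>\<omega> (y * T) $ i - (\<Sum>k\<le>n. \<omega> (real k / real n * T) $ i * Bernstein n k y)\<bar> < c"
    by blast
  have "norm (\<omega> s - bernstein_path T n (\<lambda>k. \<omega> (real k / real n * T)) s) \<le> \<epsilon>"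
    if n: "n \<ge> Max (range n0)" and s: "s \<in> {0..T}" for n s
  proof -
    define y where "y = s / T"
    have y: "y \<in> {0..1}" "s = y * T" using s assms(1) by (auto simp: y_def)
    have "bernstein_path T n (\<lambda>k. \<omega> (real k / real n * T)) s
        = (\<Sum>k\<le>n. Bernstein n k y *\<^sub>R \<omega> (real k / real n * T))"
      using s OmegaD(3)[OF assms(2)] unfolding bernstein_path_def y_def
      by (auto intro!: sum.cong)
    then have "norm (\<omega> s - bernstein_path T n (\<lambda>k. \<omega> (real k / real n * T)) s) \<le>
       (\<Sum>i\<in>UNIV. \<bar>\<omega> (y * T) $ i - (\<Sum>k\<le>n. \<omega> (real k / real n * T) $ i * Bernstein n k y)\<bar>)"
      using norm_le_l1_cart[of "\<omega> s - bernstein_path T n (\<lambda>k. \<omega> (real k / real n * T)) s"] y(2)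
      by (simp add: mult.commute)
    also have "\<dots> \<le> (\<Sum>i\<in>(UNIV::'d set). c)"
    proof (intro sum_mono)
      fix i
      have "n0 i \<le> Max (range n0)" by simp
      then show "\<bar>\<omega> (y * T) $ i - (\<Sum>k\<le>n. \<omega> (real k / real n * T) $ i * Bernstein n k y)\<bar> \<le> c"
        using n0[OF _ y(1), of i n] n by simp
    qed
    also have "\<dots> = \<epsilon>" by (simp add: c_def)
    finally show ?thesis .
  qed
  then show ?thesis by blast
qed

text \<open>Sup-norm continuity has to be reconciled with a sigma-algebra generated by evaluations.
  The value of f at the n-th Bernstein polynomial of \<omega> is a continuous function of finitely
  many values of \<omega>, hence measurable, and these functions converge pointwise to f.\<close>

lemma Lipschitz_imp_Filt_measurable:
  fixes f :: "'d::finite path \<Rightarrow> real"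
  assumes "T > 0" and Lip: "\<And>\<omega> \<omega>'. \<omega> \<in> Omega T 0 \<Longrightarrow> \<omega>' \<in> Omega T 0 \<Longrightarrow>
    \<bar>f \<omega> - f \<omega>'\<bar> \<le> C * path_norm 0 T (\<lambda>r. \<omega> r - \<omega>' r)"
  shows "f \<in> borel_measurable (Filt T 0 T)"
proof -
  \<comment> \<open>The Lipschitz constant may be negative in the hypothesis; passing to its
    absolute value needs the path norm to be nonnegative, which is read off at time 0.\<close>
  have C: "\<bar>f \<omega> - f \<omega>'\<bar> \<le> \<bar>C\<bar> * e"
    if "\<omega> \<in> Omega T 0" "\<omega>' \<in> Omega T 0" "\<And>s. s \<in> {0..T} \<Longrightarrow> norm (\<omega> s - \<omega>' s) \<le> e" for \<omega> \<omega>' e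
  proof -
    have "path_norm 0 T (\<lambda>r. \<omega> r - \<omega>' r) \<le> e" using that assms(1) by (intro path_norm_leI) auto
    moreover have "norm (\<omega> 0 - \<omega>' 0) \<le> path_norm 0 T (\<lambda>r. \<omega> r - \<omega>' r)"
      using assms(1) by (intro norm_le_path_norm[where \<omega>="\<lambda>r. \<omega> r - \<omega>' r"]
        continuous_on_diff OmegaD(2) that(1,2)) auto
    ultimately have "C * path_norm 0 T (\<lambda>r. \<omega> r - \<omega>' r) \<le> \<bar>C\<bar> * e"
      by (intro mult_mono) (auto intro: order_trans[OF norm_ge_zero])
    then show ?thesis using Lip[OF that(1,2)] by simp
  qed
  define F where "F n x = f (bernstein_path T n x)" for n and x :: "nat \<Rightarrow> real ^ 'd"
  have "continuous_on UNIV (F n)" for n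
    unfolding continuous_on_eq_continuous_at[OF open_UNIV] continuous_at
  proof (intro ballI)
    fix x :: "nat \<Rightarrow> real ^ 'd"
    have "continuous_on UNIV (\<lambda>y :: nat \<Rightarrow> real ^ 'd. y k)" for k
      by (rule continuous_on_product_coordinates)
    then have "((\<lambda>y. y k) \<longlongrightarrow> x k) (at x)" for k by (simp add: continuous_on_def)
    then have "((\<lambda>y. \<bar>C\<bar> * (\<Sum>k\<le>n. norm (y k - x k))) \<longlongrightarrow> \<bar>C\<bar> * (\<Sum>k\<le>n. norm (x k - x k))) (at x)"
      by (intro tendsto_intros)
    then have "((\<lambda>y. \<bar>C\<bar> * (\<Sum>k\<le>n. norm (y k - x k))) \<longlongrightarrow> 0) (at x)" by simp
    moreover have "norm (F n y - F n x) \<le> \<bar>C\<bar> * (\<Sum>k\<le>n. norm (y k - x k))" for y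
      unfolding F_def real_norm_def
      using assms(1) by (intro C bernstein_path_in_Omega norm_bernstein_path_diff)
    ultimately show "(F n \<longlongrightarrow> F n x) (at x)"
      by (subst LIM_zero_iff[symmetric]) (rule Lim_null_comparison[rotated], auto)
  qed
  then have F: "F n \<in> borel_measurable borel" for n by (rule borel_measurable_continuous_onI)
  \<comment> \<open>The parameter sequence is indexed by all naturals, so sampling times with k > n
    exceed T. Clamping keeps them in [0, T]; \<open>F n\<close> reads only indices up to n, where
    the clamp changes nothing.\<close>
  have "(\<lambda>\<omega> k. \<omega> (min (real k / real n * T) T)) \<in> measurable (Filt T 0 T) (PiM UNIV (\<lambda>_. borel))" for n
  proof (rule measurable_PiM_single')
    fix k :: nat
    show "(\<lambda>\<omega>. \<omega> (min (real k / real n * T) T)) \<in> borel_measurable (Filt T 0 T)"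
      using assms(1) by (intro measurable_eval_Filt) auto
  qed auto
  then have m: "(\<lambda>\<omega>. F n (\<lambda>k. \<omega> (min (real k / real n * T) T))) \<in> borel_measurable (Filt T 0 T)" for n
    using measurable_compose[OF _ F[of n]] sets_PiM_equal_borel measurable_cong_sets by blast
  show ?thesis
  proof (rule borel_measurable_LIMSEQ_real[OF _ m])
    fix \<omega> :: "'d path" assume "\<omega> \<in> space (Filt T 0 T)"
    then have \<omega>: "\<omega> \<in> Omega T 0" by simp
    show "(\<lambda>n. F n (\<lambda>k. \<omega> (min (real k / real n * T) T))) \<longlonglongrightarrow> f \<omega>"
    proof (rule LIMSEQ_I)
      fix r :: real assume "r > 0"
      \<comment> \<open>The added 1 covers C = 0 and makes the final bound \<bar>C\<bar> *
        \<epsilon> strictly smaller than r.\<close>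
      define \<epsilon> where "\<epsilon> = r / (\<bar>C\<bar> + 1)"
      have "\<epsilon> > 0" using \<open>r > 0\<close> by (simp add: \<epsilon>_def)
      obtain n0 where n0: "\<And>n s. n \<ge> n0 \<Longrightarrow> s \<in> {0..T} \<Longrightarrow>
          norm (\<omega> s - bernstein_path T n (\<lambda>k. \<omega> (real k / real n * T)) s) \<le> \<epsilon>"
        using bernstein_path_approximates[OF assms(1) \<omega> \<open>\<epsilon> > 0\<close>] by blast
      have "norm (F n (\<lambda>k. \<omega> (min (real k / real n * T) T)) - f \<omega>) < r" if n: "n \<ge> max 1 n0" for n
      proof -
        have "min (real k / real n * T) T = real k / real n * T" if "k \<le> n" for k
          using that n assms(1) by (auto simp: min_def field_simps)
        then have "bernstein_path T n (\<lambda>k. \<omega> (min (real k / real n * T) T)) = bernstein_path T n (\<lambda>k. \<omega> (real k / real n * T))"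
          unfolding bernstein_path_def by (intro restrict_ext sum.cong) auto
        then have "\<bar>f \<omega> - F n (\<lambda>k. \<omega> (min (real k / real n * T) T))\<bar> \<le> \<bar>C\<bar> * \<epsilon>"
          unfolding F_def using n n0 assms(1) \<omega> by (auto intro!: C bernstein_path_in_Omega)
        also have "\<dots> < r" using \<open>r > 0\<close> by (simp add: \<epsilon>_def field_simps)
        finally show ?thesis by (simp add: abs_minus_commute)
      qed
      then show "\<exists>no. \<forall>n\<ge>no. norm (F n (\<lambda>k. \<omega> (min (real k / real n * T) T)) - f \<omega>) < r" by blast
    qed
  qed
qed

section \<open>Independence of Brownian increments\<close>

locale brownian =
  fixes N :: "'w measure" and W :: "real \<Rightarrow> 'w \<Rightarrow> real"
  assumes brownian_motion: "brownian_motion N W"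

sublocale brownian \<subseteq> prob_space N
  using brownian_motion unfolding brownian_motion_def by blast

context brownian
begin

lemma W_measurable: "0 \<le> s \<Longrightarrow> W s \<in> borel_measurable N"
  using brownian_motion unfolding brownian_motion_def by blast

lemma W_0: "x \<in> space N \<Longrightarrow> W 0 x = 0"
  using brownian_motion unfolding brownian_motion_def by blast

lemma W_continuous: "x \<in> space N \<Longrightarrow> continuous_on {0..} (\<lambda>s. W s x)"
  using brownian_motion unfolding brownian_motion_def by blast

lemma W_increments_indep:
  "0 \<le> \<theta> 0 \<Longrightarrow> (\<And>k. k < m \<Longrightarrow> \<theta> k \<le> \<theta> (Suc k)) \<Longrightarrow>
     indep_vars (\<lambda>_. borel) (\<lambda>k x. W (\<theta> (Suc k)) x - W (\<theta> k) x) {..<m}"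
  using brownian_motion unfolding brownian_motion_def by blast

text \<open>The Gaussian density is prescribed for s < r only; for s = r the increment vanishes
  identically. The fourth moment is what later gives the variance of squared increments.\<close>

lemma W_increment_moments:
  assumes "0 \<le> s" "s \<le> r"
  shows "integrable N (\<lambda>x. (W r x - W s x) ^ k)"
    and "expectation (\<lambda>x. W r x - W s x) = 0"
    and "expectation (\<lambda>x. (W r x - W s x)\<^sup>2) = r - s"
    and "expectation (\<lambda>x. (W r x - W s x) ^ 4) = 3 * (r - s)\<^sup>2"
proof -
  have *: "integrable N (\<lambda>x. (W r x - W s x) ^ k) \<and> expectation (\<lambda>x. W r x - W s x) = 0
     \<and> expectation (\<lambda>x. (W r x - W s x)\<^sup>2) = r - s
     \<and> expectation (\<lambda>x. (W r x - W s x) ^ 4) = 3 * (r - s)\<^sup>2"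
  proof (cases "s = r")
    case False
    then have "s < r" using assms by simp
    then have D: "distributed N lborel (\<lambda>x. W r x - W s x) (normal_density 0 (sqrt (r - s)))"
      using brownian_motion assms unfolding brownian_motion_def by blast
    have pos: "0 < sqrt (r - s)" using \<open>s < r\<close> by simp
    have I: "integrable N (\<lambda>x. (W r x - W s x) ^ k)"
      using distributed_integrable[OF D, of "\<lambda>x. x ^ k"] integrable_normal_moment[OF pos, of 0 k] by simp
    have E: "expectation (\<lambda>x. (W r x - W s x) ^ k) = (\<integral>x. normal_density 0 (sqrt (r - s)) x * (x - 0) ^ k \<partial>lborel)" for k
      using distributed_integral[OF D, of "\<lambda>x. x ^ k"] by simp
    have "expectation (\<lambda>x. (W r x - W s x) ^ (2 * 0 + 1)) = 0"
      unfolding E by (rule integral_normal_moment_odd[OF pos])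
    moreover have "expectation (\<lambda>x. (W r x - W s x) ^ (2 * 1)) = r - s"
      unfolding E integral_normal_moment_even[OF pos] using \<open>s < r\<close> by simp
    moreover have "expectation (\<lambda>x. (W r x - W s x) ^ (2 * 2)) = 3 * (r - s)\<^sup>2"
      unfolding E integral_normal_moment_even[OF pos] using \<open>s < r\<close> 
      by (simp add: fact_numeral power_divide divide_simps)
    ultimately show ?thesis using I by simp
  qed (use W_measurable in auto)
  then show "integrable N (\<lambda>x. (W r x - W s x) ^ k)"
    and "expectation (\<lambda>x. W r x - W s x) = 0"
    and "expectation (\<lambda>x. (W r x - W s x)\<^sup>2) = r - s"
    and "expectation (\<lambda>x. (W r x - W s x) ^ 4) = 3 * (r - s)\<^sup>2"
    by blast+
qed

section \<open>The past of the Brownian motion and its independence of the next increment\<close>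

definition past :: "real \<Rightarrow> 'w measure" where
  "past s = sigma (space N) {W q -` A \<inter> space N | q A. q \<in> {0..s} \<and> A \<in> sets borel}"

lemma space_past [simp]: "space (past s) = space N"
  unfolding past_def by (rule space_measure_of) auto

lemma sets_past: "sets (past s) = sigma_sets (space N) {W q -` A \<inter> space N | q A. q \<in> {0..s} \<and> A \<in> sets borel}"
  unfolding past_def by (rule sets_measure_of) auto

lemma sets_past_subset: "sets (past s) \<subseteq> sets N"
  unfolding sets_past
proof (rule sets.sigma_sets_subset, safe)
  fix q :: real and A :: "real set" assume "q \<in> {0..s}" "A \<in> sets borel"
  then show "W q -` A \<inter> space N \<in> events"
    using measurable_sets[OF W_measurable] by auto
qed

lemma sets_past_mono: "s \<le> s' \<Longrightarrow> sets (past s) \<subseteq> sets (past s')"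
  unfolding sets_past by (intro sigma_sets_mono' Collect_mono impI) (metis atLeastAtMost_iff order_trans)

lemma past_measurable_mono: "f \<in> borel_measurable (past s) \<Longrightarrow> s \<le> s' \<Longrightarrow> f \<in> borel_measurable (past s')"
  using measurable_mono[OF order_refl refl sets_past_mono[of s s']] by auto

lemma past_measurable: "f \<in> borel_measurable (past s) \<Longrightarrow> f \<in> borel_measurable N"
  using measurable_mono[OF order_refl refl sets_past_subset[of s]] by auto

lemma W_past_measurable: "q \<in> {0..s} \<Longrightarrow> W q \<in> borel_measurable (past s)"
proof (rule measurableI)
  fix A :: "real set" assume "q \<in> {0..s}" "A \<in> sets borel"
  then show "W q -` A \<inter> space (past s) \<in> sets (past s)"
    unfolding space_past sets_past by (intro sigma_sets.Basic CollectI exI[of _ q] exI[of _ A] conjI refl)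
qed simp

text \<open>Independence is assumed for increments along a grid, while a cylinder constrains values.
  On a sorted grid the values are partial sums of the first m increments, and the increment from s
  to r is the last one: two disjoint blocks of an independent family.\<close>

lemma indep_cylinder:
  assumes "0 \<le> s" "s \<le> r" "finite J" "J \<subseteq> {0..s}" "\<And>q. q \<in> J \<Longrightarrow> E q \<in> sets borel" "D \<in> sets borel"
  shows "prob ({x \<in> space N. \<forall>q\<in>J. W q x \<in> E q} \<inter> ((\<lambda>x. W r x - W s x) -` D \<inter> space N)) =
    prob {x \<in> space N. \<forall>q\<in>J. W q x \<in> E q} * prob ((\<lambda>x. W r x - W s x) -` D \<inter> space N)"
proof -
  \<comment> \<open>Adding 0 makes every W value a sum of increments from W 0 = 0; adding s makes
    the last increment start exactly at s.\<close>
  define K where "K = insert 0 (insert s J)"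
  define l where "l = sorted_list_of_set K"
  define m where "m = length l - 1"
  \<comment> \<open>All indices past the end of the list yield r, so index m is s and index m + 1 is
    r. The grid is monotone but not strictly so, since r = s is allowed.\<close>
  define \<theta> where "\<theta> k = (if k < length l then l ! k else r)" for k
  define Z where "Z k x = W (\<theta> (Suc k)) x - W (\<theta> k) x" for k x
  have K: "finite K" "K \<subseteq> {0..s}" "0 \<in> K" "s \<in> K" "J \<subseteq> K" using assms by (auto simp: K_def)
  have l: "set l = K" "sorted l" "l \<noteq> []" using K by (auto simp: l_def)
  have len: "length l = Suc m" using l(3) by (simp add: m_def)
  have \<theta>_in: "\<theta> k \<in> K" if "k \<le> m" for k
    using that len l(1) nth_mem[of k l] by (simp add: \<theta>_def)
  have "\<theta> 0 \<le> 0"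
  proof -
    obtain k where "k < length l" "l ! k = 0" using K(3) l(1) by (metis in_set_conv_nth)
    then show ?thesis using sorted_nth_mono[OF l(2), of 0 k] len by (simp add: \<theta>_def)
  qed
  then have \<theta>0: "\<theta> 0 = 0" using \<theta>_in[of 0] K(2) by force
  have "s \<le> \<theta> m"
  proof -
    obtain k where "k < length l" "l ! k = s" using K(4) l(1) by (metis in_set_conv_nth)
    then show ?thesis using sorted_nth_mono[OF l(2), of k m] len by (simp add: \<theta>_def)
  qed
  then have \<theta>m: "\<theta> m = s" using \<theta>_in[of m] K(2) by force
  have \<theta>r: "\<theta> (Suc m) = r" by (simp add: \<theta>_def len)
  have mono: "\<theta> k \<le> \<theta> (Suc k)" if "k < Suc m" for k
  proof (cases "k = m")
    case True then show ?thesis using \<theta>m \<theta>r assms by simp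
  next
    case False
    then show ?thesis using that sorted_nth_mono[OF l(2), of k "Suc k"] len by (simp add: \<theta>_def)
  qed
  have ind: "indep_vars (\<lambda>_. borel) Z {..<Suc m}"
    unfolding Z_def using mono \<theta>0 by (intro W_increments_indep) auto
  have ind2: "indep_var (PiM {..<m} (\<lambda>_. borel)) (\<lambda>x. restrict (\<lambda>i. Z i x) {..<m})
                        (PiM {m} (\<lambda>_. borel)) (\<lambda>x. restrict (\<lambda>i. Z i x) {m})"
    by (rule indep_var_restrict[OF ind]) auto
  have W_eq: "W (\<theta> j) x = (\<Sum>k<j. Z k x)" if "x \<in> space N" for j x
    unfolding Z_def using sum_lessThan_telescope[of "\<lambda>k. W (\<theta> k) x" j] W_0[OF that] \<theta>0 by simp
  \<comment> \<open>The cylinder expressed through the increments: the partial sum of the first j of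
    them is W at grid time j.\<close>
  define Xa where "Xa = {f \<in> space (PiM {..<m} (\<lambda>_. borel :: real measure)). \<forall>j\<in>{j. j \<le> m \<and> \<theta> j \<in> J}. (\<Sum>k<j. f k) \<in> E (\<theta> j)}"
  define Xb where "Xb = {f \<in> space (PiM {m} (\<lambda>_. borel :: real measure)). f m \<in> D}"
  have "Xa \<in> sets (PiM {..<m} (\<lambda>_. borel))"
    unfolding Xa_def
  proof (rule sets.sets_Collect_finite_All)
    fix j assume j: "j \<in> {j. j \<le> m \<and> \<theta> j \<in> J}"
    have "(\<lambda>f. \<Sum>k<j. f k) \<in> borel_measurable (PiM {..<m} (\<lambda>_. borel :: real measure))"
      using j by (intro borel_measurable_sum measurable_component_singleton) auto
    then show "{f \<in> space (PiM {..<m} (\<lambda>_. borel)). (\<Sum>k<j. f k) \<in> E (\<theta> j)} \<in> sets (PiM {..<m} (\<lambda>_. borel))"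
      using j assms(5) measurable_sets_Collect[of _ _ borel "\<lambda>y. y \<in> E (\<theta> j)"] by simp
  qed simp
  moreover have "Xb \<in> sets (PiM {m} (\<lambda>_. borel))"
    unfolding Xb_def using assms(6)
      measurable_sets_Collect[OF measurable_component_singleton, of m "{m}" "\<lambda>_. borel" "\<lambda>y. y \<in> D"] by simp
  ultimately have "prob ((\<lambda>x. (restrict (\<lambda>i. Z i x) {..<m}, restrict (\<lambda>i. Z i x) {m})) -` (Xa \<times> Xb) \<inter> space N)
     = prob ((\<lambda>x. restrict (\<lambda>i. Z i x) {..<m}) -` Xa \<inter> space N) * prob ((\<lambda>x. restrict (\<lambda>i. Z i x) {m}) -` Xb \<inter> space N)"
    by (rule indep_varD[OF ind2])
  moreover have A: "(\<lambda>x. restrict (\<lambda>i. Z i x) {..<m}) -` Xa \<inter> space N = {x \<in> space N. \<forall>q\<in>J. W q x \<in> E q}"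
  proof -
    have "(\<forall>j\<in>{j. j \<le> m \<and> \<theta> j \<in> J}. (\<Sum>k<j. restrict (\<lambda>i. Z i x) {..<m} k) \<in> E (\<theta> j)) \<longleftrightarrow> (\<forall>q\<in>J. W q x \<in> E q)"
      if x: "x \<in> space N" for x
    proof -
      have "(\<Sum>k<j. restrict (\<lambda>i. Z i x) {..<m} k) = W (\<theta> j) x" if "j \<le> m" for j
        using W_eq[OF x, of j] that by simp
      then have "(\<forall>j\<in>{j. j \<le> m \<and> \<theta> j \<in> J}. (\<Sum>k<j. restrict (\<lambda>i. Z i x) {..<m} k) \<in> E (\<theta> j)) \<longleftrightarrow>
         (\<forall>j\<in>{j. j \<le> m \<and> \<theta> j \<in> J}. W (\<theta> j) x \<in> E (\<theta> j))" by (intro ball_cong refl) auto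
      also have "\<dots> \<longleftrightarrow> (\<forall>q\<in>J. W q x \<in> E q)"
      proof -
        have "\<exists>j\<le>m. \<theta> j = q" if "q \<in> J" for q
        proof -
          have "q \<in> set l" using that K(5) l(1) by auto
          then obtain j where "j < length l" "l ! j = q" by (metis in_set_conv_nth)
          then show ?thesis using len by (intro exI[of _ j]) (auto simp: \<theta>_def)
        qed
        then show ?thesis by blast
      qed
      finally show ?thesis .
    qed
    then show ?thesis by (auto simp: Xa_def space_PiM)
  qed
  moreover have B: "(\<lambda>x. restrict (\<lambda>i. Z i x) {m}) -` Xb \<inter> space N = (\<lambda>x. W r x - W s x) -` D \<inter> space N"
    by (auto simp: Xb_def space_PiM Z_def \<theta>m \<theta>r)
  moreover have "(\<lambda>x. (restrict (\<lambda>i. Z i x) {..<m}, restrict (\<lambda>i. Z i x) {m})) -` (Xa \<times> Xb) \<inter> space N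
      = {x \<in> space N. \<forall>q\<in>J. W q x \<in> E q} \<inter> ((\<lambda>x. W r x - W s x) -` D \<inter> space N)"
    unfolding A[symmetric] B[symmetric] by auto
  ultimately show ?thesis by simp
qed

text \<open>Cylinders are stable under intersection and generate the past, so independence extends
  from them to the generated sigma-algebra.\<close>

lemma indep_past_increment:
  fixes Y :: "'w \<Rightarrow> real"
  assumes s: "0 \<le> s" "s \<le> r" and Y: "Y \<in> borel_measurable (past s)"
  shows "indep_var borel Y borel (\<lambda>x. W r x - W s x)"
proof -
  define \<Delta> where "\<Delta> x = W r x - W s x" for x
  have \<Delta>: "\<Delta> \<in> borel_measurable N" unfolding \<Delta>_def using W_measurable s by auto
  define CA where "CA = {{x \<in> space N. \<forall>q\<in>J. W q x \<in> E q} | J E.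
     finite J \<and> J \<subseteq> {0..s} \<and> (\<forall>q\<in>J. E q \<in> sets (borel :: real measure))}"
  define CB where "CB = {\<Delta> -` D \<inter> space N | D. D \<in> sets (borel :: real measure)}"
  have CAI: "{x \<in> space N. \<forall>q\<in>J. W q x \<in> E q} \<in> CA"
    if "finite J" "J \<subseteq> {0..s}" "\<forall>q\<in>J. E q \<in> sets (borel :: real measure)" for J E
    using that unfolding CA_def by blast
  have "indep_set CA CB"
  proof (rule indep_setI)
    show "CA \<subseteq> events"
    proof (unfold CA_def, safe)
      fix J and E :: "real \<Rightarrow> real set"
      assume J: "finite J" "J \<subseteq> {0..s}" "\<forall>q\<in>J. E q \<in> sets borel"
      show "{x \<in> space N. \<forall>q\<in>J. W q x \<in> E q} \<in> events"
      proof (rule sets.sets_Collect_finite_All)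
        fix q assume "q \<in> J"
        then show "{x \<in> space N. W q x \<in> E q} \<in> events"
          using J measurable_sets_Collect[OF W_measurable, of q "\<lambda>y. y \<in> E q"] by auto
      qed (rule J(1))
    qed
    show "CB \<subseteq> events" unfolding CB_def using measurable_sets[OF \<Delta>] by auto
    fix a b assume "a \<in> CA" "b \<in> CB"
    then obtain J E D where "finite J" "J \<subseteq> {0..s}" "\<forall>q\<in>J. E q \<in> sets (borel :: real measure)"
        "a = {x \<in> space N. \<forall>q\<in>J. W q x \<in> E q}" "D \<in> sets (borel :: real measure)" "b = \<Delta> -` D \<inter> space N"
      unfolding CA_def CB_def by blast
    then show "prob (a \<inter> b) = prob a * prob b"
      unfolding \<Delta>_def using indep_cylinder[OF s, of J E D] by simp
  qed
  moreover have "Int_stable CA"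
  proof (rule Int_stableI)
    fix a b assume "a \<in> CA" "b \<in> CA"
    then obtain J E J' E' where J: "finite J" "J \<subseteq> {0..s}" "\<forall>q\<in>J. E q \<in> sets (borel :: real measure)"
        "a = {x \<in> space N. \<forall>q\<in>J. W q x \<in> E q}"
      and J': "finite J'" "J' \<subseteq> {0..s}" "\<forall>q\<in>J'. E' q \<in> sets (borel :: real measure)"
        "b = {x \<in> space N. \<forall>q\<in>J'. W q x \<in> E' q}"
      unfolding CA_def by blast
    \<comment> \<open>A time constrained by only one of the two cylinders gets the whole line as its
      constraint in the other.\<close>
    define F where "F q = (if q \<in> J then E q else UNIV) \<inter> (if q \<in> J' then E' q else UNIV)" for q
    have "a \<inter> b = {x \<in> space N. \<forall>q\<in>J \<union> J'. W q x \<in> F q}"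
      unfolding J(4) J'(4) F_def by auto
    moreover have "\<dots> \<in> CA" using J J' by (intro CAI) (auto simp: F_def)
    ultimately show "a \<inter> b \<in> CA" by simp
  qed
  moreover have "Int_stable CB"
  proof (rule Int_stableI)
    fix a b assume "a \<in> CB" "b \<in> CB"
    then obtain D D' where "D \<in> sets borel" "D' \<in> sets borel" "a = \<Delta> -` D \<inter> space N" "b = \<Delta> -` D' \<inter> space N"
      unfolding CB_def by blast
    then show "a \<inter> b \<in> CB" unfolding CB_def by (intro CollectI exI[of _ "D \<inter> D'"]) auto
  qed
  ultimately have ind: "indep_set (sigma_sets (space N) CA) (sigma_sets (space N) CB)"
    by (rule indep_set_sigma_sets)
  have past: "sets (past s) \<subseteq> sigma_sets (space N) CA"
    unfolding sets_past
  proof (rule sigma_sets_mono', safe)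
    fix q and A :: "real set" assume "q \<in> {0..s}" "A \<in> sets borel"
    moreover have "W q -` A \<inter> space N = {x \<in> space N. \<forall>p\<in>{q}. W p x \<in> A}" by auto
    ultimately show "W q -` A \<inter> space N \<in> CA" using CAI[of "{q}" "\<lambda>_. A"] by simp
  qed
  show ?thesis
    unfolding indep_var_eq
  proof (intro conjI)
    show YN: "Y \<in> borel_measurable N" using past_measurable[OF Y] .
    show "(\<lambda>x. W r x - W s x) \<in> borel_measurable N" using \<Delta> unfolding \<Delta>_def .
    have "{Y -` A \<inter> space N |A. A \<in> sets borel} \<subseteq> sigma_sets (space N) CA"
      using measurable_sets[OF Y] past by auto
    then have "sigma_sets (space N) {Y -` A \<inter> space N |A. A \<in> sets borel} \<subseteq> sigma_sets (space N) CA"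
      by (rule sigma_sets_mono)
    moreover have "sigma_sets (space N) {(\<lambda>x. W r x - W s x) -` A \<inter> space N |A. A \<in> sets borel} = sigma_sets (space N) CB"
      unfolding CB_def \<Delta>_def ..
    ultimately show "indep_set (sigma_sets (space N) {Y -` A \<inter> space N |A. A \<in> sets borel})
       (sigma_sets (space N) {(\<lambda>x. W r x - W s x) -` A \<inter> space N |A. A \<in> sets borel})"
      using ind unfolding indep_sets2_eq by blast
  qed
qed

text \<open>The summands are orthogonal martingale differences.\<close>

lemma martingale_sum_moments:
  fixes Y :: "nat \<Rightarrow> 'w \<Rightarrow> real" and f :: "nat \<Rightarrow> real \<Rightarrow> real"
  assumes \<theta>: "0 \<le> \<theta> 0" "\<And>k. k < n \<Longrightarrow> \<theta> k \<le> \<theta> (Suc k)"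
    and Y: "\<And>k. k < n \<Longrightarrow> Y k \<in> borel_measurable (past (\<theta> k))"
      "\<And>k x. k < n \<Longrightarrow> x \<in> space N \<Longrightarrow> \<bar>Y k x\<bar> \<le> C"
    and f: "\<And>k. f k \<in> borel_measurable borel"
      "\<And>k. k < n \<Longrightarrow> integrable N (\<lambda>x. (f k (W (\<theta> (Suc k)) x - W (\<theta> k) x))\<^sup>2)"
      "\<And>k. k < n \<Longrightarrow> expectation (\<lambda>x. f k (W (\<theta> (Suc k)) x - W (\<theta> k) x)) = 0"
      "\<And>k. k < n \<Longrightarrow> expectation (\<lambda>x. (f k (W (\<theta> (Suc k)) x - W (\<theta> k) x))\<^sup>2) \<le> v k"
  defines "S \<equiv> \<lambda>n x. \<Sum>k<n. Y k x * f k (W (\<theta> (Suc k)) x - W (\<theta> k) x)"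
  shows "S n \<in> borel_measurable (past (\<theta> n)) \<and> integrable N (S n) \<and> integrable N (\<lambda>x. (S n x)\<^sup>2) \<and>
    expectation (S n) = 0 \<and> expectation (\<lambda>x. (S n x)\<^sup>2) \<le> C\<^sup>2 * (\<Sum>k<n. v k)"
  using assms(1-8)
proof (induction n)
  case 0
  then show ?case by (simp add: S_def)
next
  case (Suc n)
  have IH: "S n \<in> borel_measurable (past (\<theta> n))" "integrable N (S n)" "integrable N (\<lambda>x. (S n x)\<^sup>2)"
    "expectation (S n) = 0" "expectation (\<lambda>x. (S n x)\<^sup>2) \<le> C\<^sup>2 * (\<Sum>k<n. v k)"
    using Suc.IH Suc.prems by auto
  have \<theta>n: "0 \<le> \<theta> n"
  proof -
    have "\<theta> 0 \<le> \<theta> k" if "k \<le> n" for k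
      using that by (induction k) (auto intro: order_trans[OF _ Suc.prems(2)])
    from this[of n] Suc.prems(1) show ?thesis by simp
  qed
  define \<Delta> where "\<Delta> x = W (\<theta> (Suc n)) x - W (\<theta> n) x" for x
  define F where "F x = f n (\<Delta> x)" for x
  have le: "\<theta> n \<le> \<theta> (Suc n)" using Suc.prems(2) by simp
  have Yp: "Y n \<in> borel_measurable (past (\<theta> n))" using Suc.prems(3) by simp
  have YN: "Y n \<in> borel_measurable N" using past_measurable[OF Yp] .
  have SN: "S n \<in> borel_measurable N" using past_measurable[OF IH(1)] .
  have Yb: "\<bar>Y n x\<bar> \<le> C" if "x \<in> space N" for x using Suc.prems(4) that by simp
  have fm: "f n \<in> borel_measurable borel" using Suc.prems(5) .
  have \<Delta>m: "\<Delta> \<in> borel_measurable N" unfolding \<Delta>_def using W_measurable \<theta>n le by auto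
  have Fm: "F \<in> borel_measurable N" unfolding F_def using measurable_compose[OF \<Delta>m fm] .
  have F2: "integrable N (\<lambda>x. (F x)\<^sup>2)" "expectation F = 0" "expectation (\<lambda>x. (F x)\<^sup>2) \<le> v n"
    using Suc.prems(6-8)[of n] unfolding F_def \<Delta>_def by auto
  have F1: "integrable N F" using square_integrable_imp_integrable[OF Fm F2(1)] .
  have indF: "indep_var borel Z borel F" if "Z \<in> borel_measurable (past (\<theta> n))" for Z :: "'w \<Rightarrow> real"
    using indep_var_compose[OF indep_past_increment[OF \<theta>n le that] measurable_ident_sets[OF refl] fm]
    unfolding F_def \<Delta>_def comp_def by simp
  have Y1: "integrable N (Y n)"
    using YN Yb by (intro integrable_const_bound[where B=C]) auto
  have Ysq: "(Y n x)\<^sup>2 \<le> C\<^sup>2" if "x \<in> space N" for x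
    using power_mono[OF Yb[OF that], of 2] by simp
  have YF: "integrable N (\<lambda>x. Y n x * F x)" "expectation (\<lambda>x. Y n x * F x) = 0"
    using indep_var_integrable[OF indF[OF Yp] Y1 F1] indep_var_lebesgue_integral[OF indF[OF Yp] Y1 F1] F2 by auto
  have CF: "integrable N (\<lambda>x. C\<^sup>2 * (F x)\<^sup>2)" using F2(1) by simp
  have YF2b: "(Y n x * F x)\<^sup>2 \<le> C\<^sup>2 * (F x)\<^sup>2" if "x \<in> space N" for x
    using Ysq[OF that] by (simp add: power_mult_distrib mult_right_mono)
  have YF2: "integrable N (\<lambda>x. (Y n x * F x)\<^sup>2)"
    using CF by (rule Bochner_Integration.integrable_bound) (use YN Fm YF2b in auto)
  have EYF2: "expectation (\<lambda>x. (Y n x * F x)\<^sup>2) \<le> C\<^sup>2 * v n"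
  proof -
    have "expectation (\<lambda>x. (Y n x * F x)\<^sup>2) \<le> expectation (\<lambda>x. C\<^sup>2 * (F x)\<^sup>2)"
      using YF2 CF YF2b by (intro integral_mono) auto
    also have "\<dots> \<le> C\<^sup>2 * v n" using F2(3) by (simp add: mult_left_mono)
    finally show ?thesis .
  qed
  \<comment> \<open>The cross term in the square of the next sum has mean 0: S n * Y n is measurable
    with respect to the past, hence independent of the centred factor F. Boundedness of Y supplies
    integrability.\<close>
  have SYm: "(\<lambda>x. S n x * Y n x) \<in> borel_measurable (past (\<theta> n))" using IH(1) Yp by simp
  have SY: "integrable N (\<lambda>x. S n x * Y n x)"
  proof (rule Bochner_Integration.integrable_bound[of _ "\<lambda>x. C * S n x"])
    have "norm (S n x * Y n x) \<le> norm (C * S n x)" if "x \<in> space N" for x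
    proof -
      have "\<bar>Y n x\<bar> \<le> \<bar>C\<bar>" using Yb[OF that] by simp
      then have "\<bar>S n x\<bar> * \<bar>Y n x\<bar> \<le> \<bar>S n x\<bar> * \<bar>C\<bar>" by (rule mult_left_mono) simp
      then show ?thesis by (simp add: abs_mult mult.commute)
    qed
    then show "AE x in N. norm (S n x * Y n x) \<le> norm (C * S n x)" by (rule AE_I2)
  qed (use IH(2) SN YN in auto)
  have SYF: "integrable N (\<lambda>x. (S n x * Y n x) * F x)" "expectation (\<lambda>x. (S n x * Y n x) * F x) = 0"
    using indep_var_integrable[OF indF[OF SYm] SY F1] indep_var_lebesgue_integral[OF indF[OF SYm] SY F1] F2 by auto
  have S_Suc: "S (Suc n) = (\<lambda>x. S n x + Y n x * F x)"
    by (simp add: S_def F_def \<Delta>_def)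
  have sq: "(\<lambda>x. (S (Suc n) x)\<^sup>2) = (\<lambda>x. (S n x)\<^sup>2 + 2 * (S n x * Y n x * F x) + (Y n x * F x)\<^sup>2)"
    by (simp add: S_Suc power2_sum fun_eq_iff)
  have "S (Suc n) \<in> borel_measurable (past (\<theta> (Suc n)))"
  proof -
    have "\<Delta> \<in> borel_measurable (past (\<theta> (Suc n)))"
      unfolding \<Delta>_def using \<theta>n le by (intro borel_measurable_diff W_past_measurable) auto
    then have "F \<in> borel_measurable (past (\<theta> (Suc n)))"
      unfolding F_def using fm by (rule measurable_compose)
    then show ?thesis
      unfolding S_Suc using past_measurable_mono[OF IH(1) le] past_measurable_mono[OF Yp le] by simp
  qed
  moreover have "integrable N (S (Suc n))" unfolding S_Suc using IH YF by simp
  moreover have "integrable N (\<lambda>x. (S (Suc n) x)\<^sup>2)" unfolding sq using IH SYF YF2 by simp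
  moreover have "expectation (S (Suc n)) = 0" unfolding S_Suc using IH YF by simp
  moreover have "expectation (\<lambda>x. (S (Suc n) x)\<^sup>2) \<le> C\<^sup>2 * (\<Sum>k<Suc n. v k)"
    unfolding sq using IH SYF YF2 EYF2 by (simp add: distrib_left)
  ultimately show ?case by blast
qed

text \<open>The Ito isometry for simple integrands, as an upper bound: the variance of an increment
  is the length of its time step, and the lengths telescope.\<close>

lemma brownian_sum_moments:
  fixes Y :: "nat \<Rightarrow> 'w \<Rightarrow> real"
  assumes \<theta>: "0 \<le> \<theta> 0" "\<And>k. k < n \<Longrightarrow> \<theta> k \<le> \<theta> (Suc k)"
    and Y: "\<And>k. k < n \<Longrightarrow> Y k \<in> borel_measurable (past (\<theta> k))"
      "\<And>k x. k < n \<Longrightarrow> x \<in> space N \<Longrightarrow> \<bar>Y k x\<bar> \<le> C"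
  defines "S \<equiv> \<lambda>x. \<Sum>k<n. Y k x * (W (\<theta> (Suc k)) x - W (\<theta> k) x)"
  shows "integrable N S" "integrable N (\<lambda>x. (S x)\<^sup>2)" "expectation S = 0"
    "expectation (\<lambda>x. (S x)\<^sup>2) \<le> C\<^sup>2 * (\<theta> n - \<theta> 0)"
proof -
  have \<theta>k: "0 \<le> \<theta> k" if "k < n" for k
    using that by (induction k) (auto intro: \<theta>(1) order_trans[OF _ \<theta>(2)])
  have "(\<Sum>k<n. \<theta> (Suc k) - \<theta> k) = \<theta> n - \<theta> 0" by (rule sum_lessThan_telescope)
  moreover note martingale_sum_moments[where n=n and \<theta>=\<theta> and Y=Y and C=C and f="\<lambda>k y. y" and v="\<lambda>k. \<theta> (Suc k) - \<theta> k"]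
  ultimately show "integrable N S" "integrable N (\<lambda>x. (S x)\<^sup>2)" "expectation S = 0"
    "expectation (\<lambda>x. (S x)\<^sup>2) \<le> C\<^sup>2 * (\<theta> n - \<theta> 0)"
    unfolding S_def using \<theta> Y \<theta>k by (simp_all add: W_increment_moments)
qed

text \<open>Squared increments minus their means are again martingale differences, now with weight
  1. The fourth moment 3 d^2 gives variance 2 d^2 for a step of length d; replacing one factor d by
  \<delta> leaves a telescoping sum.\<close>

lemma brownian_square_sum_moments:
  assumes \<theta>: "0 \<le> \<theta> 0" "\<And>k. k < n \<Longrightarrow> \<theta> k \<le> \<theta> (Suc k)" "\<And>k. k < n \<Longrightarrow> \<theta> (Suc k) - \<theta> k \<le> \<delta>"
  defines "S \<equiv> \<lambda>x. (\<Sum>k<n. (W (\<theta> (Suc k)) x - W (\<theta> k) x)\<^sup>2) - (\<theta> n - \<theta> 0)"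
  shows "S \<in> borel_measurable N" "integrable N (\<lambda>x. (S x)\<^sup>2)"
    "expectation (\<lambda>x. (S x)\<^sup>2) \<le> 2 * \<delta> * (\<theta> n - \<theta> 0)"
proof -
  have \<theta>k: "0 \<le> \<theta> k" if "k < n" for k
    using that by (induction k) (auto intro: \<theta>(1) order_trans[OF _ \<theta>(2)])
  define f where "f k y = y\<^sup>2 - (\<theta> (Suc k) - \<theta> k)" for k y
  have "(\<Sum>k<n. \<theta> (Suc k) - \<theta> k) = \<theta> n - \<theta> 0" by (rule sum_lessThan_telescope)
  then have Sf: "S x = (\<Sum>k<n. 1 * f k (W (\<theta> (Suc k)) x - W (\<theta> k) x))" for x
    by (simp add: S_def f_def sum_subtractf)
  have f2: "(f k y)\<^sup>2 = y ^ 4 - 2 * (\<theta> (Suc k) - \<theta> k) * y\<^sup>2 + (\<theta> (Suc k) - \<theta> k)\<^sup>2" for k y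
    by (simp add: f_def power2_diff power_mult[symmetric])
  have I: "integrable N (\<lambda>x. (W (\<theta> (Suc k)) x - W (\<theta> k) x) ^ j)" if "k < n" for k j
    using W_increment_moments(1)[OF \<theta>k[OF that] \<theta>(2)[OF that]] .
  have "(\<lambda>x. \<Sum>k<n. 1 * f k (W (\<theta> (Suc k)) x - W (\<theta> k) x)) \<in> borel_measurable (past (\<theta> n)) \<and>
      integrable N (\<lambda>x. \<Sum>k<n. 1 * f k (W (\<theta> (Suc k)) x - W (\<theta> k) x)) \<and>
      integrable N (\<lambda>x. (\<Sum>k<n. 1 * f k (W (\<theta> (Suc k)) x - W (\<theta> k) x))\<^sup>2) \<and>
      expectation (\<lambda>x. \<Sum>k<n. 1 * f k (W (\<theta> (Suc k)) x - W (\<theta> k) x)) = 0 \<and>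
      expectation (\<lambda>x. (\<Sum>k<n. 1 * f k (W (\<theta> (Suc k)) x - W (\<theta> k) x))\<^sup>2)
        \<le> 1\<^sup>2 * (\<Sum>k<n. 2 * \<delta> * (\<theta> (Suc k) - \<theta> k))"
  proof (intro martingale_sum_moments)
    fix k assume k: "k < n"
    show "integrable N (\<lambda>x. (f k (W (\<theta> (Suc k)) x - W (\<theta> k) x))\<^sup>2)"
      unfolding f2 using I[OF k] by auto
    show "expectation (\<lambda>x. f k (W (\<theta> (Suc k)) x - W (\<theta> k) x)) = 0"
      unfolding f_def using I[OF k] W_increment_moments(3)[OF \<theta>k[OF k] \<theta>(2)[OF k]] by (simp add: prob_space)
    have "expectation (\<lambda>x. (f k (W (\<theta> (Suc k)) x - W (\<theta> k) x))\<^sup>2) = 2 * (\<theta> (Suc k) - \<theta> k)\<^sup>2"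
    proof -
      define d where "d = \<theta> (Suc k) - \<theta> k"
      define D where "D x = W (\<theta> (Suc k)) x - W (\<theta> k) x" for x
      have "integrable N (\<lambda>x. D x ^ j)" for j using I[OF k] unfolding D_def .
      moreover have "expectation (\<lambda>x. (D x)\<^sup>2) = d" "expectation (\<lambda>x. D x ^ 4) = 3 * d\<^sup>2"
        using W_increment_moments(3,4)[OF \<theta>k[OF k] \<theta>(2)[OF k]] unfolding D_def d_def by auto
      ultimately have "expectation (\<lambda>x. D x ^ 4 - 2 * d * (D x)\<^sup>2 + d\<^sup>2) = 2 * d\<^sup>2"
        by (simp add: prob_space power2_eq_square[of d])
      then show ?thesis unfolding f2 D_def d_def .
    qed
    also have "\<dots> \<le> 2 * \<delta> * (\<theta> (Suc k) - \<theta> k)"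
      using \<theta>(2,3)[OF k] by (simp add: power2_eq_square mult_right_mono)
    finally show "expectation (\<lambda>x. (f k (W (\<theta> (Suc k)) x - W (\<theta> k) x))\<^sup>2) \<le> 2 * \<delta> * (\<theta> (Suc k) - \<theta> k)" .
  qed (use \<theta> in \<open>auto simp: f_def\<close>)
  then show "S \<in> borel_measurable N" "integrable N (\<lambda>x. (S x)\<^sup>2)"
    "expectation (\<lambda>x. (S x)\<^sup>2) \<le> 2 * \<delta> * (\<theta> n - \<theta> 0)"
    unfolding Sf[abs_def] by (auto simp: sum_distrib_left[symmetric] sum_lessThan_telescope)
qed

end

section \<open>Convergence in probability and mesh limits\<close>

text \<open>Convergence in probability, encoded by the metric E min(1, norm (X - Y)): sums, linear
  images and uniqueness of limits become inequalities between integrals of bounded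
  functions.\<close>

definition tendsto_prob :: "'a measure \<Rightarrow> (nat \<Rightarrow> 'a \<Rightarrow> 'b::euclidean_space) \<Rightarrow> ('a \<Rightarrow> 'b) \<Rightarrow> bool" where
  "tendsto_prob M X Y \<longleftrightarrow> (\<lambda>n. LINT x|M. min 1 (norm (X n x - Y x))) \<longlonglongrightarrow> 0"

lemma tendsto_0_squeeze:
  fixes f g :: "nat \<Rightarrow> real"
  assumes "\<And>n. 0 \<le> f n" "\<And>n. f n \<le> g n" "g \<longlonglongrightarrow> 0"
  shows "f \<longlonglongrightarrow> 0"
  using tendsto_sandwich[of "\<lambda>_. 0" f sequentially g 0] assms by (simp add: always_eventually)

context prob_space
begin

lemma expectation_min_norm_nonneg: "0 \<le> expectation (\<lambda>x. min 1 (norm (f x)))"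
  by (intro Bochner_Integration.integral_nonneg) simp

lemma integrable_min_norm:
  fixes Z :: "'a \<Rightarrow> 'b::euclidean_space"
  assumes "Z \<in> borel_measurable M"
  shows "integrable M (\<lambda>x. min 1 (norm (Z x)))"
  using assms by (intro integrable_const_bound[where B=1]) auto

lemma tendsto_probI:
  assumes "\<And>\<epsilon>. \<epsilon> > 0 \<Longrightarrow> \<forall>\<^sub>F n in sequentially. expectation (\<lambda>x. min 1 (norm (X n x - Y x))) \<le> \<epsilon>"
  shows "tendsto_prob M X Y"
  unfolding tendsto_prob_def
proof (rule tendstoI)
  fix e :: real assume "e > 0"
  then have "e / 2 > 0" by simp
  from assms[OF this] show "\<forall>\<^sub>F n in sequentially. dist (expectation (\<lambda>x. min 1 (norm (X n x - Y x)))) 0 < e"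
  proof eventually_elim
    case (elim n)
    show ?case using expectation_min_norm_nonneg[of "\<lambda>x. X n x - Y x"] elim \<open>e > 0\<close> by simp
  qed
qed

lemma tendsto_prob_linear:
  fixes X :: "nat \<Rightarrow> 'a \<Rightarrow> 'b::euclidean_space"
  assumes "tendsto_prob M X Y" "\<And>n. X n \<in> borel_measurable M" "Y \<in> borel_measurable M"
    and f: "bounded_linear f"
  shows "tendsto_prob M (\<lambda>n x. f (X n x)) (\<lambda>x. f (Y x) :: 'c::euclidean_space)"
proof -
  interpret bounded_linear f by fact
  obtain K where K: "\<And>x. norm (f x) \<le> norm x * K" "K \<ge> 0" using nonneg_bounded by blast
  have fm[measurable]: "f \<in> borel_measurable borel"
    by (intro borel_measurable_continuous_onI linear_continuous_on f)
  note [measurable] = assms(2,3)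
  \<comment> \<open>The factor is 1 + K and not K because of the truncation: where the minimum on
    the right equals 1, the factor itself must be at least 1.\<close>
  have "min 1 (norm (f (X n x) - f (Y x))) \<le> (1 + K) * min 1 (norm (X n x - Y x))" for n x
  proof -
    have "norm (f (X n x) - f (Y x)) \<le> norm (X n x - Y x) * K" using K(1)[of "X n x - Y x"] by (simp add: diff)
    also have "\<dots> \<le> (1 + K) * norm (X n x - Y x)" using K(2) by (simp add: algebra_simps)
    finally show ?thesis using K(2) by (auto simp: min_def)
  qed
  then have le: "expectation (\<lambda>x. min 1 (norm (f (X n x) - f (Y x)))) \<le>
      expectation (\<lambda>x. (1 + K) * min 1 (norm (X n x - Y x)))" for n
    by (intro integral_mono integrable_min_norm integrable_mult_right) auto
  have "(\<lambda>n. (1 + K) * expectation (\<lambda>x. min 1 (norm (X n x - Y x)))) \<longlonglongrightarrow> (1 + K) * 0"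
    using assms(1) unfolding tendsto_prob_def by (intro tendsto_intros)
  then have "(\<lambda>n. expectation (\<lambda>x. (1 + K) * min 1 (norm (X n x - Y x)))) \<longlonglongrightarrow> 0" by simp
  with expectation_min_norm_nonneg le show ?thesis
    unfolding tendsto_prob_def by (rule tendsto_0_squeeze)
qed

lemma tendsto_prob_add:
  fixes X X' :: "nat \<Rightarrow> 'a \<Rightarrow> 'b::euclidean_space"
  assumes "tendsto_prob M X Y" "\<And>n. X n \<in> borel_measurable M" "Y \<in> borel_measurable M"
    and "tendsto_prob M X' Y'" "\<And>n. X' n \<in> borel_measurable M" "Y' \<in> borel_measurable M"
  shows "tendsto_prob M (\<lambda>n x. X n x + X' n x) (\<lambda>x. Y x + Y' x)"
proof -
  note [measurable] = assms(2,3,5,6)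
  have "min 1 (norm (X n x + X' n x - (Y x + Y' x))) \<le> min 1 (norm (X n x - Y x)) + min 1 (norm (X' n x - Y' x))" for n x
  proof -
    have "norm (X n x + X' n x - (Y x + Y' x)) \<le> norm (X n x - Y x) + norm (X' n x - Y' x)"
      by (metis add_diff_add norm_triangle_ineq)
    moreover have "0 \<le> norm (X n x - Y x)" "0 \<le> norm (X' n x - Y' x)" by auto
    ultimately show ?thesis unfolding min_def by (simp split: if_split; linarith)
  qed
  then have "expectation (\<lambda>x. min 1 (norm (X n x + X' n x - (Y x + Y' x)))) \<le>
     expectation (\<lambda>x. min 1 (norm (X n x - Y x)) + min 1 (norm (X' n x - Y' x)))" for n
    by (intro integral_mono integrable_min_norm Bochner_Integration.integrable_add) auto
  then have le: "expectation (\<lambda>x. min 1 (norm (X n x + X' n x - (Y x + Y' x)))) \<le>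
     expectation (\<lambda>x. min 1 (norm (X n x - Y x))) + expectation (\<lambda>x. min 1 (norm (X' n x - Y' x)))" for n
    by (subst (asm) Bochner_Integration.integral_add) (auto intro: integrable_min_norm)
  have "(\<lambda>n. expectation (\<lambda>x. min 1 (norm (X n x - Y x))) + expectation (\<lambda>x. min 1 (norm (X' n x - Y' x)))) \<longlonglongrightarrow> 0 + 0"
    using assms(1,4) unfolding tendsto_prob_def by (intro tendsto_intros)
  then have "(\<lambda>n. expectation (\<lambda>x. min 1 (norm (X n x - Y x))) + expectation (\<lambda>x. min 1 (norm (X' n x - Y' x)))) \<longlonglongrightarrow> 0" by simp
  with expectation_min_norm_nonneg le show ?thesis
    unfolding tendsto_prob_def by (rule tendsto_0_squeeze)
qed

lemma tendsto_prob_diff: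
  fixes X X' :: "nat \<Rightarrow> 'a \<Rightarrow> 'b::euclidean_space"
  assumes "tendsto_prob M X Y" "\<And>n. X n \<in> borel_measurable M" "Y \<in> borel_measurable M"
    and "tendsto_prob M X' Y'" "\<And>n. X' n \<in> borel_measurable M" "Y' \<in> borel_measurable M"
  shows "tendsto_prob M (\<lambda>n x. X n x - X' n x) (\<lambda>x. Y x - Y' x)"
proof -
  have "tendsto_prob M (\<lambda>n x. - X' n x) (\<lambda>x. - Y' x)"
    by (rule tendsto_prob_linear[where f=uminus, OF assms(4-6)]) (intro bounded_linear_minus bounded_linear_ident)
  from tendsto_prob_add[OF assms(1-3) this] assms(5,6) show ?thesis by simp
qed

lemma tendsto_prob_unique:
  fixes X :: "nat \<Rightarrow> 'a \<Rightarrow> 'b::euclidean_space"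
  assumes "tendsto_prob M X Y" "tendsto_prob M X Y'"
    "\<And>n. X n \<in> borel_measurable M" and [measurable]: "Y \<in> borel_measurable M" "Y' \<in> borel_measurable M"
  shows "AE x in M. Y x = Y' x"
proof -
  have "tendsto_prob M (\<lambda>n x. X n x - X n x) (\<lambda>x. Y x - Y' x)"
    by (rule tendsto_prob_diff[OF assms(1,3,4) assms(2,3,5)])
  then have "expectation (\<lambda>x. min 1 (norm (Y x - Y' x))) = 0"
    by (simp add: tendsto_prob_def LIMSEQ_const_iff norm_minus_commute)
  then have "AE x in M. min 1 (norm (Y x - Y' x)) = 0"
    using integral_nonneg_eq_0_iff_AE[OF integrable_min_norm[of "\<lambda>x. Y x - Y' x"]] by simp
  then show ?thesis by eventually_elim (auto simp: min_def split: if_splits)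
qed

lemma tendsto_prob_AE:
  fixes X :: "nat \<Rightarrow> 'a \<Rightarrow> 'b::euclidean_space"
  assumes "AE x in M. (\<lambda>n. X n x) \<longlonglongrightarrow> Y x"
    and [measurable]: "\<And>n. X n \<in> borel_measurable M" "Y \<in> borel_measurable M"
  shows "tendsto_prob M X Y"
proof -
  have "(\<lambda>n. expectation (\<lambda>x. min 1 (norm (X n x - Y x)))) \<longlonglongrightarrow> expectation (\<lambda>x. 0)"
  proof (rule integral_dominated_convergence[where w="\<lambda>_. 1"])
    show "AE x in M. (\<lambda>n. min 1 (norm (X n x - Y x))) \<longlonglongrightarrow> 0"
      using assms(1)
    proof eventually_elim
      case (elim x)
      then have "(\<lambda>n. min 1 (norm (X n x - Y x))) \<longlonglongrightarrow> min 1 (norm (Y x - Y x))"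
        by (intro tendsto_intros)
      then show ?case by simp
    qed
  qed auto
  then show ?thesis by (simp add: tendsto_prob_def)
qed

lemma tendsto_prob_L2:
  fixes X :: "nat \<Rightarrow> 'a \<Rightarrow> real"
  assumes "\<And>n. X n \<in> borel_measurable M" "Y \<in> borel_measurable M"
    "\<And>n. integrable M (\<lambda>x. (X n x - Y x)\<^sup>2)" "(\<lambda>n. expectation (\<lambda>x. (X n x - Y x)\<^sup>2)) \<longlonglongrightarrow> 0"
  shows "tendsto_prob M X Y"
proof (rule tendsto_probI)
  fix \<epsilon> :: real assume "\<epsilon> > 0"
  then have "\<epsilon>\<^sup>2 > 0" by simp
  then have "\<forall>\<^sub>F n in sequentially. expectation (\<lambda>x. (X n x - Y x)\<^sup>2) < \<epsilon>\<^sup>2"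
    using order_tendstoD(2)[OF assms(4)] by simp
  then show "\<forall>\<^sub>F n in sequentially. expectation (\<lambda>x. min 1 (norm (X n x - Y x))) \<le> \<epsilon>"
  proof eventually_elim
    case (elim n)
    \<comment> \<open>Young's inequality, weighted so that a second moment below \<epsilon>^2 makes
      each of the two terms at most \<epsilon>/2.\<close>
    have "min 1 (norm z) \<le> \<epsilon> / 2 + z\<^sup>2 / (2 * \<epsilon>)" for z :: real
    proof -
      have "0 \<le> (\<bar>z\<bar> - \<epsilon>)\<^sup>2" by simp
      then have "2 * \<epsilon> * \<bar>z\<bar> \<le> \<epsilon>\<^sup>2 + z\<^sup>2" by (simp add: power2_diff algebra_simps)
      then have "\<bar>z\<bar> \<le> (\<epsilon>\<^sup>2 + z\<^sup>2) / (2 * \<epsilon>)" using \<open>\<epsilon> > 0\<close> by (simp add: field_simps)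
      also have "\<dots> = \<epsilon> / 2 + z\<^sup>2 / (2 * \<epsilon>)" using \<open>\<epsilon> > 0\<close> by (simp add: field_simps power2_eq_square)
      finally show ?thesis by simp
    qed
    then have "expectation (\<lambda>x. min 1 (norm (X n x - Y x))) \<le> expectation (\<lambda>x. \<epsilon> / 2 + (X n x - Y x)\<^sup>2 / (2 * \<epsilon>))"
      using assms(1-3) by (intro integral_mono integrable_min_norm Bochner_Integration.integrable_add integrable_divide) auto
    also have "\<dots> = \<epsilon> / 2 + expectation (\<lambda>x. (X n x - Y x)\<^sup>2) / (2 * \<epsilon>)"
      using assms(3) by (simp add: prob_space)
    also have "\<dots> \<le> \<epsilon> / 2 + \<epsilon>\<^sup>2 / (2 * \<epsilon>)" using elim \<open>\<epsilon> > 0\<close> by (intro add_left_mono divide_right_mono) auto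
    also have "\<dots> = \<epsilon>" using \<open>\<epsilon> > 0\<close> by (simp add: power2_eq_square)
    finally show ?case .
  qed
qed

text \<open>Boundedness in \<open>L\<^sup>2\<close> gives uniform integrability: \<open>\<bar>z\<bar> \<le> K min(1, \<bar>z\<bar>) + z\<^sup>2 / K\<close>.\<close>

lemma tendsto_prob_expectation_0:
  fixes X :: "nat \<Rightarrow> 'a \<Rightarrow> real"
  assumes "tendsto_prob M X Y"
    and X: "\<And>n. integrable M (X n)" "\<And>n. integrable M (\<lambda>x. (X n x)\<^sup>2)" "\<And>n. expectation (X n) = 0"
      "\<And>n. expectation (\<lambda>x. (X n x)\<^sup>2) \<le> C"
    and Y: "Y \<in> borel_measurable M" "AE x in M. \<bar>Y x\<bar> \<le> B"
  shows "expectation Y = 0"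
proof -
  have Yi: "integrable M Y" using Y by (intro integrable_const_bound[where B=B]) auto
  have "AE x in M. (Y x)\<^sup>2 \<le> B\<^sup>2"
    using Y(2) by eventually_elim (metis abs_ge_zero power2_abs power_mono)
  then have Yi2: "integrable M (\<lambda>x. (Y x)\<^sup>2)" and Yb: "expectation (\<lambda>x. (Y x)\<^sup>2) \<le> B\<^sup>2"
    using Y(1) by (auto intro!: integrable_const_bound[where B="B\<^sup>2"] integral_le_const)
  \<comment> \<open>Bounds the second moment of X n - Y, through (x - y)^2 \<le> 2 x^2 + 2
    y^2.\<close>
  define D where "D = 2 * C + 2 * B\<^sup>2"
  have "0 \<le> expectation (\<lambda>x. (X 0 x)\<^sup>2)" by (intro Bochner_Integration.integral_nonneg) auto
  then have "C \<ge> 0" using X(4)[of 0] by linarith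
  then have "D \<ge> 0" by (simp add: D_def)
  \<comment> \<open>For fixed K the limit in n removes the truncated term and leaves D / K;
    afterwards K runs to infinity through the integers.\<close>
  have *: "\<bar>expectation Y\<bar> \<le> D / K" if K: "K \<ge> 1" for K
  proof -
    have est: "\<bar>z\<bar> \<le> K * min 1 \<bar>z\<bar> + z\<^sup>2 / K" for z
    proof -
      consider "\<bar>z\<bar> \<le> 1" | "1 < \<bar>z\<bar>" "\<bar>z\<bar> \<le> K" | "\<bar>z\<bar> > K" by linarith
      then show ?thesis
      proof cases
        case 1
        then have "\<bar>z\<bar> \<le> K * \<bar>z\<bar>" using K by (simp add: mult_le_cancel_right1)
        then show ?thesis using 1 K by (simp add: add_increasing2)
      next
        case 3
        have "\<bar>z\<bar> * K \<le> z\<^sup>2" using 3 mult_left_mono[of K "\<bar>z\<bar>" "\<bar>z\<bar>"] by (simp add: power2_eq_square)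
        then have "\<bar>z\<bar> \<le> z\<^sup>2 / K" using K by (simp add: field_simps)
        then show ?thesis using K by (simp add: add_increasing)
      qed (use K in \<open>simp add: add_increasing2\<close>)
    qed
    have "\<bar>expectation Y\<bar> \<le> K * expectation (\<lambda>x. min 1 (norm (X n x - Y x))) + D / K" for n
    proof -
      have Xm: "X n \<in> borel_measurable M" using X(1) by auto
      have XYi: "integrable M (\<lambda>x. 2 * (X n x)\<^sup>2 + 2 * (Y x)\<^sup>2)" using X Yi2 by simp
      have le: "(X n x - Y x)\<^sup>2 \<le> 2 * (X n x)\<^sup>2 + 2 * (Y x)\<^sup>2" for x
        using zero_le_power2[of "X n x + Y x"] by (simp add: power2_diff power2_sum)
      have XYi2: "integrable M (\<lambda>x. (X n x - Y x)\<^sup>2)"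
        using XYi by (rule Bochner_Integration.integrable_bound) (use Xm Y(1) le in \<open>auto intro!: AE_I2\<close>)
      have "expectation (\<lambda>x. (X n x - Y x)\<^sup>2) \<le> expectation (\<lambda>x. 2 * (X n x)\<^sup>2 + 2 * (Y x)\<^sup>2)"
        using XYi XYi2 le by (intro integral_mono) auto
      also have "\<dots> \<le> D" using X(2) X(4)[of n] Yi2 Yb by (simp add: D_def)
      finally have E2: "expectation (\<lambda>x. (X n x - Y x)\<^sup>2) \<le> D" .
      have "\<bar>expectation Y\<bar> = \<bar>expectation (\<lambda>x. X n x - Y x)\<bar>" using X Yi by simp
      also have "\<dots> \<le> expectation (\<lambda>x. \<bar>X n x - Y x\<bar>)" by (rule integral_abs_bound)
      also have "\<dots> \<le> expectation (\<lambda>x. K * min 1 (norm (X n x - Y x)) + (X n x - Y x)\<^sup>2 / K)"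
        using X(1) Yi XYi2 est Xm Y(1)
        by (intro integral_mono Bochner_Integration.integrable_add integrable_mult_right integrable_min_norm integrable_abs integrable_divide) auto
      also have "\<dots> = K * expectation (\<lambda>x. min 1 (norm (X n x - Y x))) + expectation (\<lambda>x. (X n x - Y x)\<^sup>2) / K"
        using XYi2 integrable_min_norm[of "\<lambda>x. X n x - Y x"] Xm Y(1) by simp
      also have "\<dots> \<le> K * expectation (\<lambda>x. min 1 (norm (X n x - Y x))) + D / K"
        using E2 K by (simp add: divide_right_mono)
      finally show ?thesis .
    qed
    moreover have "(\<lambda>n. K * expectation (\<lambda>x. min 1 (norm (X n x - Y x))) + D / K) \<longlonglongrightarrow> K * 0 + D / K"
      using assms(1) unfolding tendsto_prob_def by (intro tendsto_intros)
    ultimately show ?thesis using LIMSEQ_le_const[of _ "K * 0 + D / K" "\<bar>expectation Y\<bar>"] by auto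
  qed
  have "(\<lambda>n. D / real (Suc n)) \<longlonglongrightarrow> 0" by real_asymp
  moreover have "\<bar>expectation Y\<bar> \<le> D / real (Suc n)" for n using *[of "real (Suc n)"] by simp
  ultimately have "\<bar>expectation Y\<bar> \<le> 0" by (intro LIMSEQ_le_const) auto
  then show ?thesis by simp
qed

end

section \<open>Mesh limits along a chosen sequence of partitions\<close>

lemma fine_partition_mono: "fine_partition t s \<delta> n p \<Longrightarrow> \<delta> \<le> \<delta>' \<Longrightarrow> fine_partition t s \<delta>' n p"
  unfolding fine_partition_def by (auto intro: less_le_trans)

text \<open>Splitting at the level \<epsilon>/2, the truncated distance is at most \<epsilon>/2 plus
  the indicator of the exceedance set. The sums are asked to be measurable so that the probability
  of this set bounds the expectation.\<close>

lemma mesh_limit_tendsto_prob: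
  fixes S :: "nat \<Rightarrow> (nat \<Rightarrow> real) \<Rightarrow> 'd::finite path \<Rightarrow> 'b::euclidean_space"
  assumes "prob_space P" "mesh_limit P t s S I"
    and p: "\<forall>\<^sub>F n in sequentially. fine_partition t s (\<delta> n) (m n) (p n)" "\<delta> \<longlonglongrightarrow> 0"
    and S: "\<And>n. S (m n) (p n) \<in> borel_measurable P"
  shows "tendsto_prob P (\<lambda>n. S (m n) (p n)) I"
proof -
  interpret prob_space P by fact
  have I: "I \<in> borel_measurable P" using assms(2) by (simp add: mesh_limit_def)
  show ?thesis
  proof (rule tendsto_probI)
    fix \<epsilon> :: real assume "\<epsilon> > 0"
    then have "\<epsilon> / 2 > 0" by simp
    then obtain \<eta> where "\<eta> > 0" and \<eta>: "\<And>n q. fine_partition t s \<eta> n q \<Longrightarrow>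
        measure P {\<omega> \<in> space P. norm (S n q \<omega> - I \<omega>) > \<epsilon> / 2} < \<epsilon> / 2"
      using assms(2) unfolding mesh_limit_def by blast
    have "\<forall>\<^sub>F n in sequentially. \<delta> n < \<eta>" using order_tendstoD(2)[OF p(2) \<open>\<eta> > 0\<close>] .
    with p(1) show "\<forall>\<^sub>F n in sequentially. expectation (\<lambda>x. min 1 (norm (S (m n) (p n) x - I x))) \<le> \<epsilon>"
    proof eventually_elim
      case (elim n)
      let ?A = "{\<omega> \<in> space P. norm (S (m n) (p n) \<omega> - I \<omega>) > \<epsilon> / 2}"
      have Z: "(\<lambda>\<omega>. S (m n) (p n) \<omega> - I \<omega>) \<in> borel_measurable P" using S I by simp
      then have A: "?A \<in> events" by measurable
      have "measure P ?A < \<epsilon> / 2" by (rule \<eta>[OF fine_partition_mono[OF elim(1) less_imp_le[OF elim(2)]]])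
      have "expectation (\<lambda>x. min 1 (norm (S (m n) (p n) x - I x))) \<le> expectation (\<lambda>x. \<epsilon> / 2 + indicator ?A x)"
      proof (rule integral_mono)
        show "integrable P (\<lambda>x. \<epsilon> / 2 + indicat_real ?A x)"
          using A by (intro Bochner_Integration.integrable_add integrable_real_indicator) (auto simp: emeasure_eq_measure)
      qed (use integrable_min_norm[OF Z] \<open>\<epsilon> > 0\<close> in \<open>auto simp: indicator_def\<close>)
      also have "\<dots> = \<epsilon> / 2 + measure P ?A" using A by (simp add: prob_space emeasure_eq_measure)
      finally show ?case using \<open>measure P ?A < \<epsilon> / 2\<close> by simp
    qed
  qed
qed

lemma tendsto_prob_distr:
  assumes [measurable]: "X \<in> measurable M P" "\<And>n. S n \<in> borel_measurable P" "I \<in> borel_measurable P"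
    and "tendsto_prob (distr M P X) S I"
  shows "tendsto_prob M (\<lambda>n x. S n (X x)) (\<lambda>x. I (X x))"
proof -
  have "(LINT y|distr M P X. min 1 (norm (S n y - I y))) = (LINT x|M. min 1 (norm (S n (X x) - I (X x))))" for n
    by (intro integral_distr) auto
  then show ?thesis using assms(4) by (simp add: tendsto_prob_def)
qed

section \<open>Uniform partitions and Riemann sums\<close>

definition upart :: "real \<Rightarrow> real \<Rightarrow> nat \<Rightarrow> nat \<Rightarrow> real" where
  "upart t s n k = t + real k * ((s - t) / real n)"

lemma upart_0 [simp]: "upart t s n 0 = t"
  by (simp add: upart_def)

lemma upart_n [simp]: "n > 0 \<Longrightarrow> upart t s n n = s"
  by (simp add: upart_def)

lemma upart_step: "upart t s n (Suc k) - upart t s n k = (s - t) / real n"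
  unfolding upart_def by (simp only: of_nat_Suc distrib_right)

lemma upart_mono: "t \<le> s \<Longrightarrow> upart t s n k \<le> upart t s n (Suc k)"
  using upart_step[of t s n k] by (smt (verit) divide_nonneg_nonneg of_nat_0_le_iff)

lemma upart_in:
  assumes "t \<le> s" "k \<le> n"
  shows "upart t s n k \<in> {t..s}"
proof (cases "n = 0")
  case False
  then have "real k * ((s - t) / real n) \<le> real n * ((s - t) / real n)"
    using assms by (intro mult_right_mono) auto
  then show ?thesis using assms False by (auto simp: upart_def)
qed (use assms in auto)

lemma upart_less:
  assumes "t < s" "k < n"
  shows "upart t s n k < s"
proof -
  have "real k * ((s - t) / real n) < real n * ((s - t) / real n)"
    using assms by (intro mult_strict_right_mono) auto
  then show ?thesis using assms by (auto simp: upart_def)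
qed

lemma sum_lessThan_add: "(\<Sum>k<(n::nat) + m. f k) = (\<Sum>k<n. f k) + (\<Sum>k<m. f (n + k) :: 'a::comm_monoid_add)"
  by (induction m) (auto simp: add.assoc)

text \<open>The two mesh limits are taken along partitions that agree on \<open>[0, t]\<close>.\<close>

lemma mesh_limit_increment:
  fixes F :: "real \<Rightarrow> real \<Rightarrow> 'd::finite path \<Rightarrow> 'b::euclidean_space"
  assumes P: "prob_space P" and ts: "0 \<le> t" "t \<le> s"
    and It: "mesh_limit P 0 t (\<lambda>n p \<omega>. \<Sum>k<n. F (p k) (p (Suc k)) \<omega>) It"
    and Is: "mesh_limit P 0 s (\<lambda>n p \<omega>. \<Sum>k<n. F (p k) (p (Suc k)) \<omega>) Is"
    and F: "\<And>q r. 0 \<le> q \<Longrightarrow> q \<le> r \<Longrightarrow> r \<le> s \<Longrightarrow> F q r \<in> borel_measurable P"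
  shows "tendsto_prob P (\<lambda>n \<omega>. \<Sum>k<n. F (upart t s n k) (upart t s n (Suc k)) \<omega>) (\<lambda>\<omega>. Is \<omega> - It \<omega>)"
proof -
  interpret prob_space P by fact
  define S where "S n p \<omega> = (\<Sum>k<n. F (p k) (p (Suc k)) \<omega>)" for n :: nat and p \<omega>
  have It': "mesh_limit P 0 t S It" and Is': "mesh_limit P 0 s S Is"
    using It Is unfolding S_def[abs_def] by auto
  define p where "p n k = (if k < n then upart 0 t n k else upart t s n (k - n))" for n k
  \<comment> \<open>One mesh bound for the partition of [0, t] and for its continuation to s. The
    added 1 makes it strictly larger than both step lengths, even when t = s or s = 0.\<close>
  define \<delta> where "\<delta> n = (s + 1) / real n" for n :: nat
  have "\<delta> \<longlonglongrightarrow> 0" unfolding \<delta>_def by real_asymp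
  have step1: "t / real n < \<delta> n" and step2: "(s - t) / real n < \<delta> n" if "n > 0" for n
    using that ts by (auto simp: \<delta>_def divide_strict_right_mono)
  have pS: "(p n k = upart 0 t n k \<and> p n (Suc k) = upart 0 t n (Suc k)) \<or>
      (p n k = upart t s n (k - n) \<and> p n (Suc k) = upart t s n (Suc (k - n)) \<and> \<not> k < n)" if "n > 0" for n k
  proof (cases "Suc k = n")
    case True then show ?thesis using that by (auto simp: p_def)
  next
    case False
    then have "Suc k < n \<or> n \<le> k" by auto
    then show ?thesis by (auto simp: p_def Suc_diff_le)
  qed
  have fine1: "fine_partition 0 t (\<delta> n) n (upart 0 t n)" if "n > 0" for n
    unfolding fine_partition_def using that ts step1[OF that] upart_mono[of 0 t] by (auto simp: upart_step)
  have fine2: "fine_partition 0 s (\<delta> n) (n + n) (p n)" if n: "n > 0" for n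
    unfolding fine_partition_def
  proof (intro conjI allI impI)
    show "p n 0 = 0" using n by (simp add: p_def)
    show "p n (n + n) = s" using n by (simp add: p_def)
    fix k assume "k < n + n"
    show "p n k \<le> p n (Suc k)" using pS[OF n, of k] upart_mono[of 0 t] upart_mono[of t s] ts by auto
    show "p n (Suc k) - p n k < \<delta> n"
      using pS[OF n, of k] step1[OF n] step2[OF n] by (auto simp: upart_step)
  qed
  have Sm1: "S n (upart t' s' n) \<in> borel_measurable P" if "0 \<le> t'" "t' \<le> s'" "s' \<le> s" for n t' s'
    unfolding S_def
  proof (intro borel_measurable_sum F)
    fix k assume "k \<in> {..<n}"
    then show "0 \<le> upart t' s' n k" "upart t' s' n k \<le> upart t' s' n (Suc k)" "upart t' s' n (Suc k) \<le> s"
      using that upart_in[of t' s' k n] upart_in[of t' s' "Suc k" n] upart_mono[of t' s' n k] by auto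
  qed
  have Sm2: "S n (upart 0 t n) \<in> borel_measurable P" for n using Sm1 ts by auto
  have split: "S (n + n) (p n) \<omega> = S n (upart 0 t n) \<omega> + S n (upart t s n) \<omega>" for n \<omega>
  proof -
    have "S n (p n) \<omega> = S n (upart 0 t n) \<omega>"
      unfolding S_def
    proof (intro sum.cong refl)
      fix k assume "k \<in> {..<n}"
      then show "F (p n k) (p n (Suc k)) \<omega> = F (upart 0 t n k) (upart 0 t n (Suc k)) \<omega>"
        using pS[of n k] by auto
    qed
    moreover have "(\<Sum>k<n. F (p n (n + k)) (p n (Suc (n + k))) \<omega>) = S n (upart t s n) \<omega>"
      unfolding S_def by (intro sum.cong) (auto simp: p_def)
    ultimately show ?thesis unfolding S_def by (subst sum_lessThan_add) auto
  qed
  have Im: "It \<in> borel_measurable P" "Is \<in> borel_measurable P" using It Is by (auto simp: mesh_limit_def)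
  have T1: "tendsto_prob P (\<lambda>n. S n (upart 0 t n)) It"
    by (rule mesh_limit_tendsto_prob[where S=S and m="\<lambda>n. n" and p="upart 0 t", OF P It' _ \<open>\<delta> \<longlonglongrightarrow> 0\<close> Sm2])
       (auto intro!: eventually_sequentiallyI[of 1] fine1)
  have Sm3: "S (n + n) (p n) \<in> borel_measurable P" for n
    unfolding split[abs_def] using Sm2 Sm1[of t s] ts by auto
  have T2: "tendsto_prob P (\<lambda>n. S (n + n) (p n)) Is"
    by (rule mesh_limit_tendsto_prob[where S=S and m="\<lambda>n. n + n" and p=p, OF P Is' _ \<open>\<delta> \<longlonglongrightarrow> 0\<close> Sm3])
       (auto intro!: eventually_sequentiallyI[of 1] fine2)
  have "tendsto_prob P (\<lambda>n \<omega>. S (n + n) (p n) \<omega> - S n (upart 0 t n) \<omega>) (\<lambda>\<omega>. Is \<omega> - It \<omega>)"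
    by (rule tendsto_prob_diff[OF T2 Sm3 Im(2) T1 Sm2 Im(1)])
  then show ?thesis by (simp add: split) (simp add: S_def)
qed

lemma set_lborel_integral_eq_integral:
  fixes f :: "real \<Rightarrow> real"
  assumes "continuous_on {t..s} f"
  shows "(LINT r:{t..s}|lborel. f r) = integral {t..s} f"
  using set_borel_integral_eq_integral(2)[OF borel_integrable_atLeastAtMost'[OF assms]] .

text \<open>Each summand is compared with the increment of the primitive over the same cell: by the
  mean value theorem the latter is the step length times a value of f in the cell, and f is
  uniformly continuous.\<close>

lemma riemann_sums_tendsto:
  fixes f :: "real \<Rightarrow> real"
  assumes "t \<le> s" "continuous_on {t..s} f"
  shows "(\<lambda>n. \<Sum>k<n. f (upart t s n k) * ((s - t) / real n)) \<longlonglongrightarrow> (LINT r:{t..s}|lborel. f r)"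
proof (cases "t = s")
  case True
  then show ?thesis using set_lborel_integral_eq_integral[OF assms(2)] by simp
next
  case False
  then have "t < s" using assms(1) by simp
  define F where "F x = integral {t..x} f" for x
  have F': "(F has_real_derivative f x) (at x within {t..s})" if "x \<in> {t..s}" for x
    unfolding F_def using integral_has_real_derivative[OF assms(2) that] .
  show ?thesis
    unfolding set_lborel_integral_eq_integral[OF assms(2)]
  proof (rule LIMSEQ_I)
    fix e :: real assume "e > 0"
    \<comment> \<open>With an error of c per unit of time the whole interval contributes
      e/2.\<close>
    define c where "c = e / (2 * (s - t))"
    have "c > 0" using \<open>e > 0\<close> \<open>t < s\<close> by (simp add: c_def)
    have "uniformly_continuous_on {t..s} f" using assms(2) by (intro compact_uniformly_continuous) auto
    then obtain \<delta> where "\<delta> > 0" and \<delta>: "\<And>x y. x \<in> {t..s} \<Longrightarrow> y \<in> {t..s} \<Longrightarrow> dist y x < \<delta> \<Longrightarrow> dist (f y) (f x) < c"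
      using \<open>c > 0\<close> unfolding uniformly_continuous_on_def by metis
    have "(\<lambda>n. (s - t) / real n) \<longlonglongrightarrow> 0" by real_asymp
    then have "\<forall>\<^sub>F n in sequentially. (s - t) / real n < \<delta>" using order_tendstoD(2) \<open>\<delta> > 0\<close> by blast
    then obtain n0 where n0: "\<And>n. n \<ge> n0 \<Longrightarrow> (s - t) / real n < \<delta>" by (auto simp: eventually_sequentially)
    have "norm ((\<Sum>k<n. f (upart t s n k) * ((s - t) / real n)) - integral {t..s} f) < e" if n: "n \<ge> max 1 n0" for n
    proof -
      define h where "h = (s - t) / real n"
      have h: "0 < h" "h < \<delta>" using n n0[of n] \<open>t < s\<close> by (auto simp: h_def)
      have loc: "\<bar>f (upart t s n k) * h - (F (upart t s n (Suc k)) - F (upart t s n k))\<bar> \<le> c * h" if k: "k < n" for k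
      proof -
        let ?a = "upart t s n k" and ?b = "upart t s n (Suc k)"
        have ab: "?b - ?a = h" "?a \<in> {t..s}" "?b \<in> {t..s}"
          using upart_step[of t s n k] upart_in[of t s k n] upart_in[of t s "Suc k" n] k \<open>t < s\<close> by (auto simp: h_def)
        have "\<exists>x\<in>{?a<..<?b}. F ?b - F ?a = (\<lambda>y. f x * y) (?b - ?a)"
        proof (rule mvt_simple)
          show "?a < ?b" using ab h by simp
          fix x assume "?a \<le> x" "x \<le> ?b"
          then have "x \<in> {t..s}" using ab by auto
          from has_field_derivative_subset[OF F'[OF this], of "{?a..?b}"] ab
          show "(F has_derivative (\<lambda>y. f x * y)) (at x within {?a..?b})"
            unfolding has_field_derivative_def by auto
        qed
        then obtain x where x: "?a < x" "x < ?b" "F ?b - F ?a = f x * h" using ab by auto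
        have "dist (f ?a) (f x) < c" using x ab h by (intro \<delta>) (auto simp: dist_real_def)
        then have "\<bar>f ?a - f x\<bar> * h \<le> c * h" using h by (intro mult_right_mono) (auto simp: dist_real_def)
        then show ?thesis using h by (simp add: x(3) left_diff_distrib[symmetric] abs_mult)
      qed
      have tel: "(\<Sum>k<n. F (upart t s n (Suc k)) - F (upart t s n k)) = integral {t..s} f"
        using sum_lessThan_telescope[of "\<lambda>k. F (upart t s n k)" n] n by (simp add: F_def)
      have "\<bar>(\<Sum>k<n. f (upart t s n k) * h) - integral {t..s} f\<bar> =
          \<bar>\<Sum>k<n. f (upart t s n k) * h - (F (upart t s n (Suc k)) - F (upart t s n k))\<bar>"
        unfolding tel[symmetric] by (simp only: sum_subtractf)
      also have "\<dots> \<le> (\<Sum>k<n. c * h)" using loc by (intro order_trans[OF sum_abs] sum_mono) auto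
      also have "\<dots> = c * (s - t)" using n by (simp add: h_def)
      also have "\<dots> = e / 2" using \<open>t < s\<close> by (simp add: c_def field_simps)
      also have "\<dots> < e" using \<open>e > 0\<close> by simp
      finally show ?thesis by (simp add: h_def)
    qed
    then show "\<exists>no. \<forall>n\<ge>no. norm ((\<Sum>k<n. f (upart t s n k) * ((s - t) / real n)) - integral {t..s} f) < e" by blast
  qed
qed

section \<open>The law of a smooth path followed by a drifted Brownian motion\<close>

definition outer :: "real ^ 'd \<Rightarrow> real ^ 'd ^ 'd" where
  "outer v = (\<chi> i j. v $ i * v $ j)"

lemma outer_nth [simp]: "outer v $ i $ j = v $ i * v $ j"
  by (simp add: outer_def)

lemma outer_measurable: "outer \<in> borel_measurable borel"
  unfolding outer_def[abs_def] by (intro borel_measurable_continuous_onI continuous_intros)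

lemma outer_0 [simp]: "outer 0 = 0"
  by (simp add: vec_eq_iff)

lemma outer_Sym: "c *\<^sub>R outer v \<in> Sym"
  by (simp add: Sym_def transpose_def vec_eq_iff mult.commute)

lemma outer_mult_vec: "outer v *v x = (v \<bullet> x) *\<^sub>R v"
  by (simp add: vec_eq_iff matrix_vector_mult_def inner_vec_def sum_distrib_left sum_distrib_right mult_ac)

lemma outer_psd: "c \<ge> 0 \<Longrightarrow> psd (c *\<^sub>R outer v)"
  by (simp add: psd_def scaleR_matrix_vector_assoc[symmetric] outer_mult_vec inner_commute mult.assoc)

lemma outer_square: "outer v ** outer v = (v \<bullet> v) *\<^sub>R outer v"
  by (simp add: vec_eq_iff matrix_matrix_mult_def inner_vec_def sum_distrib_left sum_distrib_right mult_ac)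

text \<open>The class of measures is described by a nonnegative symmetric \<beta> whose square is
  the covariance rate; for the rate v v^T this root is v v^T / norm v. For v = 0 the convention
  inverse 0 = 0 keeps the formula valid.\<close>

lemma scaled_outer_square: "(inverse (norm v) *\<^sub>R outer v) ** (inverse (norm v) *\<^sub>R outer v) = outer v"
proof (cases "v = 0")
  case False
  then have "(v \<bullet> v) = norm v * norm v" by (simp add: dot_square_norm power2_eq_square)
  moreover have "inverse (norm v) * inverse (norm v) * (norm v * norm v) = 1"
    using False by (simp add: field_simps)
  ultimately show ?thesis by (simp add: scalar_matrix_assoc[symmetric] matrix_scalar_ac outer_square)
qed simp

context brownian
begin

lemma past_increment_expectation:
  assumes "0 \<le> s" "s \<le> r" "Y \<in> borel_measurable (past s)" "\<And>x. x \<in> space N \<Longrightarrow> \<bar>Y x\<bar> \<le> C"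
  shows "integrable N (\<lambda>x. Y x * (W r x - W s x))" "expectation (\<lambda>x. Y x * (W r x - W s x)) = 0"
  using brownian_sum_moments(1,3)[of "\<lambda>k. if k = 0 then s else r" 1 "\<lambda>_. Y" C] assms by auto

end

lemma progressive_deterministic:
  fixes f :: "real \<Rightarrow> 'b::euclidean_space"
  assumes "f \<in> borel_measurable borel"
  shows "progressive T t (\<lambda>r (\<omega> :: 'd::finite path). f r)"
  unfolding progressive_def
proof
  fix s
  have "(\<lambda>z. f (fst z)) \<in> borel_measurable (restrict_space borel {t..s} \<Otimes>\<^sub>M (Filt T t s :: 'd path measure))"
    by (rule measurable_compose[OF measurable_fst]) (rule measurable_restrict_space1[OF assms])
  then show "(\<lambda>(r, \<omega> :: 'd path). f r) \<in> borel_measurable (restrict_space borel {t..s} \<Otimes>\<^sub>M Filt T t s)"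
    by (simp add: case_prod_beta)
qed

lemma fine_partition_in:
  assumes "fine_partition t s \<delta> n p" "k \<le> n"
  shows "p k \<in> {t..s}"
proof -
  have mono: "p i \<le> p j" if "i \<le> j" "j \<le> n" for i j
    using that
  proof (induction j)
    case (Suc j)
    then have "p j \<le> p (Suc j)" using assms(1) by (simp add: fine_partition_def)
    with Suc show ?case by (cases "i = Suc j") auto
  qed simp
  from mono[of 0 k] mono[of k n] assms show ?thesis by (simp add: fine_partition_def)
qed

text \<open>The path \<open>l\<close>, with derivative \<open>\<alpha>\<close>, is arbitrary up to time \<open>t\<close> and has slope \<open>b\<close> afterwards; the
  Brownian motion in direction \<open>v\<close> is started at time \<open>t\<close>.\<close>

locale driven_path = brownian N W for N :: "'w measure" and W +
  fixes T t :: real and l \<alpha> :: "real \<Rightarrow> real ^ 'd::finite" and b v :: "real ^ 'd"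
  assumes T: "0 < T" and t: "0 \<le> t" "t \<le> T"
    and l_continuous: "continuous_on {0..T} l" and l_0: "l 0 = 0"
    and l_affine: "s \<in> {t..T} \<Longrightarrow> l s = l t + (s - t) *\<^sub>R b"
    and \<alpha>_measurable: "\<alpha> \<in> borel_measurable borel"
    and \<alpha>_bounded: "\<exists>L. \<forall>r\<in>{0..T}. norm (\<alpha> r) \<le> L"
    and \<alpha>_integral: "s \<in> {0..T} \<Longrightarrow> (LINT r:{0..s}|lborel. \<alpha> r) = l s"
begin

section \<open>The random path, its law, and the membership of the law in the class of
  measures\<close>

definition X :: "'w \<Rightarrow> 'd path" where
  "X x = (\<lambda>s\<in>{0..T}. l s + W (max 0 (s - t)) x *\<^sub>R v)"

definition law :: "'d path measure" where
  "law = distr N (Filt T 0 T) X"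

lemma X_eq: "s \<in> {0..T} \<Longrightarrow> X x s = l s + W (max 0 (s - t)) x *\<^sub>R v"
  by (simp add: X_def)

lemma X_in_Omega: "x \<in> space N \<Longrightarrow> X x \<in> Omega T 0"
proof -
  assume x: "x \<in> space N"
  have "continuous_on {0..T} (\<lambda>s. W (max 0 (s - t)) x)"
    by (rule continuous_on_compose2[OF W_continuous[OF x]]) (auto intro!: continuous_intros)
  then have "continuous_on {0..T} (\<lambda>s. l s + W (max 0 (s - t)) x *\<^sub>R v)"
    by (intro continuous_intros l_continuous)
  then have "continuous_on {0..T} (X x)"
    by (rule continuous_on_eq) (simp add: X_eq)
  moreover have "X x 0 = 0" using T t l_0 W_0[OF x] by (simp add: X_eq)
  moreover have "X x \<in> extensional {0..T}" by (simp add: X_def)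
  ultimately show ?thesis by (simp add: Omega_def)
qed

lemma X_past_measurable:
  assumes "s \<in> {0..T}"
  shows "X \<in> measurable (past (max 0 (s - t))) (Filt T 0 s)"
proof (rule measurable_into_Filt)
  fix r assume r: "r \<in> {0..s}"
  have "W (max 0 (r - t)) \<in> borel_measurable (past (max 0 (s - t)))"
    using r by (intro W_past_measurable) auto
  then have "(\<lambda>x. l r + W (max 0 (r - t)) x *\<^sub>R v) \<in> borel_measurable (past (max 0 (s - t)))"
    by (intro borel_measurable_add borel_measurable_scaleR borel_measurable_const)
  then show "(\<lambda>x. X x r) \<in> borel_measurable (past (max 0 (s - t)))"
    using r assms by (simp add: X_eq)
qed (simp add: X_in_Omega)

lemma X_measurable: "X \<in> measurable N (Filt T 0 T)"
proof (rule measurable_into_Filt)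
  fix r assume r: "r \<in> {0..T}"
  have "(\<lambda>x. l r + W (max 0 (r - t)) x *\<^sub>R v) \<in> borel_measurable N"
    by (intro borel_measurable_add borel_measurable_scaleR borel_measurable_const W_measurable) simp
  then show "(\<lambda>x. X x r) \<in> borel_measurable N" using r by (simp add: X_eq)
qed (rule X_in_Omega)

lemma sets_law [simp]: "sets law = sets (Filt T 0 T)" and space_law [simp]: "space law = Omega T 0"
  by (simp_all add: law_def)

lemma law_measurable: "f \<in> borel_measurable (Filt T 0 T) \<longleftrightarrow> f \<in> borel_measurable law"
  by (simp add: law_def)

lemma prob_space_law: "prob_space law"
  unfolding law_def by (rule prob_space_distr[OF X_measurable])

lemma compensated_X:
  assumes "s \<in> {0..T}"
  shows "X x s - (LINT r:{0..s}|lborel. \<alpha> r) = W (max 0 (s - t)) x *\<^sub>R v"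
  using assms by (simp add: X_eq \<alpha>_integral)

text \<open>After compensation the path is W v with the clock started at t. An event of the
  filtration at time s pulls back along \<open>X\<close> to an event of the past of W, whose
  indicator is a bounded weight independent of the later increment.\<close>

lemma martingale_law:
  "is_martingale T 0 law (\<lambda>s \<omega>. (\<omega> s - (LINT r:{0..s}|lborel. \<alpha> r)) $ i)"
proof -
  define m where "m s \<omega> = (\<omega> s - (LINT r:{0..s}|lborel. \<alpha> r)) $ i" for s and \<omega> :: "'d path"
  have mX: "m s (X x) = W (max 0 (s - t)) x * v $ i" if "s \<in> {0..T}" for s x
    unfolding m_def compensated_X[OF that] by simp
  have m1: "m s \<in> borel_measurable (Filt T 0 s)" if "s \<in> {0..T}" for s
  proof -
    have "(\<lambda>y :: real ^ 'd. y $ i) \<in> borel_measurable borel"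
      by (intro borel_measurable_continuous_onI continuous_intros)
    moreover have "(\<lambda>\<omega>. \<omega> s - (LINT r:{0..s}|lborel. \<alpha> r)) \<in> borel_measurable (Filt T 0 s)"
      using that by (intro borel_measurable_diff measurable_eval_Filt borel_measurable_const) simp
    ultimately show ?thesis unfolding m_def using measurable_compose by blast
  qed
  have m2: "m s \<in> borel_measurable (Filt T 0 T)" if "s \<in> {0..T}" for s
    using Filt_measurable_mono[OF m1[OF that]] that by simp
  have WI: "integrable N (W r)" if "0 \<le> r" for r
    using W_increment_moments(1)[of 0 r 1] that W_0 by (simp cong: Bochner_Integration.integrable_cong)
  have mI: "integrable law (m s)" if "s \<in> {0..T}" for s
    unfolding law_def integrable_distr_eq[OF X_measurable m2[OF that]] mX[OF that]
    by (intro integrable_mult_left WI) simp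
  show ?thesis
    unfolding is_martingale_def m_def[symmetric]
  proof (intro conjI ballI)
    fix s assume "s \<in> {0..T}"
    then show "m s \<in> borel_measurable (Filt T 0 s)" "integrable law (m s)"
      using m1 mI by auto
  next
    fix s r assume s: "s \<in> {0..T}" and r: "r \<in> {s..T}"
    then have r': "r \<in> {0..T}" by auto
    interpret law: prob_space law by (rule prob_space_law)
    interpret finite_measure_subalgebra law "Filt T 0 s"
      by unfold_locales (use sets_Filt_mono[of s T T 0] s in \<open>auto simp: subalgebra_def\<close>)
    show "AE \<omega> in law. real_cond_exp law (Filt T 0 s) (m r) \<omega> = m s \<omega>"
    proof (rule real_cond_exp_charact)
      fix A :: "'d path set" assume A: "A \<in> sets (Filt T 0 s)"
      then have A': "A \<in> sets (Filt T 0 T)" using sets_Filt_mono[of s T T 0] s by auto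
      define Y where "Y x = indicat_real A (X x)" for x
      have Ym: "Y \<in> borel_measurable (past (max 0 (s - t)))"
        unfolding Y_def using X_past_measurable[OF s] borel_measurable_indicator[OF A] by (rule measurable_compose)
      have YN: "Y \<in> borel_measurable N" using past_measurable[OF Ym] .
      have E: "(\<integral>\<omega>\<in>A. m q \<omega> \<partial>law) = expectation (\<lambda>x. Y x * (W (max 0 (q - t)) x * v $ i))" if q: "q \<in> {0..T}" for q
        unfolding set_lebesgue_integral_def law_def Y_def real_scaleR_def
        using A' m2[OF q] by (subst integral_distr[OF X_measurable]) (auto simp: mX[OF q])
      have I: "integrable N (\<lambda>x. Y x * (W (max 0 (q - t)) x * v $ i))" if q: "q \<in> {0..T}" for q
      proof (rule Bochner_Integration.integrable_bound)
        show "integrable N (\<lambda>x. W (max 0 (q - t)) x * v $ i)" by (intro integrable_mult_left WI) simp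
        then show "(\<lambda>x. Y x * (W (max 0 (q - t)) x * v $ i)) \<in> borel_measurable N" using YN by auto
        show "AE x in N. norm (Y x * (W (max 0 (q - t)) x * v $ i)) \<le> norm (W (max 0 (q - t)) x * v $ i)"
          by (intro AE_I2) (simp add: Y_def indicator_def)
      qed
      have "expectation (\<lambda>x. Y x * (W (max 0 (r - t)) x - W (max 0 (s - t)) x)) = 0"
        using r by (intro past_increment_expectation[OF _ _ Ym, where C=1]) (auto simp: Y_def indicator_def)
      then have "expectation (\<lambda>x. Y x * (W (max 0 (r - t)) x - W (max 0 (s - t)) x) * v $ i) = 0" by simp
      also have "(\<lambda>x. Y x * (W (max 0 (r - t)) x - W (max 0 (s - t)) x) * v $ i) =
        (\<lambda>x. Y x * (W (max 0 (r - t)) x * v $ i) - Y x * (W (max 0 (s - t)) x * v $ i))"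
        by (simp add: fun_eq_iff algebra_simps)
      finally show "(\<integral>\<omega>\<in>A. m r \<omega> \<partial>law) = (\<integral>\<omega>\<in>A. m s \<omega> \<partial>law)"
        using I[OF s] I[OF r'] by (simp add: E[OF s] E[OF r'])
    qed (use mI s r' m1 in auto)
  qed
qed

lemma integral_quadratic_rate:
  assumes "s \<in> {0..T}"
  shows "(LINT r:{0..s}|lborel. (if t \<le> r then outer v else 0)) = max 0 (s - t) *\<^sub>R outer v"
proof -
  have "(LINT r:{0..s}|lborel. (if t \<le> r then outer v else 0)) = (LINT r|lborel. indicator {t..s} r *\<^sub>R outer v)"
    unfolding set_lebesgue_integral_def using t by (intro Bochner_Integration.integral_cong) (auto simp: indicator_def)
  also have "\<dots> = measure lborel {t..s} *\<^sub>R outer v"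
    by (cases "t \<le> s") auto
  also have "\<dots> = max 0 (s - t) *\<^sub>R outer v" by (cases "t \<le> s") auto
  finally show ?thesis .
qed

lemma quad_variation_law:
  "quad_variation T 0 law (\<lambda>s \<omega>. \<omega> s - (LINT r:{0..s}|lborel. \<alpha> r))
     (\<lambda>s \<omega>. LINT r:{0..s}|lborel. (if t \<le> r then outer v else 0))"
  unfolding quad_variation_def
proof (intro conjI ballI)
  have "continuous_on {0..T} (\<lambda>s. max 0 (s - t) *\<^sub>R outer v)" by (intro continuous_intros)
  then have "continuous_on {0..T} (\<lambda>s. LINT r:{0..s}|lborel. (if t \<le> r then outer v else 0))"
    by (rule continuous_on_eq) (simp add: integral_quadratic_rate)
  then show "AE \<omega> in law. continuous_on {0..T} (\<lambda>s. LINT r:{0..s}|lborel. (if t \<le> r then outer v else 0))" by simp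
next
  fix s assume s: "s \<in> {0..T}"
  define M where "M q \<omega> = \<omega> q - (LINT r:{0..q}|lborel. \<alpha> r)" for q and \<omega> :: "'d path"
  define S where "S n p \<omega> = (\<Sum>k<n. \<chi> i j. (M (p (Suc k)) \<omega> - M (p k) \<omega>) $ i * (M (p (Suc k)) \<omega> - M (p k) \<omega>) $ j)"
    for n :: nat and p \<omega>
  define c where "c = norm (outer v)"
  interpret law: prob_space law by (rule prob_space_law)
  have "mesh_limit law 0 s S (\<lambda>\<omega>. max 0 (s - t) *\<^sub>R outer v)"
    unfolding mesh_limit_def
  proof (intro conjI allI impI)
    fix \<epsilon> :: real assume "\<epsilon> > 0"
    \<comment> \<open>Chebyshev's inequality bounds the probability by (c / \<epsilon>)^2 * 2
      \<delta> T, which has to be below \<epsilon>. The added 1 in the denominator covers c = 0 and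
      makes the inequality strict.\<close>
    define \<delta> where "\<delta> = \<epsilon> ^ 3 / (2 * T * c\<^sup>2 + 1)"
    have pos: "2 * T * c\<^sup>2 + 1 > 0" using T by (simp add: add_nonneg_pos)
    have "\<delta> > 0" using \<open>\<epsilon> > 0\<close> pos by (simp add: \<delta>_def)
    moreover have "measure law {\<omega> \<in> space law. norm (S n p \<omega> - max 0 (s - t) *\<^sub>R outer v) > \<epsilon>} < \<epsilon>"
      if p: "fine_partition 0 s \<delta> n p" for n p
    proof -
      \<comment> \<open>Partition points before t are all sent to Brownian time 0, so cells there
        contribute nothing and the cell containing t only its part after t.\<close>
      define \<theta> where "\<theta> k = max 0 (p k - t)" for k
      define Z where "Z x = (\<Sum>k<n. (W (\<theta> (Suc k)) x - W (\<theta> k) x)\<^sup>2) - (\<theta> n - \<theta> 0)" for x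
      have pin: "p k \<in> {0..T}" if "k \<le> n" for k using fine_partition_in[OF p that] s by auto
      have \<theta>: "\<theta> k \<le> \<theta> (Suc k)" "\<theta> (Suc k) - \<theta> k \<le> \<delta>" if "k < n" for k
        using p that by (auto simp: fine_partition_def \<theta>_def max_def)
      have \<theta>n: "\<theta> n - \<theta> 0 = max 0 (s - t)" "\<theta> 0 = 0" using p t by (auto simp: fine_partition_def \<theta>_def)
      have Z: "Z \<in> borel_measurable N" "integrable N (\<lambda>x. (Z x)\<^sup>2)" "expectation (\<lambda>x. (Z x)\<^sup>2) \<le> 2 * \<delta> * (\<theta> n - \<theta> 0)"
        unfolding Z_def using brownian_square_sum_moments[of \<theta> n \<delta>, OF _ \<theta>] \<theta>n(2) by simp_all
      have SX: "S n p (X x) - max 0 (s - t) *\<^sub>R outer v = Z x *\<^sub>R outer v" for x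
      proof -
        have "M (p k) (X x) = W (\<theta> k) x *\<^sub>R v" if "k \<le> n" for k
          unfolding M_def \<theta>_def using compensated_X[OF pin[OF that]] .
        then have "S n p (X x) = (\<Sum>k<n. (W (\<theta> (Suc k)) x - W (\<theta> k) x)\<^sup>2 *\<^sub>R outer v)"
          unfolding S_def by (intro sum.cong refl)
            (simp add: vec_eq_iff power2_eq_square algebra_simps)
        then show ?thesis using \<theta>n by (simp add: Z_def scaleR_left_diff_distrib scaleR_sum_left)
      qed
      let ?A = "{\<omega> \<in> space law. norm (S n p \<omega> - max 0 (s - t) *\<^sub>R outer v) > \<epsilon>}"
      have Mm: "M (p k) \<in> borel_measurable (Filt T 0 T)" if "k \<le> n" for k
        unfolding M_def using pin[OF that] by (intro borel_measurable_diff measurable_eval_Filt borel_measurable_const)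
      have "S n p \<in> borel_measurable (Filt T 0 T)"
        unfolding S_def
      proof (intro borel_measurable_sum)
        fix k assume "k \<in> {..<n}"
        then have "(\<lambda>\<omega>. M (p (Suc k)) \<omega> - M (p k) \<omega>) \<in> borel_measurable (Filt T 0 T)"
          using Mm by (intro borel_measurable_diff) auto
        from measurable_compose[OF this outer_measurable]
        show "(\<lambda>\<omega>. \<chi> i j. (M (p (Suc k)) \<omega> - M (p k) \<omega>) $ i * (M (p (Suc k)) \<omega> - M (p k) \<omega>) $ j) \<in> borel_measurable (Filt T 0 T)"
          unfolding outer_def .
      qed
      then have "{\<omega> \<in> space (Filt T 0 T). norm (S n p \<omega> - max 0 (s - t) *\<^sub>R outer v) > \<epsilon>} \<in> sets (Filt T 0 T)"
        by measurable
      then have A: "?A \<in> sets (Filt T 0 T)" by simp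
      have "measure law ?A = prob (X -` ?A \<inter> space N)"
        unfolding law_def using A X_measurable by (simp add: measure_distr law_def)
      also have "\<dots> = prob {x \<in> space N. \<bar>Z x\<bar> * c > \<epsilon>}"
        by (intro arg_cong[where f=prob]) (auto simp: SX c_def X_in_Omega)
      also have "\<dots> \<le> expectation (\<lambda>x. (c / \<epsilon>)\<^sup>2 * (Z x)\<^sup>2)"
      proof -
        let ?B = "{x \<in> space N. \<bar>Z x\<bar> * c > \<epsilon>}"
        have B: "?B \<in> events" using Z(1) by measurable
        have "indicator ?B x \<le> (c / \<epsilon>)\<^sup>2 * (Z x)\<^sup>2" for x
        proof (cases "x \<in> ?B")
          case True
          then have "1 \<le> \<bar>Z x\<bar> * c / \<epsilon>" using \<open>\<epsilon> > 0\<close> by simp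
          then have "1 \<le> (\<bar>Z x\<bar> * c / \<epsilon>)\<^sup>2" by (simp add: one_le_power)
          then show ?thesis using True by (simp add: power_mult_distrib power_divide mult.commute)
        qed simp
        then have "expectation (indicator ?B) \<le> expectation (\<lambda>x. (c / \<epsilon>)\<^sup>2 * (Z x)\<^sup>2)"
          using Z(2) B by (intro integral_mono) (auto simp: emeasure_eq_measure)
        then show ?thesis using B by simp
      qed
      also have "\<dots> = (c / \<epsilon>)\<^sup>2 * expectation (\<lambda>x. (Z x)\<^sup>2)" by simp
      also have "\<dots> \<le> (c / \<epsilon>)\<^sup>2 * (2 * \<delta> * T)"
      proof (rule mult_left_mono)
        have "2 * \<delta> * (\<theta> n - \<theta> 0) \<le> 2 * \<delta> * T" using \<theta>n s t T \<open>\<delta> > 0\<close> by (intro mult_left_mono) auto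
        then show "expectation (\<lambda>x. (Z x)\<^sup>2) \<le> 2 * \<delta> * T" using Z(3) by linarith
      qed simp
      also have "\<dots> = \<epsilon> * (2 * T * c\<^sup>2 / (2 * T * c\<^sup>2 + 1))"
        using \<open>\<epsilon> > 0\<close> by (simp add: \<delta>_def power_divide power2_eq_square power3_eq_cube field_simps)
      also have "\<dots> < \<epsilon> * 1"
        using \<open>\<epsilon> > 0\<close> pos by (intro mult_strict_left_mono) auto
      finally show ?thesis by simp
    qed
    ultimately show "\<exists>\<delta>>0. \<forall>n p. fine_partition 0 s \<delta> n p \<longrightarrow>
        measure law {\<omega> \<in> space law. \<epsilon> < norm (S n p \<omega> - max 0 (s - t) *\<^sub>R outer v)} < \<epsilon>" by blast
  qed simp
  then show "mesh_limit law 0 s (\<lambda>N p \<omega>. \<Sum>k<N. \<chi> i j.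
      (\<omega> (p (Suc k)) - (LINT r:{0..p (Suc k)}|lborel. \<alpha> r) - (\<omega> (p k) - (LINT r:{0..p k}|lborel. \<alpha> r))) $ i *
      (\<omega> (p (Suc k)) - (LINT r:{0..p (Suc k)}|lborel. \<alpha> r) - (\<omega> (p k) - (LINT r:{0..p k}|lborel. \<alpha> r))) $ j)
     (\<lambda>\<omega>. LINT r:{0..s}|lborel. if t \<le> r then outer v else 0)"
    unfolding S_def[abs_def] M_def integral_quadratic_rate[OF s] .
qed

text \<open>Here the integrability of the initial segment is needed: its bounded derivative \<alpha>
  is the drift, and the square root of v v^T, switched on at t, is the volatility. Membership gives
  access to the formula in the definition of path derivatives.\<close>

lemma law_in_Pinf: "law \<in> Pinf T 0"
proof -
  define \<beta> where "\<beta> r = (if t \<le> r then inverse (norm v) *\<^sub>R outer v else 0)" for r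
  obtain L0 where L0: "\<And>r. r \<in> {0..T} \<Longrightarrow> norm (\<alpha> r) \<le> L0" using \<alpha>_bounded by blast
  \<comment> \<open>The drift bound requires L \<ge> L0, the volatility bound requires the squared
    norm of the root to be at most 2 L, and the class requires L > 0.\<close>
  define L where "L = max 1 (max L0 ((norm (inverse (norm v) *\<^sub>R outer v))\<^sup>2))"
  have \<beta>\<beta>: "\<beta> r ** \<beta> r = (if t \<le> r then outer v else 0)" for r
    by (simp add: \<beta>_def scaled_outer_square)
  have \<beta>_Sym: "\<beta> r \<in> Sym" for r
    using outer_Sym[of _ v] outer_Sym[of 0 v] by (simp add: \<beta>_def)
  have \<beta>_psd: "psd (\<beta> r)" for r
    using outer_psd[of _ v] outer_psd[of 0 v] by (simp add: \<beta>_def)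
  have \<beta>_norm: "norm (\<beta> r) \<le> sqrt (2 * L)" for r
  proof -
    have "(norm (inverse (norm v) *\<^sub>R outer v))\<^sup>2 \<le> 2 * L" "0 \<le> L" unfolding L_def by linarith+
    then show ?thesis by (auto simp: \<beta>_def intro: real_le_rsqrt simp del: norm_scaleR)
  qed
  have "law \<in> PL T 0 L"
    unfolding PL_def
  proof (intro CollectI conjI exI[of _ "\<lambda>r \<omega>. \<alpha> r"] exI[of _ "\<lambda>r \<omega>. \<beta> r"])
    show "prob_space law" by (rule prob_space_law)
    show "progressive T 0 (\<lambda>r (\<omega> :: 'd path). \<alpha> r)" by (rule progressive_deterministic[OF \<alpha>_measurable])
    have "\<beta> \<in> borel_measurable borel" unfolding \<beta>_def by measurable
    then show "progressive T 0 (\<lambda>r (\<omega> :: 'd path). \<beta> r)" by (rule progressive_deterministic)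
    show "\<forall>(s, \<omega>)\<in>Lambda T 0. norm (\<alpha> s) \<le> L \<and> \<beta> s \<in> Sym \<and> psd (\<beta> s) \<and> norm (\<beta> s) \<le> sqrt (2 * L)"
      using L0 \<beta>_Sym \<beta>_psd \<beta>_norm by (force simp: Lambda_def L_def)
    show "let M = \<lambda>s \<omega>. \<omega> s - (LINT r:{0..s}|lborel. \<alpha> r) in
        (\<forall>i. is_martingale T 0 law (\<lambda>s \<omega>. M s \<omega> $ i)) \<and>
        quad_variation T 0 law M (\<lambda>s \<omega>. LINT r:{0..s}|lborel. \<beta> r ** \<beta> r)"
      using martingale_law quad_variation_law by (simp add: \<beta>\<beta>)
  qed simp
  moreover have "L > 0" by (simp add: L_def)
  ultimately show ?thesis unfolding Pinf_def by blast
qed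

end

section \<open>Ito formula\<close>

lemma C0_D:
  assumes "Y \<in> C0 T t"
  shows "progressive T t Y" "continuous_proc T t Y"
  using assms by (auto simp: C0_def)

lemma C0_measurable:
  assumes "Y \<in> C0 T 0" "s \<in> {0..T}"
  shows "Y s \<in> borel_measurable (Filt T 0 s)" "Y s \<in> borel_measurable (Filt T 0 T)"
  using progressive_measurable[OF C0_D(1)[OF assms(1)] assms(2)] Filt_measurable_mono assms(2) by auto

lemma path_derivs_at_law:
  assumes "path_derivs T 0 u a p q" "P \<in> Pinf T 0"
  obtains Q J K where "quad_variation T 0 P (\<lambda>s \<omega>. \<omega> s) Q" "stoch_integral T 0 P p (\<lambda>s \<omega>. \<omega> s) J"
    "stoch_integral T 0 P q Q K"
    "AE \<omega> in P. \<forall>s\<in>{0..T}. u s \<omega> - u 0 \<omega> = (LINT r:{0..s}|lborel. a r \<omega>) + J s \<omega> + 1/2 * K s \<omega>"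
proof -
  have "\<forall>P\<in>Pinf T 0. continuous_semimartingale T 0 P u \<and>
        (\<exists>Q J K. quad_variation T 0 P (\<lambda>s \<omega>. \<omega> s) Q \<and>
           stoch_integral T 0 P p (\<lambda>s \<omega>. \<omega> s) J \<and> stoch_integral T 0 P q Q K \<and>
           (AE \<omega> in P. \<forall>s\<in>{0..T}.
              u s \<omega> - u 0 \<omega> = (LINT r:{0..s}|lborel. a r \<omega>) + J s \<omega> + 1/2 * K s \<omega>))"
    using assms(1) unfolding path_derivs_def by blast
  with assms(2) that show thesis by blast
qed

lemma path_derivs_C0:
  assumes "path_derivs T t u a p q"
  shows "u \<in> C0 T t" "a \<in> C0 T t" "p \<in> C0 T t" "q \<in> C0 T t"
  using assms by (auto simp: path_derivs_def)

text \<open>The dt-coefficient of u along a process with drift b and covariance rate v v^T, that is,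
  the generator of that diffusion together with the time derivative.\<close>

definition generator_term :: "real ^ 'd \<Rightarrow> real ^ 'd \<Rightarrow> ('d::finite, real) process \<Rightarrow> ('d, real ^ 'd) process \<Rightarrow>
    ('d, real ^ 'd ^ 'd) process \<Rightarrow> ('d, real) process" where
  "generator_term b v a p q r \<omega> = a r \<omega> + p r \<omega> \<bullet> b + 1/2 * (q r \<omega> \<bullet> outer v)"

context driven_path
begin

lemma C0_X_measurable:
  assumes "Y \<in> C0 T 0" "s \<in> {0..T}"
  shows "(\<lambda>x. Y s (X x)) \<in> borel_measurable N"
  using measurable_compose[OF X_measurable C0_measurable(2)[OF assms]] .

lemma C0_X_past_measurable:
  assumes "Y \<in> C0 T 0" "s \<in> {t..T}"
  shows "(\<lambda>x. Y s (X x)) \<in> borel_measurable (past (s - t))"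
proof -
  have "X \<in> measurable (past (s - t)) (Filt T 0 s)"
    using X_past_measurable[of s] assms(2) t by auto
  then show ?thesis using C0_measurable(1)[OF assms(1), of s] assms(2) t by (auto dest: measurable_compose)
qed

lemma C0_X_continuous:
  assumes "Y \<in> C0 T 0" "x \<in> space N"
  shows "continuous_on {0..T} (\<lambda>r. Y r (X x))"
  using continuous_proc_continuous_on_time[OF C0_D(2)[OF assms(1)] X_in_Omega[OF assms(2)]] .

text \<open>Pathwise convergence of Riemann sums yields at once that the time integral is measurable
  in x and that it is their limit in probability; no joint measurability in time and x is
  invoked.\<close>

lemma time_integral_tendsto_prob:
  fixes f :: "real \<Rightarrow> 'w \<Rightarrow> real"
  assumes "\<forall>x\<in>space N. continuous_on {0..T} (\<lambda>r. f r x)" "\<forall>r\<in>{0..T}. f r \<in> borel_measurable N"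
    and "0 \<le> r" "r \<le> s" "s \<le> T"
  shows "(\<lambda>x. \<Sum>k<n. f (upart r s n k) x * ((s - r) / real n)) \<in> borel_measurable N"
    "\<And>x. x \<in> space N \<Longrightarrow> (\<lambda>n. \<Sum>k<n. f (upart r s n k) x * ((s - r) / real n)) \<longlonglongrightarrow> (LINT q:{r..s}|lborel. f q x)"
    "(\<lambda>x. LINT q:{r..s}|lborel. f q x) \<in> borel_measurable N"
    "tendsto_prob N (\<lambda>n x. \<Sum>k<n. f (upart r s n k) x * ((s - r) / real n)) (\<lambda>x. LINT q:{r..s}|lborel. f q x)"
proof -
  show m: "(\<lambda>x. \<Sum>k<n. f (upart r s n k) x * ((s - r) / real n)) \<in> borel_measurable N" for n
  proof (intro borel_measurable_sum borel_measurable_times borel_measurable_const assms(2)[rule_format])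
    fix k assume "k \<in> {..<n}"
    then show "upart r s n k \<in> {0..T}" using upart_in[of r s k n] assms(3-5) by auto
  qed
  show c: "(\<lambda>n. \<Sum>k<n. f (upart r s n k) x * ((s - r) / real n)) \<longlonglongrightarrow> (LINT q:{r..s}|lborel. f q x)"
    if "x \<in> space N" for x
    by (rule riemann_sums_tendsto[OF assms(4)], rule continuous_on_subset[OF assms(1)[rule_format, OF that]]) (use assms(3-5) in auto)
  show i: "(\<lambda>x. LINT q:{r..s}|lborel. f q x) \<in> borel_measurable N"
    by (rule borel_measurable_LIMSEQ_real[OF c m])
  show "tendsto_prob N (\<lambda>n x. \<Sum>k<n. f (upart r s n k) x * ((s - r) / real n)) (\<lambda>x. LINT q:{r..s}|lborel. f q x)"
    by (rule tendsto_prob_AE[OF AE_I2[OF c] m i])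
qed

lemma X_increment:
  assumes "r \<in> {t..T}" "s \<in> {t..T}"
  shows "X x s - X x r = (s - r) *\<^sub>R b + (W (s - t) x - W (r - t) x) *\<^sub>R v"
proof -
  have *: "X x s = l t + (s - t) *\<^sub>R b + W (s - t) x *\<^sub>R v" "X x r = l t + (r - t) *\<^sub>R b + W (r - t) x *\<^sub>R v"
    using assms t X_eq[of s x] X_eq[of r x] l_affine[of s] l_affine[of r] by (auto simp: max_def)
  show ?thesis unfolding * by (simp add: algebra_simps)
qed

text \<open>With step h, an increment h b + dW v has the square dW^2 v v^T + h^2 b b^T + h dW (b v^T
  + v b^T). The first part is the quadratic variation of W, the second sums to O(1/n), and the third
  telescopes because it is linear in dW with a constant factor.\<close>

lemma quadratic_sums_tendsto_prob:
  assumes rs: "t \<le> r" "r \<le> s" "s \<le> T"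
  shows "tendsto_prob N (\<lambda>n x. \<Sum>k<n. outer (X x (upart r s n (Suc k)) - X x (upart r s n k))) (\<lambda>x. (s - r) *\<^sub>R outer v)"
proof -
  define \<theta> where "\<theta> n k = upart r s n k - t" for n k
  define V where "V n x = (\<Sum>k<n. (W (\<theta> n (Suc k)) x - W (\<theta> n k) x)\<^sup>2)" for n x
  define A :: "real ^ 'd ^ 'd" where "A = (\<chi> i j. b $ i * v $ j + v $ i * b $ j)"
  define R where "R n x = ((s - r)\<^sup>2 / real n) *\<^sub>R outer b + ((s - r) / real n * (W (s - t) x - W (r - t) x)) *\<^sub>R A" for n :: nat and x
  have \<theta>: "0 \<le> \<theta> n k" "\<theta> n k \<le> \<theta> n (Suc k)" "\<theta> n (Suc k) - \<theta> n k \<le> (s - r) / real n" if "k \<le> n" for n k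
    using upart_in[of r s k n] upart_mono[of r s n k] upart_step[of r s n k] rs that by (auto simp: \<theta>_def)
  have \<theta>_ends: "\<theta> n 0 = r - t" "n > 0 \<Longrightarrow> \<theta> n n = s - t" for n by (auto simp: \<theta>_def)
  have eq: "(\<Sum>k<n. outer (X x (upart r s n (Suc k)) - X x (upart r s n k))) = V n x *\<^sub>R outer v + R n x" if n: "n > 0" for n x
  proof -
    define h where "h = (s - r) / real n"
    have "outer (X x (upart r s n (Suc k)) - X x (upart r s n k)) =
        (W (\<theta> n (Suc k)) x - W (\<theta> n k) x)\<^sup>2 *\<^sub>R outer v + (h\<^sup>2 *\<^sub>R outer b + (h * (W (\<theta> n (Suc k)) x - W (\<theta> n k) x)) *\<^sub>R A)"
      if "k < n" for k
    proof -
      have "upart r s n k \<in> {t..T}" "upart r s n (Suc k) \<in> {t..T}"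
        using upart_in[of r s k n] upart_in[of r s "Suc k" n] that rs by auto
      then have *: "X x (upart r s n (Suc k)) - X x (upart r s n k) = h *\<^sub>R b + (W (\<theta> n (Suc k)) x - W (\<theta> n k) x) *\<^sub>R v"
        by (simp add: X_increment upart_step h_def \<theta>_def)
      show ?thesis
        unfolding * by (simp add: vec_eq_iff A_def power2_eq_square algebra_simps)
    qed
    then have "(\<Sum>k<n. outer (X x (upart r s n (Suc k)) - X x (upart r s n k))) =
        V n x *\<^sub>R outer v + ((\<Sum>k<n. h\<^sup>2) *\<^sub>R outer b + (h * (\<Sum>k<n. W (\<theta> n (Suc k)) x - W (\<theta> n k) x)) *\<^sub>R A)"
      by (simp add: sum.distrib V_def scaleR_sum_left sum_distrib_left del: sum_constant)
    moreover have "(\<Sum>k<n. W (\<theta> n (Suc k)) x - W (\<theta> n k) x) = W (s - t) x - W (r - t) x"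
      using sum_lessThan_telescope[of "\<lambda>k. W (\<theta> n k) x" n] \<theta>_ends n by simp
    moreover have "(\<Sum>k<n. h\<^sup>2) = (s - r)\<^sup>2 / real n" using n by (simp add: h_def power2_eq_square)
    ultimately show ?thesis by (simp add: R_def h_def)
  qed
  have VN: "V n \<in> borel_measurable N" for n
    unfolding V_def
  proof (intro borel_measurable_sum borel_measurable_power borel_measurable_diff W_measurable)
    fix k assume "k \<in> {..<n}"
    then show "0 \<le> \<theta> n (Suc k)" "0 \<le> \<theta> n k" using \<theta>[of k n] by auto
  qed
  have "tendsto_prob N V (\<lambda>x. s - r)"
  proof (rule tendsto_prob_L2)
    have Z: "integrable N (\<lambda>x. (V n x - (\<theta> n n - \<theta> n 0))\<^sup>2)"
      "expectation (\<lambda>x. (V n x - (\<theta> n n - \<theta> n 0))\<^sup>2) \<le> 2 * ((s - r) / real n) * (\<theta> n n - \<theta> n 0)" for n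
      unfolding V_def using brownian_square_sum_moments(2,3)[of "\<theta> n" n "(s - r) / real n"] \<theta>[of _ n] by simp_all
    \<comment> \<open>The index is shifted by one since for n = 0 the degenerate partition ends at r
      and not at s.\<close>
    have "(\<lambda>n. 2 * ((s - r) / real (Suc n)) * (s - r)) \<longlonglongrightarrow> 0" by real_asymp
    then have "(\<lambda>n. expectation (\<lambda>x. (V (Suc n) x - (s - r))\<^sup>2)) \<longlonglongrightarrow> 0"
    proof (rule tendsto_0_squeeze[rotated -1])
      fix n
      show "expectation (\<lambda>x. (V (Suc n) x - (s - r))\<^sup>2) \<le> 2 * ((s - r) / real (Suc n)) * (s - r)"
        using Z(2)[of "Suc n"] \<theta>_ends by simp
    qed simp
    then show "(\<lambda>n. expectation (\<lambda>x. (V n x - (s - r))\<^sup>2)) \<longlonglongrightarrow> 0"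
      by (simp add: filterlim_sequentially_Suc[of "\<lambda>n. expectation (\<lambda>x. (V n x - (s - r))\<^sup>2)"])
    fix n show "integrable N (\<lambda>x. (V n x - (s - r))\<^sup>2)"
      using Z(1)[of n] \<theta>_ends by (cases "n = 0") (auto simp: V_def)
  qed (use VN in auto)
  then have T1: "tendsto_prob N (\<lambda>n x. V n x *\<^sub>R outer v) (\<lambda>x. (s - r) *\<^sub>R outer v)"
    by (rule tendsto_prob_linear[where f="\<lambda>y. y *\<^sub>R outer v"]) (use VN in \<open>auto intro: bounded_linear_scaleR_left\<close>)
  have Wm: "W (s - t) \<in> borel_measurable N" "W (r - t) \<in> borel_measurable N" using rs by (auto intro: W_measurable)
  have Rm: "R n \<in> borel_measurable N" for n
    unfolding R_def using Wm by (intro borel_measurable_add borel_measurable_scaleR borel_measurable_times borel_measurable_diff borel_measurable_const)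
  have T2: "tendsto_prob N R (\<lambda>x. 0)"
  proof (rule tendsto_prob_AE[OF AE_I2 Rm])
    fix x
    have "(\<lambda>n. (s - r)\<^sup>2 / real n) \<longlonglongrightarrow> 0" "(\<lambda>n. (s - r) / real n) \<longlonglongrightarrow> 0" by real_asymp+
    then have "(\<lambda>n. R n x) \<longlonglongrightarrow> 0 *\<^sub>R outer b + (0 * (W (s - t) x - W (r - t) x)) *\<^sub>R A"
      unfolding R_def by (intro tendsto_intros)
    then show "(\<lambda>n. R n x) \<longlonglongrightarrow> 0" by simp
  qed simp
  have VoN: "(\<lambda>x. V n x *\<^sub>R outer v) \<in> borel_measurable N" for n using VN by simp
  have T3: "tendsto_prob N (\<lambda>n x. V n x *\<^sub>R outer v + R n x) (\<lambda>x. (s - r) *\<^sub>R outer v)"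
    using tendsto_prob_add[OF T1 VoN _ T2 Rm] by simp
  have "\<forall>\<^sub>F n in sequentially. expectation (\<lambda>x. min 1 (norm ((\<Sum>k<n. outer (X x (upart r s n (Suc k)) - X x (upart r s n k))) - (s - r) *\<^sub>R outer v))) =
    expectation (\<lambda>x. min 1 (norm (V n x *\<^sub>R outer v + R n x - (s - r) *\<^sub>R outer v)))"
    by (rule eventually_sequentiallyI[of 1]) (simp add: eq)
  then show ?thesis using T3 unfolding tendsto_prob_def by (simp cong: tendsto_cong)
qed

text \<open>Only the increment over [t, s] is examined, because before t the path is the prescribed
  l. The integrator is general since it will be both the canonical process and its bracket.\<close>

lemma stoch_integral_X_increment:
  fixes Y Z :: "('d, 'b::euclidean_space) process"
  assumes J: "stoch_integral T 0 law Y Z J" and Y: "Y \<in> C0 T 0"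
    and Z: "\<And>s. s \<in> {0..T} \<Longrightarrow> Z s \<in> borel_measurable law" and s: "s \<in> {t..T}"
  shows "tendsto_prob N (\<lambda>n x. \<Sum>k<n. Y (upart t s n k) (X x) \<bullet> (Z (upart t s n (Suc k)) (X x) - Z (upart t s n k) (X x)))
      (\<lambda>x. J s (X x) - J t (X x))"
    and "(\<lambda>x. J s (X x) - J t (X x)) \<in> borel_measurable N"
proof -
  define F where "F q r \<omega> = Y q \<omega> \<bullet> (Z r \<omega> - Z q \<omega>)" for q r \<omega>
  have Fm: "F q r \<in> borel_measurable law" if "0 \<le> q" "q \<le> r" "r \<le> T" for q r
  proof -
    have "Y q \<in> borel_measurable law" using C0_measurable(2)[OF Y, of q] that by (simp add: law_measurable)
    then show ?thesis unfolding F_def using Z[of q] Z[of r] that by (intro borel_measurable_inner borel_measurable_diff) auto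
  qed
  have ml: "mesh_limit law 0 r (\<lambda>n p \<omega>. \<Sum>k<n. F (p k) (p (Suc k)) \<omega>) (J r)" if "r \<in> {0..T}" for r
    using J that unfolding stoch_integral_def F_def by blast
  have Jm: "J r \<in> borel_measurable law" if "r \<in> {0..T}" for r
    using ml[OF that] by (simp add: mesh_limit_def)
  have JJ: "(\<lambda>\<omega>. J s \<omega> - J t \<omega>) \<in> borel_measurable (Filt T 0 T)"
    unfolding law_measurable using s t by (intro borel_measurable_diff Jm) auto
  then show "(\<lambda>x. J s (X x) - J t (X x)) \<in> borel_measurable N"
    by (rule measurable_compose[OF X_measurable])
  have "tendsto_prob law (\<lambda>n \<omega>. \<Sum>k<n. F (upart t s n k) (upart t s n (Suc k)) \<omega>) (\<lambda>\<omega>. J s \<omega> - J t \<omega>)"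
    using s t by (intro mesh_limit_increment prob_space_law ml Fm) auto
  from tendsto_prob_distr[OF X_measurable _ JJ this[unfolded law_def]]
  have "tendsto_prob N (\<lambda>n x. \<Sum>k<n. F (upart t s n k) (upart t s n (Suc k)) (X x)) (\<lambda>x. J s (X x) - J t (X x))"
  proof this
    fix n
    show "(\<lambda>\<omega>. \<Sum>k<n. F (upart t s n k) (upart t s n (Suc k)) \<omega>) \<in> borel_measurable (Filt T 0 T)"
      unfolding law_measurable
    proof (intro borel_measurable_sum Fm)
      fix k assume "k \<in> {..<n}"
      then show "0 \<le> upart t s n k" "upart t s n k \<le> upart t s n (Suc k)" "upart t s n (Suc k) \<le> T"
        using upart_in[of t s k n] upart_in[of t s "Suc k" n] upart_mono[of t s n k] s t by auto
    qed
  qed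
  then show "tendsto_prob N (\<lambda>n x. \<Sum>k<n. Y (upart t s n k) (X x) \<bullet> (Z (upart t s n (Suc k)) (X x) - Z (upart t s n k) (X x)))
      (\<lambda>x. J s (X x) - J t (X x))"
    unfolding F_def .
qed

text \<open>The bracket Q is handed over by the definition of path derivatives and known only as a
  mesh limit. Uniqueness of limits in probability identifies its increments after t with the
  explicit ones.\<close>

lemma quad_variation_X_increment:
  assumes Q: "quad_variation T 0 law (\<lambda>s \<omega>. \<omega> s) Q" and rs: "t \<le> r" "r \<le> s" "s \<le> T"
  shows "AE x in N. Q s (X x) - Q r (X x) = (s - r) *\<^sub>R outer v"
proof -
  define F where "F q r \<omega> = outer (\<omega> r - \<omega> q)" for q r and \<omega> :: "'d path"
  have Fm: "F q r \<in> borel_measurable law" if "0 \<le> q" "q \<le> r" "r \<le> T" for q r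
    unfolding F_def law_measurable[symmetric] using that
    by (intro measurable_compose[OF _ outer_measurable] borel_measurable_diff measurable_eval_Filt) auto
  have ml: "mesh_limit law 0 r (\<lambda>n p \<omega>. \<Sum>k<n. F (p k) (p (Suc k)) \<omega>) (Q r)" if "r \<in> {0..T}" for r
    using Q that unfolding quad_variation_def F_def outer_def by blast
  have Qm: "Q r \<in> borel_measurable law" if "r \<in> {0..T}" for r
    using ml[OF that] by (simp add: mesh_limit_def)
  have QQ: "(\<lambda>\<omega>. Q s \<omega> - Q r \<omega>) \<in> borel_measurable (Filt T 0 T)"
    unfolding law_measurable using rs t by (intro borel_measurable_diff Qm) auto
  have Sm: "(\<lambda>\<omega>. \<Sum>k<n. F (upart r s n k) (upart r s n (Suc k)) \<omega>) \<in> borel_measurable (Filt T 0 T)" for n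
    unfolding law_measurable
  proof (intro borel_measurable_sum Fm)
    fix k assume "k \<in> {..<n}"
    then show "0 \<le> upart r s n k" "upart r s n k \<le> upart r s n (Suc k)" "upart r s n (Suc k) \<le> T"
      using upart_in[of r s k n] upart_in[of r s "Suc k" n] upart_mono[of r s n k] rs t by auto
  qed
  have "tendsto_prob law (\<lambda>n \<omega>. \<Sum>k<n. F (upart r s n k) (upart r s n (Suc k)) \<omega>) (\<lambda>\<omega>. Q s \<omega> - Q r \<omega>)"
    using rs t by (intro mesh_limit_increment prob_space_law ml Fm) auto
  from tendsto_prob_distr[OF X_measurable Sm QQ this[unfolded law_def]]
  have "tendsto_prob N (\<lambda>n x. \<Sum>k<n. F (upart r s n k) (upart r s n (Suc k)) (X x)) (\<lambda>x. Q s (X x) - Q r (X x))" .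
  moreover have "tendsto_prob N (\<lambda>n x. \<Sum>k<n. F (upart r s n k) (upart r s n (Suc k)) (X x)) (\<lambda>x. (s - r) *\<^sub>R outer v)"
    unfolding F_def by (rule quadratic_sums_tendsto_prob[OF rs])
  ultimately show ?thesis
    by (rule tendsto_prob_unique[OF _ _ measurable_compose[OF X_measurable Sm] measurable_compose[OF X_measurable QQ] borel_measurable_const])
qed

lemma generator_term_continuous:
  assumes "path_derivs T 0 u a p q" "x \<in> space N"
  shows "continuous_on {0..T} (\<lambda>r. generator_term b v a p q r (X x))"
  unfolding generator_term_def
  by (intro continuous_intros C0_X_continuous[OF _ assms(2)] path_derivs_C0[OF assms(1)])

lemma generator_term_measurable:
  assumes "path_derivs T 0 u a p q" "r \<in> {0..T}"
  shows "(\<lambda>x. generator_term b v a p q r (X x)) \<in> borel_measurable N"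
  unfolding generator_term_def
  by (intro borel_measurable_add borel_measurable_times borel_measurable_inner borel_measurable_const
      C0_X_measurable[OF _ assms(2)] path_derivs_C0[OF assms(1)])

text \<open>The martingale part of the left-endpoint sums for p dX after t: sums for the integral of
  p v against W, with the drift contribution of b split off.\<close>

definition ito_sum :: "('d, real ^ 'd) process \<Rightarrow> real \<Rightarrow> nat \<Rightarrow> 'w \<Rightarrow> real" where
  "ito_sum p s n x = (\<Sum>k<n. (p (upart t s n k) (X x) \<bullet> v) * (W (upart t s n (Suc k) - t) x - W (upart t s n k - t) x))"

lemma ito_sum_measurable:
  assumes "p \<in> C0 T 0" "s \<in> {t..T}"
  shows "ito_sum p s n \<in> borel_measurable N"
  unfolding ito_sum_def
proof (intro borel_measurable_sum borel_measurable_times borel_measurable_inner borel_measurable_diff borel_measurable_const W_measurable C0_X_measurable assms(1))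
  fix k assume k: "k \<in> {..<n}"
  show "0 \<le> upart t s n (Suc k) - t" "0 \<le> upart t s n k - t" "upart t s n k \<in> {0..T}"
    using upart_in[of t s k n] upart_in[of t s "Suc k" n] k assms(2) t by auto
qed

text \<open>The integral against Q and the drift part of the integral against X become time
  integrals and merge with that of a. What remains is known only as a limit of
  \<open>ito_sum\<close>; this determines it up to null sets and gives access to its mean.\<close>

lemma ito_formula:
  assumes D: "path_derivs T 0 u a p q" and s: "s \<in> {t..T}"
  obtains I where "I \<in> borel_measurable N"
    "tendsto_prob N (ito_sum p s) I"
    "AE x in N. u s (X x) - u t (X x) = (LINT r:{t..s}|lborel. generator_term b v a p q r (X x)) + I x"
proof -
  note C = path_derivs_C0[OF D]
  obtain Q J K where Q: "quad_variation T 0 law (\<lambda>s \<omega>. \<omega> s) Q"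
    and J: "stoch_integral T 0 law p (\<lambda>s \<omega>. \<omega> s) J" and K: "stoch_integral T 0 law q Q K"
    and E: "AE \<omega> in law. \<forall>s\<in>{0..T}. u s \<omega> - u 0 \<omega> = (LINT r:{0..s}|lborel. a r \<omega>) + J s \<omega> + 1/2 * K s \<omega>"
    using path_derivs_at_law[OF D law_in_Pinf] by blast
  have ts: "0 \<le> t" "t \<le> s" "s \<le> T" using s t by auto
  have uin: "upart t s n k \<in> {t..s}" if "k \<le> n" for n k using upart_in[OF ts(2) that] .
  define fp where "fp r x = p r (X x) \<bullet> b" for r x
  define fq where "fq r x = q r (X x) \<bullet> outer v" for r x
  have fp: "\<forall>x\<in>space N. continuous_on {0..T} (\<lambda>r. fp r x)" "\<forall>r\<in>{0..T}. fp r \<in> borel_measurable N"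
    unfolding fp_def using C0_X_continuous[OF C(3)] C0_X_measurable[OF C(3)] by (auto intro!: continuous_intros)
  have fq: "\<forall>x\<in>space N. continuous_on {0..T} (\<lambda>r. fq r x)" "\<forall>r\<in>{0..T}. fq r \<in> borel_measurable N"
    unfolding fq_def using C0_X_continuous[OF C(4)] C0_X_measurable[OF C(4)] by (auto intro!: continuous_intros)
  note fpi = time_integral_tendsto_prob[OF fp ts]
  note fqi = time_integral_tendsto_prob[OF fq ts]
  have Qm: "Q r \<in> borel_measurable law" if "r \<in> {0..T}" for r
    using Q that by (auto simp: quad_variation_def mesh_limit_def)
  have em: "(\<lambda>\<omega>. \<omega> r) \<in> borel_measurable law" if "r \<in> {0..T}" for r
    unfolding law_measurable[symmetric] using measurable_eval_Filt[OF that] .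
  have AEK: "AE x in N. K s (X x) - K t (X x) = (LINT r:{t..s}|lborel. fq r x)"
  proof -
    let ?S = "\<lambda>n x. \<Sum>k<n. q (upart t s n k) (X x) \<bullet> (Q (upart t s n (Suc k)) (X x) - Q (upart t s n k) (X x))"
    have T1: "tendsto_prob N ?S (\<lambda>x. K s (X x) - K t (X x))"
      and Km: "(\<lambda>x. K s (X x) - K t (X x)) \<in> borel_measurable N"
      using stoch_integral_X_increment[OF K C(4) Qm s] by auto
    have Sm: "?S n \<in> borel_measurable N" for n
    proof (intro borel_measurable_sum borel_measurable_inner borel_measurable_diff)
      fix k assume k: "k \<in> {..<n}"
      show "(\<lambda>x. q (upart t s n k) (X x)) \<in> borel_measurable N"
        using uin[of k n] k ts by (intro C0_X_measurable[OF C(4)]) auto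
      show "(\<lambda>x. Q (upart t s n k) (X x)) \<in> borel_measurable N" "(\<lambda>x. Q (upart t s n (Suc k)) (X x)) \<in> borel_measurable N"
        using uin[of k n] uin[of "Suc k" n] k ts
        by (auto intro!: measurable_compose[OF X_measurable] simp: law_measurable Qm)
    qed
    \<comment> \<open>There are countably many cells over all uniform partitions, so one null set
      serves all of them. Outside it the sums against Q are Riemann sums with weights (s - t) /
      n.\<close>
    have "AE x in N. \<forall>n. \<forall>k\<in>{..<n}. Q (upart t s n (Suc k)) (X x) - Q (upart t s n k) (X x) = ((s - t) / real n) *\<^sub>R outer v"
      unfolding AE_all_countable
    proof (intro allI AE_finite_allI finite_lessThan)
      fix n k :: nat assume k: "k \<in> {..<n}"
      show "AE x in N. Q (upart t s n (Suc k)) (X x) - Q (upart t s n k) (X x) = ((s - t) / real n) *\<^sub>R outer v"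
        unfolding upart_step[of t s n k, symmetric]
        using uin[of k n] uin[of "Suc k" n] k ts upart_mono[of t s n k] by (intro quad_variation_X_increment[OF Q]) auto
    qed
    then have "AE x in N. (\<lambda>n. ?S n x) \<longlonglongrightarrow> (LINT r:{t..s}|lborel. fq r x)"
    proof (rule AE_mp, intro AE_I2 impI)
      fix x assume x: "x \<in> space N"
        and "\<forall>n. \<forall>k\<in>{..<n}. Q (upart t s n (Suc k)) (X x) - Q (upart t s n k) (X x) = ((s - t) / real n) *\<^sub>R outer v"
      then have "?S n x = (\<Sum>k<n. fq (upart t s n k) x * ((s - t) / real n))" for n
        by (intro sum.cong) (auto simp: fq_def)
      then show "(\<lambda>n. ?S n x) \<longlonglongrightarrow> (LINT r:{t..s}|lborel. fq r x)" using fqi(2)[OF x] by simp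
    qed
    then have "tendsto_prob N ?S (\<lambda>x. LINT r:{t..s}|lborel. fq r x)"
      by (rule tendsto_prob_AE[OF _ Sm fqi(3)])
    with T1 show ?thesis by (rule tendsto_prob_unique[OF _ _ Sm Km fqi(3)])
  qed
  let ?SJ = "\<lambda>n x. \<Sum>k<n. p (upart t s n k) (X x) \<bullet> (X x (upart t s n (Suc k)) - X x (upart t s n k))"
  let ?SW = "ito_sum p s"
  let ?R = "\<lambda>n x. \<Sum>k<n. fp (upart t s n k) x * ((s - t) / real n)"
  \<comment> \<open>The increment of X is (step length) b + dW v on each cell, hence subtracting the
    drift integral from J leaves the limit of the Brownian sums.\<close>
  define I where "I x = J s (X x) - J t (X x) - (LINT r:{t..s}|lborel. fp r x)" for x
  have TJ: "tendsto_prob N ?SJ (\<lambda>x. J s (X x) - J t (X x))"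
    and Jm: "(\<lambda>x. J s (X x) - J t (X x)) \<in> borel_measurable N"
    using stoch_integral_X_increment[OF J C(3) em s] by auto
  have SW: "?SW n \<in> borel_measurable N" for n by (rule ito_sum_measurable[OF C(3) s])
  have SJ: "?SJ n x = ?SW n x + ?R n x" for n x
  proof -
    have "p (upart t s n k) (X x) \<bullet> (X x (upart t s n (Suc k)) - X x (upart t s n k)) =
      (p (upart t s n k) (X x) \<bullet> v) * (W (upart t s n (Suc k) - t) x - W (upart t s n k - t) x) + fp (upart t s n k) x * ((s - t) / real n)"
      if "k < n" for k
    proof -
      have "upart t s n k \<in> {t..T}" "upart t s n (Suc k) \<in> {t..T}"
        using uin[of k n] uin[of "Suc k" n] that ts by auto
      then show ?thesis by (simp add: X_increment upart_step inner_add_right fp_def)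
    qed
    then show ?thesis by (simp add: sum.distrib ito_sum_def)
  qed
  have SJm: "?SJ n \<in> borel_measurable N" for n unfolding SJ using SW fpi(1) by (intro borel_measurable_add)
  have "tendsto_prob N (\<lambda>n x. ?SJ n x - ?R n x) I"
    unfolding I_def by (rule tendsto_prob_diff[OF TJ SJm Jm fpi(4,1,3)])
  then have TW: "tendsto_prob N ?SW I" unfolding SJ by simp
  have Im: "I \<in> borel_measurable N" unfolding I_def by (rule borel_measurable_diff[OF Jm fpi(3)])
  have "AE x in N. \<forall>s\<in>{0..T}. u s (X x) - u 0 (X x) = (LINT r:{0..s}|lborel. a r (X x)) + J s (X x) + 1/2 * K s (X x)"
    using AE_distrD[OF X_measurable E[unfolded law_def]] .
  with AEK AE_space have "AE x in N. u s (X x) - u t (X x) = (LINT r:{t..s}|lborel. generator_term b v a p q r (X x)) + I x"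
  proof eventually_elim
    case (elim x)
    note ca = C0_X_continuous[OF C(2) elim(2)]
    have int: "f integrable_on {t..s}" if "continuous_on {0..T} f" for f :: "real \<Rightarrow> real"
      using ts by (intro integrable_continuous_interval continuous_on_subset[OF that]) auto
    have LI: "(LINT r:{t..s}|lborel. f r) = integral {t..s} f" if "continuous_on {0..T} f" for f :: "real \<Rightarrow> real"
      using ts by (intro set_lborel_integral_eq_integral continuous_on_subset[OF that]) auto
    have LI0: "(LINT r:{0..q}|lborel. a r (X x)) = integral {0..q} (\<lambda>r. a r (X x))" if "q \<in> {0..T}" for q
      using that by (intro set_lborel_integral_eq_integral continuous_on_subset[OF ca]) auto
    have "integral {0..t} (\<lambda>r. a r (X x)) + integral {t..s} (\<lambda>r. a r (X x)) = integral {0..s} (\<lambda>r. a r (X x))"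
      using ts by (intro Henstock_Kurzweil_Integration.integral_combine integrable_continuous_interval continuous_on_subset[OF ca]) auto
    then have 1: "(LINT r:{0..s}|lborel. a r (X x)) - (LINT r:{0..t}|lborel. a r (X x)) = integral {t..s} (\<lambda>r. a r (X x))"
      using LI0[of s] LI0[of t] ts by simp
    have "((\<lambda>r. a r (X x) + fp r x + 1/2 * fq r x) has_integral
        integral {t..s} (\<lambda>r. a r (X x)) + integral {t..s} (\<lambda>r. fp r x) + 1/2 * integral {t..s} (\<lambda>r. fq r x)) {t..s}"
      by (intro has_integral_add has_integral_mult_right integrable_integral int ca
          bspec[OF fp(1) elim(2)] bspec[OF fq(1) elim(2)])
    then have 2: "(LINT r:{t..s}|lborel. generator_term b v a p q r (X x)) =
        integral {t..s} (\<lambda>r. a r (X x)) + integral {t..s} (\<lambda>r. fp r x) + 1/2 * integral {t..s} (\<lambda>r. fq r x)"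
      unfolding LI[OF generator_term_continuous[OF D elim(2)]]
      by (simp add: generator_term_def fp_def fq_def integral_unique)
    have 3: "(LINT r:{t..s}|lborel. fp r x) = integral {t..s} (\<lambda>r. fp r x)" "(LINT r:{t..s}|lborel. fq r x) = integral {t..s} (\<lambda>r. fq r x)"
      using LI bspec[OF fp(1) elim(2)] bspec[OF fq(1) elim(2)] by auto
    have "u s (X x) - u 0 (X x) = (LINT r:{0..s}|lborel. a r (X x)) + J s (X x) + 1/2 * K s (X x)"
      "u t (X x) - u 0 (X x) = (LINT r:{0..t}|lborel. a r (X x)) + J t (X x) + 1/2 * K t (X x)"
      using elim(3) ts by auto
    then show ?case using elim(1) 1 2 3 by (simp add: I_def)
  qed
  with Im TW that show thesis by blast
qed

end

section \<open>Dynkin formula and uniqueness of path derivatives\<close>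

lemma bounded_procD:
  assumes "bounded_proc T t Y"
  obtains C where "C \<ge> 0" "\<And>s \<omega>. s \<in> {t..T} \<Longrightarrow> \<omega> \<in> Omega T t \<Longrightarrow> norm (Y s \<omega>) \<le> C"
proof -
  obtain C where "\<forall>(s, \<omega>)\<in>Lambda T t. norm (Y s \<omega>) \<le> C" using assms unfolding bounded_proc_def by blast
  then have "norm (Y s \<omega>) \<le> max C 0" if "s \<in> {t..T}" "\<omega> \<in> Omega T t" for s \<omega>
    using that by (force simp: Lambda_def)
  then show thesis using that[of "max C 0"] by auto
qed

lemma inner_outer: "M \<bullet> outer v = (\<Sum>i\<in>UNIV. \<Sum>j\<in>UNIV. v $ i * v $ j * M $ i $ j)"
  by (simp add: inner_vec_def mult_ac)

lemma plus_divide_Suc_in: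
  fixes t T :: real
  assumes "t < T"
  shows "t + (T - t) / real (Suc n) \<in> {t<..T}"
proof -
  have "(T - t) / real (Suc n) \<le> (T - t) / 1" using assms by (intro divide_left_mono) auto
  then show ?thesis using assms by auto
qed

text \<open>The primitive of f vanishes along a sequence decreasing to t, so its derivative at t,
  which is f t, is 0.\<close>

lemma continuous_zero_integrals_imp_zero:
  fixes f :: "real \<Rightarrow> real"
  assumes "t < T" "continuous_on {t..T} f"
    and zero: "\<And>n. (LINT r:{t..t + (T - t) / real (Suc n)}|lborel. f r) = 0"
  shows "f t = 0"
proof -
  define s where "s n = t + (T - t) / real (Suc n)" for n
  have s: "s n \<in> {t..T}" "s n \<noteq> t" for n using plus_divide_Suc_in[OF assms(1), of n] by (auto simp: s_def)
  define F where "F x = integral {t..x} f" for x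
  have F0: "F (s n) = 0" for n
  proof -
    have "continuous_on {t..s n} f" using s[of n] by (intro continuous_on_subset[OF assms(2)]) auto
    from set_lborel_integral_eq_integral[OF this] zero[of n] show ?thesis by (simp add: F_def s_def)
  qed
  have "(F has_real_derivative f t) (at t within {t..T})"
    unfolding F_def using assms by (intro integral_has_real_derivative) auto
  then have "((\<lambda>y. (F y - F t) / (y - t)) \<longlongrightarrow> f t) (at t within {t..T})"
    by (simp add: has_field_derivative_iff)
  moreover have "filterlim s (at t within {t..T}) sequentially"
    unfolding filterlim_at
  proof (intro conjI)
    show "s \<longlonglongrightarrow> t" unfolding s_def by real_asymp
  qed (use s in auto)
  ultimately have "(\<lambda>n. (F (s n) - F t) / (s n - t)) \<longlonglongrightarrow> f t" by (rule filterlim_compose)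
  moreover have "F t = 0" by (simp add: F_def)
  ultimately show ?thesis by (simp add: F0 LIMSEQ_const_iff)
qed

context driven_path
begin

text \<open>The initial segment as an element of path space. It is frozen after t merely to be
  defined on [0, T]; processes in \<open>C0\<close> at time t cannot distinguish it from the random
  path.\<close>

definition base :: "'d path" where
  "base = (\<lambda>s\<in>{0..T}. l (min s t))"

lemma base_in_Omega: "base \<in> Omega T 0"
proof -
  have "continuous_on {0..T} (\<lambda>s. l (min s t))"
    by (rule continuous_on_compose2[OF l_continuous]) (use t in \<open>auto intro!: continuous_intros\<close>)
  then have "continuous_on {0..T} base" by (rule continuous_on_eq) (simp add: base_def)
  then show ?thesis using t T l_0 by (simp add: Omega_def base_def)
qed

lemma C0_at_t:
  assumes "Y \<in> C0 T 0" "x \<in> space N"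
  shows "Y t (X x) = Y t base"
  using t W_0[OF assms(2)]
  by (intro continuous_proc_nonanticipative[OF C0_D(2)[OF assms(1)] _ X_in_Omega[OF assms(2)] base_in_Omega])
     (auto simp: X_eq base_def)

text \<open>The Ito term has mean 0: the approximating sums have mean 0 and second moments bounded
  independently of n, so the mean survives the limit in probability.\<close>

lemma dynkin_formula:
  assumes D: "path_derivs T 0 u a p q"
    and u: "\<And>s \<omega>. s \<in> {0..T} \<Longrightarrow> \<omega> \<in> Omega T 0 \<Longrightarrow> norm (u s \<omega>) \<le> Cu"
    and p: "\<And>s \<omega>. s \<in> {0..T} \<Longrightarrow> \<omega> \<in> Omega T 0 \<Longrightarrow> norm (p s \<omega>) \<le> Cp"
    and g: "\<And>s \<omega>. s \<in> {0..T} \<Longrightarrow> \<omega> \<in> Omega T 0 \<Longrightarrow> norm (generator_term b v a p q s \<omega>) \<le> Cg"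
    and s: "s \<in> {t..T}"
  shows "expectation (\<lambda>x. u s (X x)) - u t base = expectation (\<lambda>x. LINT r:{t..s}|lborel. generator_term b v a p q r (X x))"
    and "\<And>x. x \<in> space N \<Longrightarrow> \<bar>LINT r:{t..s}|lborel. generator_term b v a p q r (X x)\<bar> \<le> Cg * (s - t)"
proof -
  note C = path_derivs_C0[OF D]
  have ts: "0 \<le> t" "t \<le> s" "s \<le> T" using s t by auto
  let ?G = "\<lambda>x. LINT r:{t..s}|lborel. generator_term b v a p q r (X x)"
  show Gb: "\<bar>?G x\<bar> \<le> Cg * (s - t)" if x: "x \<in> space N" for x
  proof -
    have c: "continuous_on {t..s} (\<lambda>r. generator_term b v a p q r (X x))"
      using ts by (intro continuous_on_subset[OF generator_term_continuous[OF D x]]) auto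
    have "norm (integral {t..s} (\<lambda>r. generator_term b v a p q r (X x))) \<le> Cg * (s - t)"
      using ts g X_in_Omega[OF x] by (intro integral_bound c) auto
    then show ?thesis by (simp add: set_lborel_integral_eq_integral[OF c])
  qed
  have Gm: "?G \<in> borel_measurable N"
    using ts by (intro time_integral_tendsto_prob(3)) (auto intro: generator_term_continuous[OF D] generator_term_measurable[OF D])
  have Gi: "integrable N ?G" using Gm Gb by (intro integrable_const_bound[where B="Cg * (s - t)"]) auto
  have um: "(\<lambda>x. u s (X x)) \<in> borel_measurable N" using ts by (intro C0_X_measurable[OF C(1)]) auto
  have ui: "integrable N (\<lambda>x. u s (X x))"
    using um u[of s] X_in_Omega ts by (intro integrable_const_bound[where B=Cu]) auto
  obtain I where I: "I \<in> borel_measurable N"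
    "tendsto_prob N (ito_sum p s) I"
    "AE x in N. u s (X x) - u t (X x) = ?G x + I x"
    using ito_formula[OF D s] by blast
  have uin: "upart t s n k \<in> {t..s}" if "k \<le> n" for n k using upart_in[OF ts(2) that] .
  have mom: "integrable N (ito_sum p s n)" "integrable N (\<lambda>x. (ito_sum p s n x)\<^sup>2)"
    "expectation (ito_sum p s n) = 0" "expectation (\<lambda>x. (ito_sum p s n x)\<^sup>2) \<le> (Cp * norm v)\<^sup>2 * (s - t)" for n
  proof -
    define Y where "Y k x = p (upart t s n k) (X x) \<bullet> v" for k x
    define \<theta> where "\<theta> k = upart t s n k - t" for k
    have \<theta>: "0 \<le> \<theta> 0" "\<And>k. k < n \<Longrightarrow> \<theta> k \<le> \<theta> (Suc k)" using upart_mono[of t s n] ts by (auto simp: \<theta>_def)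
    have Ym: "Y k \<in> borel_measurable (past (\<theta> k))" if "k < n" for k
      unfolding Y_def \<theta>_def using uin[of k n] that ts
      by (intro borel_measurable_inner borel_measurable_const C0_X_past_measurable[OF C(3)]) auto
    have Yb: "\<bar>Y k x\<bar> \<le> Cp * norm v" if "k < n" "x \<in> space N" for k x
    proof -
      have "\<bar>Y k x\<bar> \<le> norm (p (upart t s n k) (X x)) * norm v" unfolding Y_def by (rule Cauchy_Schwarz_ineq2)
      also have "\<dots> \<le> Cp * norm v"
        using uin[of k n] that ts X_in_Omega by (intro mult_right_mono p) auto
      finally show ?thesis .
    qed
    have \<theta>n: "\<theta> n - \<theta> 0 \<le> s - t" using ts by (cases "n = 0") (auto simp: \<theta>_def)
    note m = brownian_sum_moments[where \<theta>=\<theta> and n=n and Y=Y and C="Cp * norm v", OF \<theta> Ym Yb]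
    have eq: "ito_sum p s n = (\<lambda>x. \<Sum>k<n. Y k x * (W (\<theta> (Suc k)) x - W (\<theta> k) x))"
      by (simp add: ito_sum_def fun_eq_iff Y_def \<theta>_def)
    show "integrable N (ito_sum p s n)" "integrable N (\<lambda>x. (ito_sum p s n x)\<^sup>2)" "expectation (ito_sum p s n) = 0"
      unfolding eq using m(1-3) by auto
    have "expectation (\<lambda>x. (ito_sum p s n x)\<^sup>2) \<le> (Cp * norm v)\<^sup>2 * (\<theta> n - \<theta> 0)"
      unfolding eq using m(4) by auto
    also have "\<dots> \<le> (Cp * norm v)\<^sup>2 * (s - t)" using \<theta>n by (intro mult_left_mono) auto
    finally show "expectation (\<lambda>x. (ito_sum p s n x)\<^sup>2) \<le> (Cp * norm v)\<^sup>2 * (s - t)" .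
  qed
  \<comment> \<open>The Ito term inherits a bound from the formula itself, being a difference of
    bounded quantities.\<close>
  have "AE x in N. \<bar>I x\<bar> \<le> 2 * Cu + Cg * (s - t)"
    using I(3) AE_space
  proof eventually_elim
    case (elim x)
    have "\<bar>u s (X x)\<bar> \<le> Cu" "\<bar>u t (X x)\<bar> \<le> Cu" using u[of _ "X x"] X_in_Omega[OF elim(2)] ts by auto
    then show ?case using elim(1) Gb[OF elim(2)] by linarith
  qed
  from tendsto_prob_expectation_0[OF I(2) mom I(1) this]
  have EI: "expectation I = 0" .
  have Ii: "integrable N I"
    using I(1) \<open>AE x in N. \<bar>I x\<bar> \<le> 2 * Cu + Cg * (s - t)\<close> by (intro integrable_const_bound[where B="2 * Cu + Cg * (s - t)"]) auto
  have "expectation (\<lambda>x. u s (X x) - u t base) = expectation (\<lambda>x. ?G x + I x)"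
  proof (rule integral_cong_AE)
    show "AE x in N. u s (X x) - u t base = ?G x + I x"
      using I(3) AE_space by eventually_elim (use C0_at_t[OF C(1)] in auto)
  qed (use um Gm I(1) in auto)
  then show "expectation (\<lambda>x. u s (X x)) - u t base = expectation ?G"
    using ui Gi Ii EI by (simp add: prob_space)
qed

text \<open>Riemann sums take the place of exchanging expectation and time integral: they are
  dominated by Cg (s - t), and each node contributes an error of at most C (s - t) times the step.
  Using s - t at every node in place of r - t costs only a constant factor.\<close>

lemma dynkin_second_order:
  assumes D: "path_derivs T 0 u a p q"
    and u: "\<And>s \<omega>. s \<in> {0..T} \<Longrightarrow> \<omega> \<in> Omega T 0 \<Longrightarrow> norm (u s \<omega>) \<le> Cu"
    and p: "\<And>s \<omega>. s \<in> {0..T} \<Longrightarrow> \<omega> \<in> Omega T 0 \<Longrightarrow> norm (p s \<omega>) \<le> Cp"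
    and g: "\<And>s \<omega>. s \<in> {0..T} \<Longrightarrow> \<omega> \<in> Omega T 0 \<Longrightarrow> norm (generator_term b v a p q s \<omega>) \<le> Cg"
    and s: "s \<in> {t..T}"
    and rate: "\<And>r. r \<in> {t..s} \<Longrightarrow> \<bar>expectation (\<lambda>x. generator_term b v a p q r (X x)) - \<gamma>\<bar> \<le> C * (r - t)"
    and C: "0 \<le> C"
  shows "\<bar>expectation (\<lambda>x. u s (X x)) - u t base - (s - t) * \<gamma>\<bar> \<le> C * (s - t)\<^sup>2"
proof -
  have ts: "0 \<le> t" "t \<le> s" "s \<le> T" using s t by auto
  let ?g = "\<lambda>r x. generator_term b v a p q r (X x)"
  let ?R = "\<lambda>n x. \<Sum>k<n. ?g (upart t s n k) x * ((s - t) / real n)"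
  have uin: "upart t s n k \<in> {t..s}" if "k \<le> n" for n k using upart_in[OF ts(2) that] .
  have gi: "integrable N (?g r)" if "r \<in> {t..s}" for r
    using that ts g X_in_Omega generator_term_measurable[OF D]
    by (intro integrable_const_bound[where B=Cg]) auto
  note ti = time_integral_tendsto_prob[of ?g t s, OF _ _ ts]
  have ti: "?R n \<in> borel_measurable N" "x \<in> space N \<Longrightarrow> (\<lambda>n. ?R n x) \<longlonglongrightarrow> (LINT r:{t..s}|lborel. ?g r x)"
    "(\<lambda>x. LINT r:{t..s}|lborel. ?g r x) \<in> borel_measurable N" for n x
    using ti(1-3) generator_term_continuous[OF D] generator_term_measurable[OF D] by auto
  have hb: "0 \<le> (s - t) / real n" for n using ts by simp
  have lim: "(\<lambda>n. expectation (?R n)) \<longlonglongrightarrow> expectation (\<lambda>x. LINT r:{t..s}|lborel. ?g r x)"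
  proof (rule integral_dominated_convergence[where w="\<lambda>_. Cg * (s - t)"])
    fix n
    show "AE x in N. norm (?R n x) \<le> Cg * (s - t)"
    proof (intro AE_I2)
      fix x assume x: "x \<in> space N"
      have "norm (?R n x) \<le> (\<Sum>k<n. Cg * ((s - t) / real n))"
      proof (intro sum_norm_le)
        fix k assume "k \<in> {..<n}"
        then have "norm (?g (upart t s n k) x) \<le> Cg" using uin[of k n] ts X_in_Omega[OF x] by (intro g) auto
        then show "norm (?g (upart t s n k) x * ((s - t) / real n)) \<le> Cg * ((s - t) / real n)"
          unfolding real_norm_def abs_mult abs_of_nonneg[OF hb[of n]] using hb[of n] by (rule mult_right_mono)
      qed
      also have "\<dots> \<le> Cg * (s - t)"
      proof (cases "n = 0")
        case True
        have "0 \<le> Cg" using g[of 0 base] base_in_Omega T norm_ge_zero order_trans by (metis atLeastAtMost_iff less_imp_le order_refl)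
        then show ?thesis using True ts by simp
      qed simp
      finally show "norm (?R n x) \<le> Cg * (s - t)" .
    qed
  qed (use ti in auto)
  have est: "\<bar>expectation (?R n) - (s - t) * \<gamma>\<bar> \<le> C * (s - t)\<^sup>2" if "n \<ge> 1" for n
  proof -
    define h where "h = (s - t) / real n"
    have h: "0 \<le> h" "real n * h = s - t" using that ts by (auto simp: h_def)
    have "expectation (?R n) = (\<Sum>k<n. expectation (?g (upart t s n k)) * h)"
    proof -
      have "integrable N (\<lambda>x. ?g (upart t s n k) x * h)" if "k < n" for k
        using gi[OF uin[of k n]] that by (intro integrable_mult_left) auto
      then show ?thesis unfolding h_def[symmetric] by (subst Bochner_Integration.integral_sum) auto
    qed
    moreover have "(s - t) * \<gamma> = (\<Sum>k<n. \<gamma> * h)" using h(2) by (simp add: mult.commute mult.left_commute)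
    ultimately have "\<bar>expectation (?R n) - (s - t) * \<gamma>\<bar> = \<bar>\<Sum>k<n. (expectation (?g (upart t s n k)) - \<gamma>) * h\<bar>"
      by (simp add: sum_subtractf left_diff_distrib)
    also have "\<dots> \<le> (\<Sum>k<n. C * (s - t) * h)"
    proof (rule order_trans[OF sum_abs], rule sum_mono)
      fix k assume k: "k \<in> {..<n}"
      have "\<bar>expectation (?g (upart t s n k)) - \<gamma>\<bar> \<le> C * (upart t s n k - t)" using uin[of k n] k by (intro rate) auto
      also have "\<dots> \<le> C * (s - t)" using uin[of k n] k C by (intro mult_left_mono) auto
      finally show "\<bar>(expectation (?g (upart t s n k)) - \<gamma>) * h\<bar> \<le> C * (s - t) * h"
        using h(1) by (simp add: abs_mult mult_right_mono)
    qed
    also have "\<dots> = C * (s - t)\<^sup>2" using h(2) by (simp add: power2_eq_square mult.commute mult.left_commute)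
    finally show ?thesis .
  qed
  have "(\<lambda>n. \<bar>expectation (?R n) - (s - t) * \<gamma>\<bar>) \<longlonglongrightarrow> \<bar>expectation (\<lambda>x. LINT r:{t..s}|lborel. ?g r x) - (s - t) * \<gamma>\<bar>"
    by (intro tendsto_intros lim)
  then have "\<bar>expectation (\<lambda>x. LINT r:{t..s}|lborel. ?g r x) - (s - t) * \<gamma>\<bar> \<le> C * (s - t)\<^sup>2"
    by (rule LIMSEQ_le_const2) (use est in blast)
  then show ?thesis using dynkin_formula(1)[OF D u p g s] by simp
qed

text \<open>Two Ito formulas for the same u are subtracted. If v = 0 or p = p', the Brownian sums
  coincide, hence so do the time integrals over all short intervals after t, and thus the continuous
  integrands at t.\<close>

lemma path_derivs_generator_term_unique:
  assumes D: "path_derivs T 0 u a p q" and D': "path_derivs T 0 u a' p' q'" and tT: "t < T"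
    and p: "v = 0 \<or> (\<forall>r\<in>{0..<T}. \<forall>\<omega>\<in>Omega T 0. p r \<omega> = p' r \<omega>)"
  shows "generator_term b v a p q t base = generator_term b v a' p' q' t base"
proof -
  let ?g = "generator_term b v a p q" and ?g' = "generator_term b v a' p' q'"
  have AEs: "AE x in N. (LINT r:{t..s}|lborel. ?g r (X x)) = (LINT r:{t..s}|lborel. ?g' r (X x))" if s: "s \<in> {t<..T}" for s
  proof -
    have s': "s \<in> {t..T}" using s by auto
    obtain I where I: "I \<in> borel_measurable N"
      "tendsto_prob N (ito_sum p s) I"
      "AE x in N. u s (X x) - u t (X x) = (LINT r:{t..s}|lborel. ?g r (X x)) + I x"
      using ito_formula[OF D s'] by blast
    obtain I' where I': "I' \<in> borel_measurable N"
      "tendsto_prob N (ito_sum p' s) I'"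
      "AE x in N. u s (X x) - u t (X x) = (LINT r:{t..s}|lborel. ?g' r (X x)) + I' x"
      using ito_formula[OF D' s'] by blast
    have "ito_sum p s n x = ito_sum p' s n x" if x: "x \<in> space N" for n x
      unfolding ito_sum_def
    proof (intro sum.cong refl)
      fix k assume "k \<in> {..<n}"
      \<comment> \<open>Left endpoints stay strictly below s \<le> T, so agreement of p and p'
        before T is enough.\<close>
      then have "p (upart t s n k) (X x) \<bullet> v = p' (upart t s n k) (X x) \<bullet> v"
        using p upart_less[of t s k n] upart_in[of t s k n] x s t X_in_Omega[of x] by auto
      then show "(p (upart t s n k) (X x) \<bullet> v) * (W (upart t s n (Suc k) - t) x - W (upart t s n k - t) x) =
        (p' (upart t s n k) (X x) \<bullet> v) * (W (upart t s n (Suc k) - t) x - W (upart t s n k - t) x)" by simp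
    qed
    then have "expectation (\<lambda>x. min 1 (norm (ito_sum p s n x - I' x))) = expectation (\<lambda>x. min 1 (norm (ito_sum p' s n x - I' x)))" for n
      by (intro Bochner_Integration.integral_cong refl) simp
    with I'(2) have T': "tendsto_prob N (ito_sum p s) I'" by (simp add: tendsto_prob_def)
    have m: "ito_sum p s n \<in> borel_measurable N" for n by (rule ito_sum_measurable[OF path_derivs_C0(3)[OF D] s'])
    have "AE x in N. I x = I' x" by (rule tendsto_prob_unique[OF I(2) T' m I(1) I'(1)])
    with I(3) I'(3) show ?thesis by eventually_elim simp
  qed
  \<comment> \<open>Countably many end points shrinking to t keep the exceptional set null and
    suffice for a derivative at t.\<close>
  have "AE x in N. \<forall>n. (LINT r:{t..t + (T - t) / real (Suc n)}|lborel. ?g r (X x)) = (LINT r:{t..t + (T - t) / real (Suc n)}|lborel. ?g' r (X x))"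
    unfolding AE_all_countable
  proof
    fix n show "AE x in N. (LINT r:{t..t + (T - t) / real (Suc n)}|lborel. ?g r (X x)) = (LINT r:{t..t + (T - t) / real (Suc n)}|lborel. ?g' r (X x))"
      by (intro AEs plus_divide_Suc_in tT)
  qed
  then have "AE x in N. ?g t base = ?g' t base"
    using AE_space
  proof eventually_elim
    case (elim x)
    have c: "continuous_on {0..T} (\<lambda>r. ?g r (X x))" "continuous_on {0..T} (\<lambda>r. ?g' r (X x))"
      using generator_term_continuous[OF D elim(2)] generator_term_continuous[OF D' elim(2)] by auto
    have ct: "continuous_on {t..T} (\<lambda>r. ?g r (X x) - ?g' r (X x))"
      using t by (intro continuous_on_subset[OF continuous_on_diff[OF c]]) auto
    have "?g t (X x) - ?g' t (X x) = 0"
    proof (rule continuous_zero_integrals_imp_zero[OF tT ct])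
      fix n
      have sub: "{t..t + (T - t) / real (Suc n)} \<subseteq> {0..T}"
        using t plus_divide_Suc_in[OF tT, of n] by auto
      have "set_integrable lborel {t..t + (T - t) / real (Suc n)} (\<lambda>r. ?g r (X x))"
        "set_integrable lborel {t..t + (T - t) / real (Suc n)} (\<lambda>r. ?g' r (X x))"
        by (intro borel_integrable_atLeastAtMost' continuous_on_subset[OF c(1) sub] continuous_on_subset[OF c(2) sub])+
      then show "(LINT r:{t..t + (T - t) / real (Suc n)}|lborel. ?g r (X x) - ?g' r (X x)) = 0"
        using elim(1) by (simp add: set_integral_diff(2))
    qed
    then show ?case
      using C0_at_t[OF path_derivs_C0(2)[OF D] elim(2)] C0_at_t[OF path_derivs_C0(3)[OF D] elim(2)] C0_at_t[OF path_derivs_C0(4)[OF D] elim(2)]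
        C0_at_t[OF path_derivs_C0(2)[OF D'] elim(2)] C0_at_t[OF path_derivs_C0(3)[OF D'] elim(2)] C0_at_t[OF path_derivs_C0(4)[OF D'] elim(2)]
      by (simp add: generator_term_def)
  qed
  then show ?thesis by simp
qed

end

section \<open>Rates along concatenated paths\<close>

lemma polynomial_approximation:
  fixes \<omega> :: "real \<Rightarrow> real ^ 'd::finite"
  assumes "continuous_on {0..t} \<omega>" "\<omega> 0 = 0" "0 \<le> t" "e > 0"
  obtains g g' where "g 0 = 0" "\<And>s. s \<in> {0..t} \<Longrightarrow> norm (\<omega> s - g s) \<le> e"
    "\<And>s. (g has_vector_derivative g' s) (at s)" "continuous_on UNIV g'"
proof -
  \<comment> \<open>Half of the tolerance is reserved for subtracting the value at 0, which makes
    the polynomial start at 0.\<close>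
  have "e / 2 > 0" using assms(4) by simp
  from Stone_Weierstrass_polynomial_function[OF compact_Icc assms(1) this]
  obtain h where h: "polynomial_function h" "\<And>s. s \<in> {0..t} \<Longrightarrow> norm (\<omega> s - h s) < e / 2" by blast
  obtain h' where h': "polynomial_function h'" "\<And>s. (h has_vector_derivative h' s) (at s)"
    using has_vector_derivative_polynomial_function[OF h(1)] by blast
  show thesis
  proof (rule that[of "\<lambda>s. h s - h 0" h'])
    fix s assume s: "s \<in> {0..t}"
    have "norm (\<omega> s - (h s - h 0)) = norm ((\<omega> s - h s) - (\<omega> 0 - h 0))" by (simp add: assms(2) algebra_simps)
    also have "\<dots> \<le> norm (\<omega> s - h s) + norm (\<omega> 0 - h 0)" by (rule norm_triangle_ineq4)
    also have "\<dots> \<le> e" using h(2)[OF s] h(2)[of 0] assms(3) by simp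
    finally show "norm (\<omega> s - (h s - h 0)) \<le> e" .
  next
    fix s show "((\<lambda>s. h s - h 0) has_vector_derivative h' s) (at s)"
      using has_vector_derivative_diff[OF h'(2) has_vector_derivative_const] by simp
  next
    show "continuous_on UNIV h'"
      using continuous_polymonial_function[OF h'(1)] by (simp add: continuous_on_eq_continuous_at)
  qed simp
qed

section \<open>Arbitrary initial segments followed by a drifted Brownian motion\<close>

context brownian
begin

definition increment_path :: "real \<Rightarrow> real \<Rightarrow> real ^ 'd::finite \<Rightarrow> real ^ 'd \<Rightarrow> 'w \<Rightarrow> 'd path" where
  "increment_path T t b v x = (\<lambda>s\<in>{t..T}. (s - t) *\<^sub>R b + W (s - t) x *\<^sub>R v)"

definition shifted_path :: "real \<Rightarrow> real \<Rightarrow> 'd::finite path \<Rightarrow> real ^ 'd \<Rightarrow> real ^ 'd \<Rightarrow> 'w \<Rightarrow> 'd path" where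
  "shifted_path T t \<omega> b v x = concat_path T 0 t \<omega> (increment_path T t b v x)"

lemma increment_path_in_Omega:
  assumes "x \<in> space N" "t \<le> T"
  shows "increment_path T t b v x \<in> Omega T t"
proof -
  have "continuous_on {t..T} (\<lambda>s. W (s - t) x)"
    by (rule continuous_on_compose2[OF W_continuous[OF assms(1)]]) (auto intro!: continuous_intros)
  then have "continuous_on {t..T} (\<lambda>s. (s - t) *\<^sub>R b + W (s - t) x *\<^sub>R v)" by (intro continuous_intros)
  then have "continuous_on {t..T} (increment_path T t b v x)"
    by (rule continuous_on_eq) (simp add: increment_path_def)
  then show ?thesis using assms W_0 by (simp add: Omega_def increment_path_def)
qed

lemma increment_path_measurable:
  assumes "t \<le> T"
  shows "increment_path T t b v \<in> measurable N (Filt T t T)"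
proof (rule measurable_into_Filt)
  fix r assume r: "r \<in> {t..T}"
  have "(\<lambda>x. (r - t) *\<^sub>R b + W (r - t) x *\<^sub>R v) \<in> borel_measurable N"
    using r by (intro borel_measurable_add borel_measurable_scaleR borel_measurable_const W_measurable) simp
  then show "(\<lambda>x. increment_path T t b v x r) \<in> borel_measurable N" using r by (simp add: increment_path_def)
qed (rule increment_path_in_Omega[OF _ assms])

end

lemma concat_path_in_Omega:
  assumes "\<omega> \<in> Omega T 0" "\<omega>' \<in> Omega T t" "t \<in> {0..T}"
  shows "concat_path T 0 t \<omega> \<omega>' \<in> Omega T 0"
proof -
  have "continuous_on ({0..t} \<union> {t..T}) (\<lambda>r. if r \<le> t then \<omega> r else \<omega> t + \<omega>' r)"
  proof (rule continuous_on_If)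
    show "continuous_on {0..t} \<omega>"
      using OmegaD(2)[OF assms(1)] by (rule continuous_on_subset) (use assms(3) in auto)
    show "continuous_on {t..T} (\<lambda>r. \<omega> t + \<omega>' r)" using OmegaD(2)[OF assms(2)] by (intro continuous_intros)
  qed (use OmegaD(3)[OF assms(2)] in auto)
  then have "continuous_on {0..T} (concat_path T 0 t \<omega> \<omega>')"
    by (rule continuous_on_eq[OF continuous_on_subset])
       (use assms(3) OmegaD(3)[OF assms(2)] in \<open>auto simp: concat_path_def\<close>)
  then show ?thesis
    using assms(3) OmegaD(3)[OF assms(1)] OmegaD(3)[OF assms(2)] by (auto simp: Omega_def concat_path_def)
qed

lemma concat_path_measurable:
  assumes "\<omega> \<in> Omega T 0" "t \<in> {0..T}"
  shows "concat_path T 0 t \<omega> \<in> measurable (Filt T t T) (Filt T 0 T)"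
proof (rule measurable_into_Filt)
  fix r assume r: "r \<in> {0..T}"
  show "(\<lambda>\<omega>'. concat_path T 0 t \<omega> \<omega>' r) \<in> borel_measurable (Filt T t T)"
  proof (cases "r < t")
    case True
    then show ?thesis using r by (simp add: concat_path_def)
  next
    case False
    then have "(\<lambda>\<omega>'. \<omega> t + \<omega>' r) \<in> borel_measurable (Filt T t T)"
      using r by (intro borel_measurable_add borel_measurable_const measurable_eval_Filt) auto
    then show ?thesis using r False by (simp add: concat_path_def)
  qed
qed (use concat_path_in_Omega[OF assms(1) _ assms(2)] in auto)

context brownian
begin

lemma shifted_path_in_Omega:
  assumes "\<omega> \<in> Omega T 0" "t \<in> {0..T}" "x \<in> space N"
  shows "shifted_path T t \<omega> b v x \<in> Omega T 0"
  unfolding shifted_path_def using assms by (intro concat_path_in_Omega increment_path_in_Omega) auto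

lemma shifted_path_measurable:
  assumes "\<omega> \<in> Omega T 0" "t \<in> {0..T}"
  shows "shifted_path T t \<omega> b v \<in> measurable N (Filt T 0 T)"
  unfolding shifted_path_def[abs_def] using assms
  by (intro measurable_compose[OF increment_path_measurable concat_path_measurable]) auto

lemma driven_path_smooth:
  fixes g g' :: "real \<Rightarrow> real ^ 'd::finite"
  assumes T: "0 < T" "0 \<le> t" "t \<le> T" and g: "g 0 = 0" "\<And>s. (g has_vector_derivative g' s) (at s)" "continuous_on UNIV g'"
  shows "driven_path N W T t (\<lambda>s. if s \<le> t then g s else g t + (s - t) *\<^sub>R b) (\<lambda>s. if s \<le> t then g' s else b) b"
proof unfold_locales
  let ?l = "\<lambda>s. if s \<le> t then g s else g t + (s - t) *\<^sub>R b" and ?\<alpha> = "\<lambda>s. if s \<le> t then g' s else b"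
  have gc: "continuous_on A g" for A
    using g(2) by (meson continuous_at_imp_continuous_on has_vector_derivative_continuous)
  have "continuous_on ({0..t} \<union> {t..T}) ?l"
    by (rule continuous_on_If) (auto intro!: continuous_intros gc)
  moreover have "{0..t} \<union> {t..T} = {0..T}" using T by auto
  ultimately show lc: "continuous_on {0..T} ?l" by simp
  have [measurable]: "g' \<in> borel_measurable borel" by (rule borel_measurable_continuous_onI[OF g(3)])
  show \<alpha>m: "?\<alpha> \<in> borel_measurable borel" by measurable
  have "compact (g' ` {0..T})" by (intro compact_continuous_image continuous_on_subset[OF g(3)]) auto
  then obtain L where L: "\<And>r. r \<in> {0..T} \<Longrightarrow> norm (g' r) \<le> L"
    by (meson bounded_iff compact_imp_bounded imageI)
  have \<alpha>b: "norm (?\<alpha> r) \<le> max L (norm b)" if "r \<in> {0..T}" for r using L[OF that] by auto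
  then show "\<exists>L. \<forall>r\<in>{0..T}. norm (?\<alpha> r) \<le> L" by blast
  fix s assume s: "s \<in> {0..T}"
  \<comment> \<open>The path has a kink at t, where the polynomial meets the line of slope b; the
    fundamental theorem tolerates this one exceptional point.\<close>
  have "(?\<alpha> has_integral (?l s - ?l 0)) {0..s}"
  proof (rule fundamental_theorem_of_calculus_interior_strong[of "{t}"])
    show "continuous_on {0..s} ?l" by (rule continuous_on_subset[OF lc]) (use s in auto)
    fix r assume r: "r \<in> {0<..<s} - {t}"
    show "(?l has_vector_derivative ?\<alpha> r) (at r)"
    proof (cases "r < t")
      case True
      have "(?l has_vector_derivative g' r) (at r)"
        by (rule has_vector_derivative_transform_within_open[OF g(2), where S="{..<t}"]) (use True in auto)
      then show ?thesis using True by simp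
    next
      case False
      then have "r > t" using r by auto
      have "((\<lambda>s. g t + (s - t) *\<^sub>R b) has_vector_derivative b) (at r)"
        by (auto intro!: derivative_eq_intros)
      then have "(?l has_vector_derivative b) (at r)"
        by (rule has_vector_derivative_transform_within_open[where S="{t<..}"]) (use \<open>r > t\<close> in auto)
      then show ?thesis using \<open>r > t\<close> by simp
    qed
  qed (use s in auto)
  then have "integral {0..s} ?\<alpha> = ?l s" using T g(1) by (simp add: integral_unique)
  moreover have "set_integrable lborel {0..s} ?\<alpha>"
    unfolding set_integrable_def
  proof (rule integrableI_bounded_set_indicator[where B="max L (norm b)"])
    show "AE r in lborel. r \<in> {0..s} \<longrightarrow> norm (?\<alpha> r) \<le> max L (norm b)"
      using \<alpha>b s by (intro AE_I2 impI) auto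
  qed (use \<alpha>m in \<open>auto simp: emeasure_lborel_Icc_eq\<close>)
  then have "(LINT r:{0..s}|lborel. ?\<alpha> r) = integral {0..s} ?\<alpha>" by (rule set_borel_integral_eq_integral(2))
  ultimately show "(LINT r:{0..s}|lborel. ?\<alpha> r) = ?l s" by simp
qed (use T g in auto)

lemma (in driven_path) X_eq_shifted_path:
  assumes "x \<in> space N"
  shows "X x = shifted_path T t base b v x"
proof
  fix s
  consider "s \<notin> {0..T}" | "s \<in> {0..T}" "s < t" | "s \<in> {0..T}" "t \<le> s" by fastforce
  then show "X x s = shifted_path T t base b v x s"
  proof cases
    case 2
    then show ?thesis using W_0[OF assms] by (simp add: X_def shifted_path_def concat_path_def base_def)
  next
    case 3
    then show ?thesis using l_affine[of s] t
      by (simp add: X_def shifted_path_def concat_path_def increment_path_def base_def)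
  qed (auto simp: X_def shifted_path_def concat_path_def)
qed

text \<open>Reduces statements about arbitrary \<omega> to smooth initial segments. Closeness is
  needed up to t only, so the affine continuation may start from the value of the polynomial at
  t.\<close>

lemma driven_path_approximation:
  fixes \<omega> :: "'d::finite path"
  assumes T: "0 < T" and t: "t \<in> {0..T}" and \<omega>: "\<omega> \<in> Omega T 0"
  obtains l \<alpha> where "\<And>m. driven_path N W T t (l m) (\<alpha> m) b"
    "\<And>m s. s \<in> {0..t} \<Longrightarrow> norm (\<omega> s - driven_path.base T t (l m) s) \<le> 1 / real (Suc m)"
proof -
  have c: "continuous_on {0..t} \<omega>" using OmegaD(2)[OF \<omega>] by (rule continuous_on_subset) (use t in auto)
  have "\<exists>l \<alpha>. driven_path N W T t l \<alpha> b \<and> (\<forall>s\<in>{0..t}. norm (\<omega> s - driven_path.base T t l s) \<le> 1 / real (Suc m))" for m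
  proof -
    have "0 \<le> t" "(0::real) < 1 / real (Suc m)" using t by auto
    then obtain g g' where g: "g 0 = 0" "\<And>s. s \<in> {0..t} \<Longrightarrow> norm (\<omega> s - g s) \<le> 1 / real (Suc m)"
      "\<And>s. (g has_vector_derivative g' s) (at s)" "continuous_on UNIV g'"
      using polynomial_approximation[OF c OmegaD(3)[OF \<omega>]] by metis
    define l where "l s = (if s \<le> t then g s else g t + (s - t) *\<^sub>R b)" for s
    have D: "driven_path N W T t l (\<lambda>s. if s \<le> t then g' s else b) b"
      unfolding l_def[abs_def] using T t by (intro driven_path_smooth g(1,3,4)) auto
    have "driven_path.base T t l s = g s" if "s \<in> {0..t}" for s
      using that t by (simp add: driven_path.base_def[OF D] l_def)
    then show ?thesis using D g(2) by (intro exI[of _ l] exI) auto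
  qed
  then show thesis using that by metis
qed

text \<open>Both concatenations add the same increments after t, so their difference there stays
  frozen at its value at time t.\<close>

lemma shifted_path_close:
  assumes "t \<in> {0..T}" "\<And>s. s \<in> {0..t} \<Longrightarrow> norm (\<omega> s - \<omega>' s) \<le> e" "r \<in> {0..T}"
  shows "norm (shifted_path T t \<omega> b v x r - shifted_path T t \<omega>' b v x r) \<le> e"
  using assms(2)[of r] assms(2)[of t] assms(1,3) by (simp add: shifted_path_def concat_path_def)

text \<open>For each x the concatenated paths converge uniformly, so f s converges pointwise, and
  its bound is the dominating constant.\<close>

lemma expectation_shifted_path_tendsto:
  fixes f :: "('d::finite, real) process"
  assumes f: "f \<in> C0 T 0" "bounded_proc T 0 f" and t: "t \<in> {0..T}" and s: "s \<in> {t..T}"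
    and \<omega>: "\<omega> \<in> Omega T 0" "\<And>m. \<omega>' m \<in> Omega T 0" "\<And>m r. r \<in> {0..t} \<Longrightarrow> norm (\<omega> r - \<omega>' m r) \<le> 1 / real (Suc m)"
  shows "(\<lambda>m. expectation (\<lambda>x. f s (shifted_path T t (\<omega>' m) b v x))) \<longlonglongrightarrow> expectation (\<lambda>x. f s (shifted_path T t \<omega> b v x))"
proof -
  obtain C where C: "C \<ge> 0" "\<And>s \<omega>. s \<in> {0..T} \<Longrightarrow> \<omega> \<in> Omega T 0 \<Longrightarrow> norm (f s \<omega>) \<le> C"
    using bounded_procD[OF f(2)] by blast
  have s': "s \<in> {0..T}" using s t by auto
  show ?thesis
  proof (rule integral_dominated_convergence[where w="\<lambda>_. C"])
    show "AE x in N. (\<lambda>m. f s (shifted_path T t (\<omega>' m) b v x)) \<longlonglongrightarrow> f s (shifted_path T t \<omega> b v x)"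
    proof (intro AE_I2)
      fix x assume x: "x \<in> space N"
      have "(\<lambda>m. 1 / real (Suc m)) \<longlonglongrightarrow> 0" by real_asymp
      then show "(\<lambda>m. f s (shifted_path T t (\<omega>' m) b v x)) \<longlonglongrightarrow> f s (shifted_path T t \<omega> b v x)"
        using t s' \<omega> x
        by (intro continuous_proc_tendsto[OF C0_D(2)[OF f(1)] s', where e="\<lambda>m. 1 / real (Suc m)"] shifted_path_in_Omega shifted_path_close) auto
    qed
    show "AE x in N. norm (f s (shifted_path T t (\<omega>' m) b v x)) \<le> C" for m
      using s' t \<omega> by (intro AE_I2 C shifted_path_in_Omega) auto
  qed (use t \<omega> in \<open>auto intro!: measurable_compose[OF shifted_path_measurable C0_measurable(2)[OF f(1) s']]\<close>)
qed

lemma C0_approximation_tendsto: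
  fixes f :: "('d::finite, 'b::euclidean_space) process"
  assumes f: "f \<in> C0 T 0" and t: "t \<in> {0..T}"
    and \<omega>: "\<omega> \<in> Omega T 0" "\<And>m. \<omega>' m \<in> Omega T 0" "\<And>m r. r \<in> {0..t} \<Longrightarrow> norm (\<omega> r - \<omega>' m r) \<le> 1 / real (Suc m)"
  shows "(\<lambda>m. f t (\<omega>' m)) \<longlonglongrightarrow> f t \<omega>"
proof -
  have "(\<lambda>m. 1 / real (Suc m)) \<longlonglongrightarrow> 0" by real_asymp
  then show ?thesis using \<omega> by (intro continuous_proc_tendsto[OF C0_D(2)[OF f] t])
qed

lemma generator_term_approximation_tendsto:
  assumes D: "path_derivs T 0 u a p q" and t: "t \<in> {0..T}"
    and \<omega>: "\<omega> \<in> Omega T 0" "\<And>m. \<omega>' m \<in> Omega T 0" "\<And>m r. r \<in> {0..t} \<Longrightarrow> norm (\<omega> r - \<omega>' m r) \<le> 1 / real (Suc m)"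
  shows "(\<lambda>m. generator_term b v a p q t (\<omega>' m)) \<longlonglongrightarrow> generator_term b v a p q t \<omega>"
  unfolding generator_term_def
  by (intro tendsto_intros C0_approximation_tendsto[OF path_derivs_C0(2)[OF D] t \<omega>]
      C0_approximation_tendsto[OF path_derivs_C0(3)[OF D] t \<omega>] C0_approximation_tendsto[OF path_derivs_C0(4)[OF D] t \<omega>])

text \<open>The pair b = v = 0 isolates a, and b = axis i 1 with v = 0 then isolates p. Only with p
  settled may v be nonzero; polarisation in v gives the symmetric part of q, which is all of q. Time
  T is excluded because the argument needs an interval after t.\<close>

lemma path_derivs_unique:
  fixes u :: "('d::finite, real) process"
  assumes T: "0 < T" and D: "path_derivs T 0 u a p q" and D': "path_derivs T 0 u a' p' q'"
    and t: "t \<in> {0..<T}" and \<omega>: "\<omega> \<in> Omega T 0"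
  shows "a t \<omega> = a' t \<omega>" "p t \<omega> = p' t \<omega>" "q t \<omega> = q' t \<omega>"
proof -
  have G: "generator_term b v a p q t \<omega> = generator_term b v a' p' q' t \<omega>"
    if t: "t \<in> {0..<T}" and \<omega>: "\<omega> \<in> Omega T 0" and v: "v = 0 \<or> (\<forall>r\<in>{0..<T}. \<forall>\<omega>\<in>Omega T 0. p r \<omega> = p' r \<omega>)"
    for b v t \<omega>
  proof -
    have t': "t \<in> {0..T}" using t by auto
    obtain l \<alpha> where l: "\<And>m. driven_path N W T t (l m) (\<alpha> m) b"
      "\<And>m s. s \<in> {0..t} \<Longrightarrow> norm (\<omega> s - driven_path.base T t (l m) s) \<le> 1 / real (Suc m)"
      using driven_path_approximation[OF T t' \<omega>] by blast
    have bO: "driven_path.base T t (l m) \<in> Omega T 0" for m by (rule driven_path.base_in_Omega[OF l(1)])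
    have "generator_term b v a p q t (driven_path.base T t (l m)) = generator_term b v a' p' q' t (driven_path.base T t (l m))" for m
      using t by (intro driven_path.path_derivs_generator_term_unique[OF l(1) D D' _ v]) auto
    then show ?thesis
      using generator_term_approximation_tendsto[OF D t' \<omega> bO l(2), of b v]
        generator_term_approximation_tendsto[OF D' t' \<omega> bO l(2), of b v] LIMSEQ_unique by auto
  qed
  have a: "a t \<omega> = a' t \<omega>" if "t \<in> {0..<T}" "\<omega> \<in> Omega T 0" for t \<omega>
    using G[OF that, of 0 0] by (simp add: generator_term_def)
  have p: "p t \<omega> = p' t \<omega>" if "t \<in> {0..<T}" "\<omega> \<in> Omega T 0" for t \<omega>
  proof (rule vec_eq_iff[THEN iffD2], rule)
    fix i
    show "p t \<omega> $ i = p' t \<omega> $ i"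
      using G[OF that, of 0 "axis i 1"] a[OF that] by (simp add: generator_term_def inner_axis)
  qed
  have q: "q t \<omega> \<bullet> outer v = q' t \<omega> \<bullet> outer v" for v
    using G[OF t \<omega>, of v 0] a[OF t \<omega>] p by (simp add: generator_term_def)
  have qe: "q t \<omega> $ i $ j + q t \<omega> $ j $ i = q' t \<omega> $ i $ j + q' t \<omega> $ j $ i" for i j
  proof -
    have *: "M \<bullet> outer (axis i 1 + axis j 1) - M \<bullet> outer (axis i 1) - M \<bullet> outer (axis j 1) = M $ i $ j + M $ j $ i"
      for M :: "real ^ 'd ^ 'd"
      by (simp add: inner_outer axis_def distrib_left distrib_right sum.distrib if_distrib[of "\<lambda>x. x * _"] if_distrib[of "\<lambda>x. _ * x"] cong: if_cong)
    show ?thesis using *[of "q t \<omega>"] *[of "q' t \<omega>"] q by simp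
  qed
  have "q t \<omega> \<in> Sym" "q' t \<omega> \<in> Sym" using D D' t \<omega> by (auto simp: path_derivs_def Lambda_def)
  then have sym: "q t \<omega> $ i $ j = q t \<omega> $ j $ i" "q' t \<omega> $ i $ j = q' t \<omega> $ j $ i" for i j
    unfolding Sym_def by (metis (mono_tags) mem_Collect_eq transpose_def vec_lambda_beta)+
  show "a t \<omega> = a' t \<omega>" "p t \<omega> = p' t \<omega>" using a p t \<omega> by auto
  show "q t \<omega> = q' t \<omega>"
  proof -
    have "q t \<omega> $ i $ j = q' t \<omega> $ i $ j" for i j using qe[of i j] sym(1)[of j i] sym(2)[of j i] by linarith
    then show ?thesis by (simp add: vec_eq_iff)
  qed
qed

lemma generator_term_bounded:
  assumes "C12b_derivs T 0 u a p q"
  obtains C where "C \<ge> 0" "\<And>s \<omega>. s \<in> {0..T} \<Longrightarrow> \<omega> \<in> Omega T 0 \<Longrightarrow> norm (generator_term b v a p q s \<omega>) \<le> C"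
proof -
  have bp: "bounded_proc T 0 a" "bounded_proc T 0 p" "bounded_proc T 0 q" using assms by (auto simp: C12b_derivs_def)
  obtain Ca where Ca: "Ca \<ge> 0" "\<And>s \<omega>. s \<in> {0..T} \<Longrightarrow> \<omega> \<in> Omega T 0 \<Longrightarrow> norm (a s \<omega>) \<le> Ca"
    using bounded_procD[OF bp(1)] by blast
  obtain Cp where Cp: "Cp \<ge> 0" "\<And>s \<omega>. s \<in> {0..T} \<Longrightarrow> \<omega> \<in> Omega T 0 \<Longrightarrow> norm (p s \<omega>) \<le> Cp"
    using bounded_procD[OF bp(2)] by blast
  obtain Cq where Cq: "Cq \<ge> 0" "\<And>s \<omega>. s \<in> {0..T} \<Longrightarrow> \<omega> \<in> Omega T 0 \<Longrightarrow> norm (q s \<omega>) \<le> Cq"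
    using bounded_procD[OF bp(3)] by blast
  have "norm (generator_term b v a p q s \<omega>) \<le> Ca + Cp * norm b + Cq * norm (outer v)"
    if "s \<in> {0..T}" "\<omega> \<in> Omega T 0" for s \<omega>
  proof -
    have "\<bar>p s \<omega> \<bullet> b\<bar> \<le> norm (p s \<omega>) * norm b" by (rule Cauchy_Schwarz_ineq2)
    also have "\<dots> \<le> Cp * norm b" using Cp that by (intro mult_right_mono) auto
    finally have 1: "\<bar>p s \<omega> \<bullet> b\<bar> \<le> Cp * norm b" .
    have "\<bar>q s \<omega> \<bullet> outer v\<bar> \<le> norm (q s \<omega>) * norm (outer v)" by (rule Cauchy_Schwarz_ineq2)
    also have "\<dots> \<le> Cq * norm (outer v)" using Cq that by (intro mult_right_mono) auto
    finally have 2: "\<bar>q s \<omega> \<bullet> outer v\<bar> \<le> Cq * norm (outer v)" .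
    have "\<bar>a s \<omega>\<bar> \<le> Ca" using Ca that by auto
    with 1 2 show ?thesis unfolding generator_term_def real_norm_def by linarith
  qed
  moreover have "0 \<le> Ca + Cp * norm b + Cq * norm (outer v)" using Ca Cp Cq by simp
  ultimately show thesis using that by blast
qed

text \<open>Along smooth segments Dynkin's formula bounds the change by the sup of the generator
  term times s - t. That sup does not depend on the segment, so the bound passes to every
  \<omega>.\<close>

lemma C12b_rate:
  fixes f :: "('d::finite, real) process"
  assumes T: "0 < T" and f: "f \<in> C12b T 0"
  shows "\<exists>C\<ge>0. \<forall>t\<in>{0..T}. \<forall>s\<in>{t..T}. \<forall>\<omega>\<in>Omega T 0.
    \<bar>expectation (\<lambda>x. f s (shifted_path T t \<omega> b v x)) - f t \<omega>\<bar> \<le> C * (s - t)"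
proof -
  obtain a p q where C12: "C12b_derivs T 0 f a p q" using f unfolding C12b_def by blast
  then have D: "path_derivs T 0 f a p q" and bp: "bounded_proc T 0 f" "bounded_proc T 0 p"
    by (auto simp: C12b_derivs_def)
  obtain Cf where Cf: "Cf \<ge> 0" "\<And>s \<omega>. s \<in> {0..T} \<Longrightarrow> \<omega> \<in> Omega T 0 \<Longrightarrow> norm (f s \<omega>) \<le> Cf"
    using bounded_procD[OF bp(1)] by blast
  obtain Cp where Cp: "Cp \<ge> 0" "\<And>s \<omega>. s \<in> {0..T} \<Longrightarrow> \<omega> \<in> Omega T 0 \<Longrightarrow> norm (p s \<omega>) \<le> Cp"
    using bounded_procD[OF bp(2)] by blast
  obtain Cg where Cg: "Cg \<ge> 0" "\<And>s \<omega>. s \<in> {0..T} \<Longrightarrow> \<omega> \<in> Omega T 0 \<Longrightarrow> norm (generator_term b v a p q s \<omega>) \<le> Cg"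
    using generator_term_bounded[OF C12] by blast
  have "\<bar>expectation (\<lambda>x. f s (shifted_path T t \<omega> b v x)) - f t \<omega>\<bar> \<le> Cg * (s - t)"
    if t: "t \<in> {0..T}" and s: "s \<in> {t..T}" and \<omega>: "\<omega> \<in> Omega T 0" for t s \<omega>
  proof -
    obtain l \<alpha> where l: "\<And>m. driven_path N W T t (l m) (\<alpha> m) b"
      "\<And>m s. s \<in> {0..t} \<Longrightarrow> norm (\<omega> s - driven_path.base T t (l m) s) \<le> 1 / real (Suc m)"
      using driven_path_approximation[OF T t \<omega>] by blast
    have bO: "driven_path.base T t (l m) \<in> Omega T 0" for m by (rule driven_path.base_in_Omega[OF l(1)])
    have "\<bar>expectation (\<lambda>x. f s (shifted_path T t (driven_path.base T t (l m)) b v x)) - f t (driven_path.base T t (l m))\<bar> \<le> Cg * (s - t)" for m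
    proof -
      interpret driven_path N W T t "l m" "\<alpha> m" b v by (rule l(1))
      have "expectation (\<lambda>x. f s (X x)) - f t base = expectation (\<lambda>x. LINT r:{t..s}|lborel. generator_term b v a p q r (X x))"
        by (rule dynkin_formula(1)[OF D Cf(2) Cp(2) Cg(2) s])
      also have "\<bar>\<dots>\<bar> \<le> Cg * (s - t)"
      proof (rule order_trans[OF integral_abs_bound])
        have "expectation (\<lambda>x. \<bar>LINT r:{t..s}|lborel. generator_term b v a p q r (X x)\<bar>) \<le> expectation (\<lambda>x. Cg * (s - t))"
          using dynkin_formula(2)[OF D Cf(2) Cp(2) Cg(2) s] Cg(1) s
          by (intro integral_mono_AE') auto
        then show "expectation (\<lambda>x. \<bar>LINT r:{t..s}|lborel. generator_term b v a p q r (X x)\<bar>) \<le> Cg * (s - t)"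
          by (simp add: prob_space)
      qed
      finally have "\<bar>expectation (\<lambda>x. f s (X x)) - f t base\<bar> \<le> Cg * (s - t)" .
      moreover have "expectation (\<lambda>x. f s (X x)) = expectation (\<lambda>x. f s (shifted_path T t base b v x))"
        by (intro Bochner_Integration.integral_cong refl) (simp add: X_eq_shifted_path)
      ultimately show ?thesis by simp
    qed
    moreover have "(\<lambda>m. \<bar>expectation (\<lambda>x. f s (shifted_path T t (driven_path.base T t (l m)) b v x)) - f t (driven_path.base T t (l m))\<bar>)
      \<longlonglongrightarrow> \<bar>expectation (\<lambda>x. f s (shifted_path T t \<omega> b v x)) - f t \<omega>\<bar>"
      by (intro tendsto_intros expectation_shifted_path_tendsto[OF path_derivs_C0(1)[OF D] bp(1) t s \<omega> bO l(2)]
          C0_approximation_tendsto[OF path_derivs_C0(1)[OF D] t \<omega> bO l(2)])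
    ultimately show ?thesis by (intro LIMSEQ_le_const2) auto
  qed
  then show ?thesis using Cg(1) by blast
qed

text \<open>The generator term of u is a finite linear combination, with fixed coefficients from b
  and v, of functions that each change by O(r - t) in expectation. Hence so does the generator term,
  and integrating this over [t, s] gives the square.\<close>

lemma C24b_rate:
  fixes u :: "('d::finite, real) process"
  assumes T: "0 < T" and C12: "C12b_derivs T 0 u a p q" and a: "a \<in> C12b T 0"
    and p: "\<And>i. (\<lambda>s \<omega>. p s \<omega> $ i) \<in> C12b T 0" and q: "\<And>i j. (\<lambda>s \<omega>. q s \<omega> $ i $ j) \<in> C12b T 0"
  shows "\<exists>C\<ge>0. \<forall>t\<in>{0..T}. \<forall>s\<in>{t..T}. \<forall>\<omega>\<in>Omega T 0.
    \<bar>expectation (\<lambda>x. u s (shifted_path T t \<omega> b v x)) - u t \<omega> - (s - t) * generator_term b v a p q t \<omega>\<bar> \<le> C * (s - t)\<^sup>2"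
proof -
  have D: "path_derivs T 0 u a p q" and bp: "bounded_proc T 0 u" "bounded_proc T 0 p"
    using C12 by (auto simp: C12b_derivs_def)
  obtain Cu where Cu: "Cu \<ge> 0" "\<And>s \<omega>. s \<in> {0..T} \<Longrightarrow> \<omega> \<in> Omega T 0 \<Longrightarrow> norm (u s \<omega>) \<le> Cu"
    using bounded_procD[OF bp(1)] by blast
  obtain Cp where Cp: "Cp \<ge> 0" "\<And>s \<omega>. s \<in> {0..T} \<Longrightarrow> \<omega> \<in> Omega T 0 \<Longrightarrow> norm (p s \<omega>) \<le> Cp"
    using bounded_procD[OF bp(2)] by blast
  obtain Cg where Cg: "Cg \<ge> 0" "\<And>s \<omega>. s \<in> {0..T} \<Longrightarrow> \<omega> \<in> Omega T 0 \<Longrightarrow> norm (generator_term b v a p q s \<omega>) \<le> Cg"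
    using generator_term_bounded[OF C12] by blast
  define rate where "rate f C \<longleftrightarrow> (\<forall>t\<in>{0..T}. \<forall>s\<in>{t..T}. \<forall>\<omega>\<in>Omega T 0.
    \<bar>expectation (\<lambda>x. f s (shifted_path T t \<omega> b v x)) - f t \<omega>\<bar> \<le> C * (s - t))" for f :: "('d, real) process" and C
  obtain Ra where Ra: "Ra \<ge> 0" "rate a Ra" using C12b_rate[OF T a] unfolding rate_def by blast
  have "\<forall>i. \<exists>C\<ge>0. rate (\<lambda>s \<omega>. p s \<omega> $ i) C" using C12b_rate[OF T p] unfolding rate_def by blast
  then obtain Rp where Rp: "\<And>i. Rp i \<ge> 0" "\<And>i. rate (\<lambda>s \<omega>. p s \<omega> $ i) (Rp i)" by metis
  have "\<forall>i j. \<exists>C\<ge>0. rate (\<lambda>s \<omega>. q s \<omega> $ i $ j) C" using C12b_rate[OF T q] unfolding rate_def by blast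
  then obtain Rq where Rq: "\<And>i j. Rq i j \<ge> 0" "\<And>i j. rate (\<lambda>s \<omega>. q s \<omega> $ i $ j) (Rq i j)" by metis
  \<comment> \<open>The rates of the components, weighted by the absolute coefficients with which
    they enter the generator term.\<close>
  define C where "C = Ra + (\<Sum>i\<in>UNIV. \<bar>b $ i\<bar> * Rp i) + 1/2 * (\<Sum>i\<in>UNIV. \<Sum>j\<in>UNIV. \<bar>v $ i * v $ j\<bar> * Rq i j)"
  have "C \<ge> 0" unfolding C_def using Ra(1) Rp(1) Rq(1) by (intro add_nonneg_nonneg mult_nonneg_nonneg sum_nonneg) auto
  have grate: "\<bar>expectation (\<lambda>x. generator_term b v a p q r (shifted_path T t \<omega> b v x)) - generator_term b v a p q t \<omega>\<bar> \<le> C * (r - t)"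
    if t: "t \<in> {0..T}" and r: "r \<in> {t..T}" and \<omega>: "\<omega> \<in> Omega T 0" for t r \<omega>
  proof -
    define E where "E f = expectation (\<lambda>x. f r (shifted_path T t \<omega> b v x))" for f :: "('d, real) process"
    have r0: "r \<in> {0..T}" using r t by auto
    have int: "integrable N (\<lambda>x. f r (shifted_path T t \<omega> b v x))" if f: "f \<in> C12b T 0" for f :: "('d, real) process"
    proof -
      obtain a' p' q' where "C12b_derivs T 0 f a' p' q'" using f unfolding C12b_def by blast
      then have f0: "f \<in> C0 T 0" "bounded_proc T 0 f" using path_derivs_C0(1) by (auto simp: C12b_derivs_def)
      obtain B where "\<And>s \<omega>. s \<in> {0..T} \<Longrightarrow> \<omega> \<in> Omega T 0 \<Longrightarrow> norm (f s \<omega>) \<le> B"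
        using bounded_procD[OF f0(2)] by blast
      then show ?thesis
        using measurable_compose[OF shifted_path_measurable[OF \<omega> t] C0_measurable(2)[OF f0(1) r0]] shifted_path_in_Omega[OF \<omega> t] r0
        by (intro integrable_const_bound[where B=B]) auto
    qed
    have R: "\<bar>E f - f t \<omega>\<bar> \<le> C * (r - t)" if "rate f C" for f C
      using that t r \<omega> unfolding rate_def E_def by blast
    have gsum: "generator_term b v a p q s \<omega>' = a s \<omega>' + (\<Sum>i\<in>UNIV. b $ i * p s \<omega>' $ i) + 1/2 * (\<Sum>i\<in>UNIV. \<Sum>j\<in>UNIV. v $ i * v $ j * q s \<omega>' $ i $ j)" for s \<omega>'
      by (simp add: generator_term_def inner_outer inner_vec_def mult.commute)
    have "expectation (\<lambda>x. generator_term b v a p q r (shifted_path T t \<omega> b v x)) =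
       E a + (\<Sum>i\<in>UNIV. b $ i * E (\<lambda>s \<omega>. p s \<omega> $ i)) + 1/2 * (\<Sum>i\<in>UNIV. \<Sum>j\<in>UNIV. v $ i * v $ j * E (\<lambda>s \<omega>. q s \<omega> $ i $ j))"
      unfolding gsum E_def using int[OF a] int[OF p] int[OF q] by simp
    then have "expectation (\<lambda>x. generator_term b v a p q r (shifted_path T t \<omega> b v x)) - generator_term b v a p q t \<omega> =
       (E a - a t \<omega>) + (\<Sum>i\<in>UNIV. b $ i * (E (\<lambda>s \<omega>. p s \<omega> $ i) - p t \<omega> $ i)) +
       1/2 * (\<Sum>i\<in>UNIV. \<Sum>j\<in>UNIV. v $ i * v $ j * (E (\<lambda>s \<omega>. q s \<omega> $ i $ j) - q t \<omega> $ i $ j))"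
      unfolding gsum by (simp add: right_diff_distrib sum_subtractf)
    moreover have "\<bar>E a - a t \<omega>\<bar> \<le> Ra * (r - t)" by (rule R[OF Ra(2)])
    moreover have "\<bar>\<Sum>i\<in>UNIV. b $ i * (E (\<lambda>s \<omega>. p s \<omega> $ i) - p t \<omega> $ i)\<bar> \<le> (\<Sum>i\<in>UNIV. \<bar>b $ i\<bar> * (Rp i * (r - t)))"
      by (rule order_trans[OF sum_abs]) (auto simp: abs_mult intro!: sum_mono mult_left_mono R[OF Rp(2)])
    moreover have "\<bar>\<Sum>i\<in>UNIV. \<Sum>j\<in>UNIV. v $ i * v $ j * (E (\<lambda>s \<omega>. q s \<omega> $ i $ j) - q t \<omega> $ i $ j)\<bar>
       \<le> (\<Sum>i\<in>UNIV. \<Sum>j\<in>UNIV. \<bar>v $ i * v $ j\<bar> * (Rq i j * (r - t)))"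
    proof (rule order_trans[OF sum_abs], rule sum_mono, rule order_trans[OF sum_abs], rule sum_mono)
      fix i j
      have "\<bar>E (\<lambda>s \<omega>. q s \<omega> $ i $ j) - q t \<omega> $ i $ j\<bar> \<le> Rq i j * (r - t)" by (rule R[OF Rq(2)])
      then show "\<bar>v $ i * v $ j * (E (\<lambda>s \<omega>. q s \<omega> $ i $ j) - q t \<omega> $ i $ j)\<bar> \<le> \<bar>v $ i * v $ j\<bar> * (Rq i j * (r - t))"
        unfolding abs_mult[of "v $ i * v $ j"] by (rule mult_left_mono) simp
    qed
    moreover have "C * (r - t) = Ra * (r - t) + (\<Sum>i\<in>UNIV. \<bar>b $ i\<bar> * (Rp i * (r - t))) +
       1/2 * (\<Sum>i\<in>UNIV. \<Sum>j\<in>UNIV. \<bar>v $ i * v $ j\<bar> * (Rq i j * (r - t)))"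
      by (simp add: C_def distrib_right sum_distrib_right mult.assoc)
    ultimately show ?thesis by linarith
  qed
  have "\<bar>expectation (\<lambda>x. u s (shifted_path T t \<omega> b v x)) - u t \<omega> - (s - t) * generator_term b v a p q t \<omega>\<bar> \<le> C * (s - t)\<^sup>2"
    if t: "t \<in> {0..T}" and s: "s \<in> {t..T}" and \<omega>: "\<omega> \<in> Omega T 0" for t s \<omega>
  proof -
    obtain l \<alpha> where l: "\<And>m. driven_path N W T t (l m) (\<alpha> m) b"
      "\<And>m s. s \<in> {0..t} \<Longrightarrow> norm (\<omega> s - driven_path.base T t (l m) s) \<le> 1 / real (Suc m)"
      using driven_path_approximation[OF T t \<omega>] by blast
    have bO: "driven_path.base T t (l m) \<in> Omega T 0" for m by (rule driven_path.base_in_Omega[OF l(1)])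
    have "\<bar>expectation (\<lambda>x. u s (shifted_path T t (driven_path.base T t (l m)) b v x)) - u t (driven_path.base T t (l m)) -
        (s - t) * generator_term b v a p q t (driven_path.base T t (l m))\<bar> \<le> C * (s - t)\<^sup>2" for m
    proof -
      note t0 = t
      interpret driven_path N W T t "l m" "\<alpha> m" b v by (rule l(1))
      have E: "expectation (\<lambda>x. f (X x)) = expectation (\<lambda>x. f (shifted_path T t base b v x))" for f :: "'d path \<Rightarrow> real"
        by (intro Bochner_Integration.integral_cong refl) (simp add: X_eq_shifted_path)
      have "\<bar>expectation (\<lambda>x. u s (X x)) - u t base - (s - t) * generator_term b v a p q t base\<bar> \<le> C * (s - t)\<^sup>2"
      proof (rule dynkin_second_order[OF D Cu(2) Cp(2) Cg(2) s _ \<open>C \<ge> 0\<close>])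
        fix r assume "r \<in> {t..s}"
        then show "\<bar>expectation (\<lambda>x. generator_term b v a p q r (X x)) - generator_term b v a p q t base\<bar> \<le> C * (r - t)"
          using grate[OF t0 _ base_in_Omega, of r] s by (simp add: E)
      qed
      then show ?thesis by (simp add: E)
    qed
    moreover have "(\<lambda>m. \<bar>expectation (\<lambda>x. u s (shifted_path T t (driven_path.base T t (l m)) b v x)) - u t (driven_path.base T t (l m)) -
        (s - t) * generator_term b v a p q t (driven_path.base T t (l m))\<bar>)
      \<longlonglongrightarrow> \<bar>expectation (\<lambda>x. u s (shifted_path T t \<omega> b v x)) - u t \<omega> - (s - t) * generator_term b v a p q t \<omega>\<bar>"
      by (intro tendsto_intros expectation_shifted_path_tendsto[OF path_derivs_C0(1)[OF D] bp(1) t s \<omega> bO l(2)]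
          C0_approximation_tendsto[OF path_derivs_C0(1)[OF D] t \<omega> bO l(2)] generator_term_approximation_tendsto[OF D t \<omega> bO l(2)])
    ultimately show ?thesis by (intro LIMSEQ_le_const2) auto
  qed
  then show ?thesis using \<open>C \<ge> 0\<close> by blast
qed

end

section \<open>One step of the scheme\<close>

text \<open>The scheme depends on the function it is applied to only through the family \<open>E b v\<close> of its
  expectations under the laws with drift \<open>b\<close> and volatility direction \<open>v\<close>.\<close>

definition quot1 :: "('d::finite \<Rightarrow> real) \<Rightarrow> real \<Rightarrow> (real ^ 'd \<Rightarrow> real ^ 'd \<Rightarrow> real) \<Rightarrow> real ^ 'd" where
  "quot1 \<mu> h E = (\<chi> i. (E (\<mu> i *\<^sub>R axis i 1) 0 - E 0 0) / (\<mu> i * h))"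

definition quot2 :: "('d::finite \<Rightarrow> real) \<Rightarrow> real \<Rightarrow> (real ^ 'd \<Rightarrow> real ^ 'd \<Rightarrow> real) \<Rightarrow> real ^ 'd ^ 'd" where
  "quot2 \<sigma> h E = (\<chi> i j. if i = j then (E 0 (\<sigma> i *\<^sub>R axis i 1) - E 0 0) / ((\<sigma> i)\<^sup>2 * h / 2)
     else (E 0 (\<sigma> i *\<^sub>R axis i 1 + \<sigma> j *\<^sub>R axis j 1) - E 0 (\<sigma> i *\<^sub>R axis i 1) - E 0 (\<sigma> j *\<^sub>R axis j 1) + E 0 0) / (\<sigma> i * \<sigma> j * h))"

text \<open>Collects the pairs of drift and volatility at which the quotients evaluate E. The set is
  finite, so constants that depend on the pair can be summed into a single one.\<close>

definition directions :: "('d::finite \<Rightarrow> real) \<Rightarrow> ('d \<Rightarrow> real) \<Rightarrow> ((real ^ 'd) \<times> (real ^ 'd)) set" where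
  "directions \<mu> \<sigma> = {(0, 0)} \<union> range (\<lambda>i. (\<mu> i *\<^sub>R axis i 1, 0)) \<union> range (\<lambda>i. (0, \<sigma> i *\<^sub>R axis i 1)) \<union>
     range (\<lambda>(i, j). (0, \<sigma> i *\<^sub>R axis i 1 + \<sigma> j *\<^sub>R axis j 1))"

lemma finite_directions: "finite (directions \<mu> \<sigma>)"
  by (simp add: directions_def)

lemma directions_memb:
  "(0, 0) \<in> directions \<mu> \<sigma>" "(\<mu> i *\<^sub>R axis i 1, 0) \<in> directions \<mu> \<sigma>" "(0, \<sigma> i *\<^sub>R axis i 1) \<in> directions \<mu> \<sigma>"
  "(0, \<sigma> i *\<^sub>R axis i 1 + \<sigma> j *\<^sub>R axis j 1) \<in> directions \<mu> \<sigma>"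
  by (auto simp: directions_def)

lemma quot1_diff: "quot1 \<mu> h (\<lambda>b v. E b v - F b v) = quot1 \<mu> h E - quot1 \<mu> h F"
  by (simp add: quot1_def vec_eq_iff diff_divide_distrib[symmetric])

lemma quot2_diff: "quot2 \<sigma> h (\<lambda>b v. E b v - F b v) = quot2 \<sigma> h E - quot2 \<sigma> h F"
  by (simp add: quot2_def vec_eq_iff diff_divide_distrib[symmetric])

lemma quot2_Sym: "quot2 \<sigma> h E \<in> Sym"
  by (simp add: Sym_def transpose_def quot2_def vec_eq_iff add.commute mult.commute)

lemma norm_vec_le_sum: "norm (x :: 'a::real_normed_vector ^ 'n::finite) \<le> (\<Sum>i\<in>UNIV. norm (x $ i))"
  unfolding norm_vec_def by (rule L2_set_le_sum) simp

lemma norm_quot1_le: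
  assumes "\<And>i. \<mu> i > 0" "h > 0" "\<forall>(b, v)\<in>directions \<mu> \<sigma>. \<bar>E b v\<bar> \<le> e"
  shows "norm (quot1 \<mu> h E) \<le> (\<Sum>i\<in>UNIV. 2 / \<mu> i) * (e / h)"
proof -
  have "norm (quot1 \<mu> h E $ i) \<le> 2 / \<mu> i * (e / h)" for i
  proof -
    have "\<bar>E 0 0\<bar> \<le> e" "\<bar>E (\<mu> i *\<^sub>R axis i 1) 0\<bar> \<le> e"
      using assms(3) directions_memb(1,2)[where \<mu>=\<mu> and \<sigma>=\<sigma>] by fastforce+
    then have "\<bar>E (\<mu> i *\<^sub>R axis i 1) 0 - E 0 0\<bar> \<le> 2 * e" by linarith
    then have "\<bar>E (\<mu> i *\<^sub>R axis i 1) 0 - E 0 0\<bar> / (\<mu> i * h) \<le> 2 * e / (\<mu> i * h)"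
      using assms(1)[of i] assms(2) by (intro divide_right_mono) auto
    then show ?thesis using assms(1)[of i] assms(2) by (simp add: quot1_def abs_mult)
  qed
  then have "(\<Sum>i\<in>UNIV. norm (quot1 \<mu> h E $ i)) \<le> (\<Sum>i\<in>UNIV. 2 / \<mu> i * (e / h))" by (intro sum_mono) auto
  with norm_vec_le_sum show ?thesis unfolding sum_distrib_right by (rule order_trans)
qed

lemma norm_quot2_le:
  assumes "\<And>i. \<sigma> i > 0" "h > 0" "\<forall>(b, v)\<in>directions \<mu> \<sigma>. \<bar>E b v\<bar> \<le> e"
  shows "norm (quot2 \<sigma> h E) \<le> (\<Sum>i\<in>UNIV. \<Sum>j\<in>UNIV. 4 / (\<sigma> i * \<sigma> j)) * (e / h)"
proof -
  have b: "\<bar>E 0 0\<bar> \<le> e" "\<bar>E 0 (\<sigma> i *\<^sub>R axis i 1)\<bar> \<le> e" "\<bar>E 0 (\<sigma> i *\<^sub>R axis i 1 + \<sigma> j *\<^sub>R axis j 1)\<bar> \<le> e" for i j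
    using assms(3) directions_memb[where \<mu>=\<mu> and \<sigma>=\<sigma>] by fastforce+
  have "norm (quot2 \<sigma> h E $ i $ j) \<le> 4 / (\<sigma> i * \<sigma> j) * (e / h)" for i j
  proof (cases "i = j")
    case True
    have "\<bar>E 0 (\<sigma> i *\<^sub>R axis i 1) - E 0 0\<bar> \<le> 2 * e" using b(1) b(2)[of i] by linarith
    then have "\<bar>E 0 (\<sigma> i *\<^sub>R axis i 1) - E 0 0\<bar> / ((\<sigma> i)\<^sup>2 * h / 2) \<le> 2 * e / ((\<sigma> i)\<^sup>2 * h / 2)"
      using assms(1)[of i] assms(2) by (intro divide_right_mono) auto
    also have "\<dots> = 4 / (\<sigma> i * \<sigma> j) * (e / h)" using True by (simp add: power2_eq_square)
    finally have "\<bar>E 0 (\<sigma> i *\<^sub>R axis i 1) - E 0 0\<bar> / ((\<sigma> i)\<^sup>2 * h / 2) \<le> 4 / (\<sigma> i * \<sigma> j) * (e / h)" .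
    moreover have "quot2 \<sigma> h E $ i $ j = (E 0 (\<sigma> i *\<^sub>R axis i 1) - E 0 0) / ((\<sigma> i)\<^sup>2 * h / 2)"
      using True by (simp add: quot2_def)
    moreover have "0 < (\<sigma> i)\<^sup>2 * h / 2" using assms(1)[of i] assms(2) by simp
    ultimately show ?thesis by (simp only: real_norm_def abs_divide abs_of_pos)
  next
    case False
    have "\<bar>E 0 (\<sigma> i *\<^sub>R axis i 1 + \<sigma> j *\<^sub>R axis j 1) - E 0 (\<sigma> i *\<^sub>R axis i 1) - E 0 (\<sigma> j *\<^sub>R axis j 1) + E 0 0\<bar> \<le> 4 * e"
      using b(1) b(2)[of i] b(2)[of j] b(3)[of i j] by linarith
    then have "\<bar>E 0 (\<sigma> i *\<^sub>R axis i 1 + \<sigma> j *\<^sub>R axis j 1) - E 0 (\<sigma> i *\<^sub>R axis i 1) - E 0 (\<sigma> j *\<^sub>R axis j 1) + E 0 0\<bar> / (\<sigma> i * \<sigma> j * h)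
        \<le> 4 * e / (\<sigma> i * \<sigma> j * h)"
      using assms(1)[of i] assms(1)[of j] assms(2) by (intro divide_right_mono) auto
    then show ?thesis using False assms(1)[of i] assms(1)[of j] assms(2) by (simp add: quot2_def abs_mult)
  qed
  then have "(\<Sum>i\<in>UNIV. \<Sum>j\<in>UNIV. norm (quot2 \<sigma> h E $ i $ j)) \<le> (\<Sum>i\<in>UNIV. \<Sum>j\<in>UNIV. 4 / (\<sigma> i * \<sigma> j) * (e / h))"
    by (intro sum_mono)
  moreover have "norm (quot2 \<sigma> h E) \<le> (\<Sum>i\<in>UNIV. \<Sum>j\<in>UNIV. norm (quot2 \<sigma> h E $ i $ j))"
    by (rule order_trans[OF norm_vec_le_sum]) (intro sum_mono norm_vec_le_sum)
  ultimately show ?thesis unfolding sum_distrib_right by linarith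
qed

text \<open>The function F is affine in b and quadratic in v. First differences in b return p, and
  second differences in v return q by polarisation; the terms y and h a cancel in all of
  them.\<close>

lemma quot_exact:
  fixes p :: "real ^ 'd::finite" and q :: "real ^ 'd ^ 'd" and y a h :: real
  assumes "\<And>i. \<mu> i > 0" "\<And>i. \<sigma> i > 0" "h > 0" "q \<in> Sym"
  defines "F \<equiv> \<lambda>b v. y + h * (a + p \<bullet> b + 1/2 * (q \<bullet> outer v))"
  shows "quot1 \<mu> h F = p" "quot2 \<sigma> h F = q"
proof -
  have sym: "q $ i $ j = q $ j $ i" for i j
    using assms(4) unfolding Sym_def by (metis (mono_tags) mem_Collect_eq transpose_def vec_lambda_beta)
  have o1: "q \<bullet> outer (c *\<^sub>R axis i 1) = c\<^sup>2 * q $ i $ i" for c i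
    by (simp add: inner_outer axis_def power2_eq_square if_distrib[of "\<lambda>x. x * _"] if_distrib[of "\<lambda>x. _ * x"] cong: if_cong)
  \<comment> \<open>The two mixed terms of the quadratic form coincide because q is
    symmetric.\<close>
  have o2: "q \<bullet> outer (x + y) = q \<bullet> outer x + q \<bullet> outer y + 2 * (\<Sum>i\<in>UNIV. \<Sum>j\<in>UNIV. x $ i * y $ j * q $ i $ j)" for x y
  proof -
    have "(\<Sum>i\<in>UNIV. \<Sum>j\<in>UNIV. y $ i * x $ j * q $ i $ j) = (\<Sum>i\<in>UNIV. \<Sum>j\<in>UNIV. x $ i * y $ j * q $ i $ j)"
      by (subst sum.swap) (simp add: sym mult.commute)
    then show ?thesis by (simp add: inner_outer distrib_left distrib_right sum.distrib)
  qed
  have o3: "(\<Sum>k\<in>UNIV. \<Sum>m\<in>UNIV. (c *\<^sub>R axis i 1) $ k * (d *\<^sub>R axis j 1) $ m * q $ k $ m) = c * d * q $ i $ j" for c d i j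
    by (simp add: axis_def if_distrib[of "\<lambda>x. x * _"] if_distrib[of "\<lambda>x. _ * x"] cong: if_cong)
  show "quot1 \<mu> h F = p"
    unfolding quot1_def F_def using assms(1,3) by (simp add: vec_eq_iff inner_axis field_simps)
       (metis less_irrefl)
  show "quot2 \<sigma> h F = q"
  proof -
    have "quot2 \<sigma> h F $ i $ j = q $ i $ j" for i j
    proof (cases "i = j")
      case True
      have "F 0 (\<sigma> i *\<^sub>R axis i 1) - F 0 0 = (\<sigma> i)\<^sup>2 * h / 2 * q $ i $ i"
        by (simp add: F_def o1 algebra_simps)
      moreover have "(\<sigma> i)\<^sup>2 * h / 2 \<noteq> 0" using assms(2)[of i] assms(3) by simp
      ultimately show ?thesis using True by (simp add: quot2_def)
    next
      case False
      have "F 0 (\<sigma> i *\<^sub>R axis i 1 + \<sigma> j *\<^sub>R axis j 1) - F 0 (\<sigma> i *\<^sub>R axis i 1) - F 0 (\<sigma> j *\<^sub>R axis j 1) + F 0 0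
          = \<sigma> i * \<sigma> j * h * q $ i $ j"
        unfolding F_def o2 o1 o3 by (simp add: algebra_simps)
      moreover have "\<sigma> i * \<sigma> j * h \<noteq> 0" using assms(2)[of i] assms(2)[of j] assms(3) by simp
      ultimately show ?thesis using False by (simp add: quot2_def)
    qed
    then show ?thesis by (simp add: vec_eq_iff)
  qed
qed

text \<open>Under the monotonicity condition, one step of the scheme is a convex combination of the expectations.\<close>

lemma monotone_combination:
  fixes c :: "real ^ 'd::finite" and \<Gamma> :: "real ^ 'd ^ 'd"
  assumes pos: "\<And>i. \<mu> i > 0" "\<And>i. \<sigma> i > 0" "h > 0"
    and c: "\<And>i. c $ i \<ge> 0" and \<Gamma>: "\<And>i j. \<Gamma> $ i $ j \<ge> 0"
    and dom: "\<And>i. 2 * \<Gamma> $ i $ i / \<sigma> i \<ge> (\<Sum>j\<in>UNIV - {i}. (\<Gamma> $ i $ j + \<Gamma> $ j $ i) / \<sigma> j)"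
    and tot: "(\<Sum>i\<in>UNIV. c $ i / \<mu> i) + (\<Sum>i\<in>UNIV. 2 * \<Gamma> $ i $ i / (\<sigma> i)\<^sup>2)
          - (\<Sum>i\<in>UNIV. \<Sum>j\<in>UNIV - {i}. \<Gamma> $ i $ j / (\<sigma> i * \<sigma> j)) \<le> 1"
    and E: "\<forall>(b, v)\<in>directions \<mu> \<sigma>. \<bar>E b v\<bar> \<le> e"
  shows "\<bar>E 0 0 + h * (c \<bullet> quot1 \<mu> h E + \<Gamma> \<bullet> quot2 \<sigma> h E)\<bar> \<le> e"
proof -
  \<comment> \<open>The factor h cancels the h in the quotients: A, B and C are the weights of the
    mixed, pure second and first differences. A vanishes on the diagonal, so sums over j different
    from i become full double sums.\<close>
  define A where "A i j = (if i = j then 0 else \<Gamma> $ i $ j / (\<sigma> i * \<sigma> j))" for i j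
  define B where "B i = 2 * \<Gamma> $ i $ i / (\<sigma> i)\<^sup>2" for i
  define C where "C i = c $ i / \<mu> i" for i
  define e0 where "e0 = E 0 0"
  define e1 where "e1 i = E (\<mu> i *\<^sub>R axis i 1) 0" for i
  define e2 where "e2 i = E 0 (\<sigma> i *\<^sub>R axis i 1)" for i
  define e3 where "e3 i j = E 0 (\<sigma> i *\<^sub>R axis i 1 + \<sigma> j *\<^sub>R axis j 1)" for i j
  \<comment> \<open>Coefficients of e0 and e2 after collecting terms. The total-weight condition
    makes \<open>w0\<close> nonnegative, diagonal dominance makes \<open>w2\<close> nonnegative, and
    all weights add up to 1.\<close>
  define w0 where "w0 = 1 - (\<Sum>i\<in>UNIV. C i) - (\<Sum>i\<in>UNIV. B i) + (\<Sum>i\<in>UNIV. \<Sum>j\<in>UNIV. A i j)"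
  define w2 where "w2 i = B i - (\<Sum>j\<in>UNIV. A i j) - (\<Sum>j\<in>UNIV. A j i)" for i
  have offdiag: "(\<Sum>j\<in>UNIV - {i}. f j) = (\<Sum>j\<in>UNIV. if i = j then 0 else f j)" for f :: "'d \<Rightarrow> real" and i
    by (rule sum.mono_neutral_cong_left) auto
  have bound: "\<bar>e0\<bar> \<le> e" "\<bar>e1 i\<bar> \<le> e" "\<bar>e2 i\<bar> \<le> e" "\<bar>e3 i j\<bar> \<le> e" for i j
    using E directions_memb[where \<mu>=\<mu> and \<sigma>=\<sigma>] unfolding e0_def e1_def e2_def e3_def by fastforce+
  have A0: "A i j \<ge> 0" for i j using \<Gamma> pos(2)[of i] pos(2)[of j] by (simp add: A_def)
  have C0: "C i \<ge> 0" for i using c pos(1)[of i] by (simp add: C_def)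
  have "(\<Sum>i\<in>UNIV. \<Sum>j\<in>UNIV - {i}. \<Gamma> $ i $ j / (\<sigma> i * \<sigma> j)) = (\<Sum>i\<in>UNIV. \<Sum>j\<in>UNIV. A i j)"
    unfolding offdiag A_def ..
  then have w00: "w0 \<ge> 0" using tot by (simp add: w0_def C_def B_def)
  have w20: "w2 i \<ge> 0" for i
  proof -
    have "(\<Sum>j\<in>UNIV - {i}. (\<Gamma> $ i $ j + \<Gamma> $ j $ i) / \<sigma> j) / \<sigma> i \<le> 2 * \<Gamma> $ i $ i / \<sigma> i / \<sigma> i"
      using pos(2)[of i] dom[of i] by (intro divide_right_mono) auto
    also have "2 * \<Gamma> $ i $ i / \<sigma> i / \<sigma> i = B i" by (simp add: B_def power2_eq_square)
    also have "(\<Sum>j\<in>UNIV - {i}. (\<Gamma> $ i $ j + \<Gamma> $ j $ i) / \<sigma> j) / \<sigma> i = (\<Sum>j\<in>UNIV. A i j) + (\<Sum>j\<in>UNIV. A j i)"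
      unfolding offdiag sum_divide_distrib sum.distrib[symmetric]
      by (intro sum.cong) (auto simp: A_def add_divide_distrib mult.commute)
    finally show ?thesis by (simp add: w2_def)
  qed
  have "h * (c \<bullet> quot1 \<mu> h E) = (\<Sum>i\<in>UNIV. C i * (e1 i - e0))"
    unfolding inner_vec_def sum_distrib_left
    using pos(1,3) by (intro sum.cong refl) (simp add: quot1_def C_def e1_def e0_def)
  moreover have "h * (\<Gamma> \<bullet> quot2 \<sigma> h E) = (\<Sum>i\<in>UNIV. B i * (e2 i - e0)) + (\<Sum>i\<in>UNIV. \<Sum>j\<in>UNIV. A i j * (e3 i j - e2 i - e2 j + e0))"
  proof -
    have "h * (\<Gamma> $ i $ j * quot2 \<sigma> h E $ i $ j) = (if i = j then B i * (e2 i - e0) else 0) + A i j * (e3 i j - e2 i - e2 j + e0)" for i j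
      using pos(2)[of i] pos(2)[of j] pos(3)
      by (simp add: quot2_def A_def B_def e0_def e2_def e3_def)
    then have "h * (\<Gamma> \<bullet> quot2 \<sigma> h E) = (\<Sum>i\<in>UNIV. \<Sum>j\<in>UNIV. (if i = j then B i * (e2 i - e0) else 0) + A i j * (e3 i j - e2 i - e2 j + e0))"
      unfolding inner_vec_def sum_distrib_left inner_real_def by simp
    then show ?thesis by (simp add: sum.distrib)
  qed
  ultimately have "e0 + h * (c \<bullet> quot1 \<mu> h E + \<Gamma> \<bullet> quot2 \<sigma> h E) =
      e0 + (\<Sum>i\<in>UNIV. C i * (e1 i - e0)) + (\<Sum>i\<in>UNIV. B i * (e2 i - e0)) + (\<Sum>i\<in>UNIV. \<Sum>j\<in>UNIV. A i j * (e3 i j - e2 i - e2 j + e0))"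
    by (simp add: distrib_left)
  also have "\<dots> = w0 * e0 + (\<Sum>i\<in>UNIV. C i * e1 i) + (\<Sum>i\<in>UNIV. w2 i * e2 i) + (\<Sum>i\<in>UNIV. \<Sum>j\<in>UNIV. A i j * e3 i j)"
  proof -
    \<comment> \<open>Renaming the indices moves these terms to e2 i; this is the origin of the
      transposed sum of A in \<open>w2\<close>.\<close>
    have "(\<Sum>i\<in>UNIV. \<Sum>j\<in>UNIV. A i j * e2 j) = (\<Sum>i\<in>UNIV. \<Sum>j\<in>UNIV. A j i * e2 i)"
      by (rule sum.swap)
    then show ?thesis
      by (simp add: w0_def w2_def algebra_simps sum.distrib sum_subtractf sum_distrib_left sum_distrib_right)
  qed
  finally have eq: "E 0 0 + h * (c \<bullet> quot1 \<mu> h E + \<Gamma> \<bullet> quot2 \<sigma> h E) =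
     w0 * e0 + (\<Sum>i\<in>UNIV. C i * e1 i) + (\<Sum>i\<in>UNIV. w2 i * e2 i) + (\<Sum>i\<in>UNIV. \<Sum>j\<in>UNIV. A i j * e3 i j)"
    by (simp add: e0_def)
  have wt: "\<bar>w * x\<bar> \<le> w * e" if "0 \<le> w" "\<bar>x\<bar> \<le> e" for w x :: real
    using that by (simp add: abs_mult mult_left_mono)
  have "\<bar>w0 * e0\<bar> \<le> w0 * e" using wt w00 bound by blast
  moreover have "\<bar>\<Sum>i\<in>UNIV. C i * e1 i\<bar> \<le> (\<Sum>i\<in>UNIV. C i * e)"
    by (intro order_trans[OF sum_abs] sum_mono wt C0 bound)
  moreover have "\<bar>\<Sum>i\<in>UNIV. w2 i * e2 i\<bar> \<le> (\<Sum>i\<in>UNIV. w2 i * e)"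
    by (intro order_trans[OF sum_abs] sum_mono wt w20 bound)
  moreover have "\<bar>\<Sum>i\<in>UNIV. \<Sum>j\<in>UNIV. A i j * e3 i j\<bar> \<le> (\<Sum>i\<in>UNIV. \<Sum>j\<in>UNIV. A i j * e)"
    by (intro order_trans[OF sum_abs] sum_mono wt A0 bound)
  moreover have "w0 * e + (\<Sum>i\<in>UNIV. C i * e) + (\<Sum>i\<in>UNIV. w2 i * e) + (\<Sum>i\<in>UNIV. \<Sum>j\<in>UNIV. A i j * e) = e"
  proof -
    have "(\<Sum>i\<in>UNIV. \<Sum>j\<in>UNIV. A j i) = (\<Sum>i\<in>UNIV. \<Sum>j\<in>UNIV. A i j)" by (rule sum.swap)
    then have "w0 + (\<Sum>i\<in>UNIV. C i) + (\<Sum>i\<in>UNIV. w2 i) + (\<Sum>i\<in>UNIV. \<Sum>j\<in>UNIV. A i j) = 1"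
      by (simp add: w0_def w2_def sum_subtractf)
    then have "(w0 + (\<Sum>i\<in>UNIV. C i) + (\<Sum>i\<in>UNIV. w2 i) + (\<Sum>i\<in>UNIV. \<Sum>j\<in>UNIV. A i j)) * e = e" by simp
    then show ?thesis by (simp add: distrib_right sum_distrib_right)
  qed
  ultimately show ?thesis unfolding eq by linarith
qed

text \<open>The segment between the two arguments stays in the linear space of symmetric matrices,
  so differentiability within \<open>UNIV \<times> Sym\<close> gives an ordinary derivative along
  it, and the one-dimensional mean value theorem applies.\<close>

lemma gradient_mean_value:
  fixes G :: "'d::finite generator"
  assumes G: "\<And>z \<gamma>. \<gamma> \<in> Sym \<Longrightarrow> \<exists>c \<Gamma>. has_gradients G t \<omega> y z \<gamma> c \<Gamma>" and \<gamma>: "\<gamma>0 \<in> Sym" "\<gamma>1 \<in> Sym"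
  obtains z \<gamma> c \<Gamma> where "\<gamma> \<in> Sym" "has_gradients G t \<omega> y z \<gamma> c \<Gamma>"
    "G t \<omega> y z1 \<gamma>1 - G t \<omega> y z0 \<gamma>0 = c \<bullet> (z1 - z0) + \<Gamma> \<bullet> (\<gamma>1 - \<gamma>0)"
proof -
  define F where "F = (\<lambda>(z, \<gamma>). G t \<omega> y z \<gamma>)"
  define P where "P \<tau> = (z0 + \<tau> *\<^sub>R (z1 - z0), \<gamma>0 + \<tau> *\<^sub>R (\<gamma>1 - \<gamma>0))" for \<tau> :: real
  have S: "\<gamma>0 + \<tau> *\<^sub>R (\<gamma>1 - \<gamma>0) \<in> Sym" for \<tau>
  proof -
    have "\<gamma>0 $ j $ i = \<gamma>0 $ i $ j" "\<gamma>1 $ j $ i = \<gamma>1 $ i $ j" for i j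
      using \<gamma> unfolding Sym_def by (metis (mono_tags) mem_Collect_eq transpose_def vec_lambda_beta)+
    then show ?thesis by (simp add: Sym_def transpose_def vec_eq_iff)
  qed
  have "\<forall>\<tau>. \<exists>c \<Gamma>. has_gradients G t \<omega> y (fst (P \<tau>)) (snd (P \<tau>)) c \<Gamma>"
    using G[OF S] by (simp add: P_def)
  then obtain c \<Gamma> where c\<Gamma>: "\<And>\<tau>. has_gradients G t \<omega> y (fst (P \<tau>)) (snd (P \<tau>)) (c \<tau>) (\<Gamma> \<tau>)" by metis
  have "\<exists>\<tau>\<in>{0<..<1}. F (P 1) - F (P 0) = (\<lambda>d. c \<tau> \<bullet> (d *\<^sub>R (z1 - z0)) + \<Gamma> \<tau> \<bullet> (d *\<^sub>R (\<gamma>1 - \<gamma>0))) (1 - 0)"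
  proof (rule mvt_simple)
    fix \<tau> :: real
    have dP: "(P has_derivative (\<lambda>d. (d *\<^sub>R (z1 - z0), d *\<^sub>R (\<gamma>1 - \<gamma>0)))) (at \<tau> within {0..1})"
      unfolding P_def by (auto intro!: derivative_eq_intros)
    have "(F has_derivative (\<lambda>(z', \<gamma>'). c \<tau> \<bullet> z' + \<Gamma> \<tau> \<bullet> \<gamma>')) (at (P \<tau>) within UNIV \<times> Sym)"
      using c\<Gamma>[of \<tau>] by (simp add: has_gradients_def F_def)
    then have "(F has_derivative (\<lambda>(z', \<gamma>'). c \<tau> \<bullet> z' + \<Gamma> \<tau> \<bullet> \<gamma>')) (at (P \<tau>) within P ` {0..1})"
      by (rule has_derivative_subset) (use S in \<open>auto simp: P_def\<close>)
    from has_derivative_in_compose[OF dP this]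
    show "((\<lambda>\<tau>. F (P \<tau>)) has_derivative (\<lambda>d. c \<tau> \<bullet> (d *\<^sub>R (z1 - z0)) + \<Gamma> \<tau> \<bullet> (d *\<^sub>R (\<gamma>1 - \<gamma>0)))) (at \<tau> within {0..1})"
      by simp
  qed simp
  then obtain \<tau> where "F (P 1) - F (P 0) = c \<tau> \<bullet> (z1 - z0) + \<Gamma> \<tau> \<bullet> (\<gamma>1 - \<gamma>0)" by auto
  then show thesis
    using that[of "snd (P \<tau>)" "fst (P \<tau>)" "c \<tau>" "\<Gamma> \<tau>"] c\<Gamma>[of \<tau>] S[of \<tau>] by (simp add: F_def P_def)
qed

definition quotient_step :: "'d::finite generator \<Rightarrow> ('d \<Rightarrow> real) \<Rightarrow> ('d \<Rightarrow> real) \<Rightarrow> real \<Rightarrow> 'd path \<Rightarrow> real \<Rightarrow>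
    (real ^ 'd \<Rightarrow> real ^ 'd \<Rightarrow> real) \<Rightarrow> real" where
  "quotient_step G \<mu> \<sigma> t \<omega> h E = E 0 0 + h * G t \<omega> (E 0 0) (quot1 \<mu> h E) (quot2 \<sigma> h E)"

context brownian
begin

definition expectations :: "real \<Rightarrow> real \<Rightarrow> 'd::finite path \<Rightarrow> ('d path \<Rightarrow> real) \<Rightarrow> real ^ 'd \<Rightarrow> real ^ 'd \<Rightarrow> real" where
  "expectations T t \<omega> \<xi> b v = expectation (\<lambda>x. \<xi> (shifted_path T t \<omega> b v x))"

text \<open>Every law of the scheme is an image of N under an increment path; the drift laws are
  Dirac measures, obtained for v = 0, where the path does not depend on x. Measurability of \<xi>
  allows the integrals to be pulled back to N.\<close>

lemma scheme_eq_quotient_step: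
  fixes \<xi> :: "'d::finite path \<Rightarrow> real"
  assumes \<omega>: "\<omega> \<in> Omega T 0" and t: "t \<in> {0..T}" and \<xi>: "\<xi> \<in> borel_measurable (Filt T 0 T)"
  shows "scheme G \<mu> \<sigma> N W T t \<omega> h (shift_rv T 0 t \<omega> \<xi>) = quotient_step G \<mu> \<sigma> t \<omega> h (expectations T t \<omega> \<xi>)"
proof -
  define \<phi> where "\<phi> = shift_rv T 0 t \<omega> \<xi>"
  define E where "E = expectations T t \<omega> \<xi>"
  have \<phi>m: "\<phi> \<in> borel_measurable (Filt T t T)"
    unfolding \<phi>_def shift_rv_def using concat_path_measurable[OF \<omega> t] \<xi> by (rule measurable_compose)
  have E: "E b v = expectation (\<lambda>x. \<phi> (increment_path T t b v x))" for b v
    by (simp add: E_def expectations_def \<phi>_def shift_rv_def shifted_path_def)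
  have im: "increment_path T t b v \<in> measurable N (Filt T t T)" for b v :: "real ^ 'd"
    using t by (intro increment_path_measurable) auto
  obtain x0 where x0: "x0 \<in> space N" using not_empty by blast
  have det: "increment_path T t b 0 x = (\<lambda>s\<in>{t..T}. (s - t) *\<^sub>R b)" for b :: "real ^ 'd" and x
    by (simp add: increment_path_def)
  have detO: "(\<lambda>s\<in>{t..T}. (s - t) *\<^sub>R b) \<in> Omega T t" for b :: "real ^ 'd"
    using increment_path_in_Omega[OF x0, of t T b 0] t by (simp add: det)
  have drift: "(LINT \<omega>'|law_drift T t b. \<phi> \<omega>') = E b 0" for b
    unfolding E det law_drift_def using \<phi>m detO by (simp add: integral_return prob_space)
  have D0: "D0 T t \<phi> = E 0 0"
    using drift[of 0] by (simp add: D0_def law_drift_def zero_path_def)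
  have BM: "(LINT \<omega>'|law_BM N W T t v. \<phi> \<omega>') = E 0 v" for v
  proof -
    have "(\<lambda>x. \<lambda>s\<in>{t..T}. W (s - t) x *\<^sub>R v) = increment_path T t 0 v"
      by (simp add: increment_path_def fun_eq_iff)
    then show ?thesis unfolding law_BM_def E using integral_distr[OF im \<phi>m] by simp
  qed
  show ?thesis
    unfolding scheme_def quotient_step_def \<phi>_def[symmetric] E_def[symmetric]
      D1_def D2_def quot1_def quot2_def Let_def drift BM D0 ..
qed

text \<open>Both the functional and the initial path may differ, so that the same estimate serves
  the Lipschitz bound in \<omega> and the comparison of the approximation with u.\<close>

lemma expectations_le:
  assumes \<omega>: "\<omega> \<in> Omega T 0" "\<omega>' \<in> Omega T 0" and t: "t \<in> {0..T}"
    and \<xi>: "\<xi> \<in> borel_measurable (Filt T 0 T)" "\<And>\<omega>. \<omega> \<in> Omega T 0 \<Longrightarrow> \<bar>\<xi> \<omega>\<bar> \<le> B"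
    and \<eta>: "\<eta> \<in> borel_measurable (Filt T 0 T)" "\<And>\<omega>. \<omega> \<in> Omega T 0 \<Longrightarrow> \<bar>\<eta> \<omega>\<bar> \<le> B'"
    and e: "\<And>x. x \<in> space N \<Longrightarrow> \<bar>\<xi> (shifted_path T t \<omega> b v x) - \<eta> (shifted_path T t \<omega>' b v x)\<bar> \<le> e"
  shows "\<bar>expectations T t \<omega> \<xi> b v - expectations T t \<omega>' \<eta> b v\<bar> \<le> e"
proof -
  have i: "integrable N (\<lambda>x. \<xi> (shifted_path T t \<omega> b v x))"
    using measurable_compose[OF shifted_path_measurable[OF \<omega>(1) t] \<xi>(1)] \<xi>(2) shifted_path_in_Omega[OF \<omega>(1) t]
    by (intro integrable_const_bound[where B=B]) auto
  have i': "integrable N (\<lambda>x. \<eta> (shifted_path T t \<omega>' b v x))"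
    using measurable_compose[OF shifted_path_measurable[OF \<omega>(2) t] \<eta>(1)] \<eta>(2) shifted_path_in_Omega[OF \<omega>(2) t]
    by (intro integrable_const_bound[where B=B']) auto
  have "\<bar>expectations T t \<omega> \<xi> b v - expectations T t \<omega>' \<eta> b v\<bar> = \<bar>expectation (\<lambda>x. \<xi> (shifted_path T t \<omega> b v x) - \<eta> (shifted_path T t \<omega>' b v x))\<bar>"
    using i i' by (simp add: expectations_def)
  also have "\<dots> \<le> expectation (\<lambda>x. \<bar>\<xi> (shifted_path T t \<omega> b v x) - \<eta> (shifted_path T t \<omega>' b v x)\<bar>)"
    by (rule integral_abs_bound)
  also have "\<dots> \<le> e"
    using i i' e by (intro integral_le_const) auto
  finally show ?thesis .
qed

end

section \<open>Error of the scheme\<close>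

lemma grid_n [simp]: "n > 0 \<Longrightarrow> grid T n n = T"
  by (simp add: grid_def)

lemma grid_Suc: "grid T n (Suc i) = grid T n i + T / real n"
  unfolding grid_def by (simp only: of_nat_Suc distrib_right mult_1 add.commute)

lemma grid_in:
  assumes "0 < T" "i \<le> n" "n > 0"
  shows "grid T n i \<in> {0..T}"
proof -
  have "real i * (T / real n) \<le> real n * (T / real n)" using assms by (intro mult_right_mono) auto
  then show ?thesis using assms by (simp add: grid_def)
qed

lemma discrete_approximation_terminal:
  assumes "discrete_approximation G g \<mu> \<sigma> N W T n U" "\<omega> \<in> Omega T 0"
  shows "U (grid T n n) \<omega> = g \<omega>"
  using assms unfolding discrete_approximation_def by blast

text \<open>The index k counts steps back from T, which turns the backward recursion into an upward
  induction.\<close>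

lemma discrete_approximation_step:
  assumes U: "discrete_approximation G g \<mu> \<sigma> N W T n U" and \<omega>: "\<omega> \<in> Omega T 0" and "k < n" "T > 0"
  shows "U (grid T n (n - Suc k)) \<omega> = scheme G \<mu> \<sigma> N W T (grid T n (n - Suc k)) \<omega>
    (grid T n (n - k) - grid T n (n - Suc k)) (shift_rv T 0 (grid T n (n - Suc k)) \<omega> (U (grid T n (n - k))))"
proof -
  have i: "n - k \<in> {1..n}" "n - k - 1 = n - Suc k" and "n - k = Suc (n - Suc k)" using assms(3) by auto
  then have "grid T n (n - Suc k) < grid T n (n - k)" using assms(3,4) by (simp add: grid_Suc)
  then have t: "grid T n (n - Suc k) \<in> {grid T n (n - k - 1)..<grid T n (n - k)}" using i by simp
  have "\<forall>i\<in>{1..n}. \<forall>t\<in>{grid T n (i - 1)..<grid T n i}.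
        U t \<omega> = scheme G \<mu> \<sigma> N W T t \<omega> (grid T n i - t) (shift_rv T 0 t \<omega> (U (grid T n i)))"
    using U \<omega> unfolding discrete_approximation_def by blast
  from bspec[OF bspec[OF this i(1)] t] show ?thesis .
qed

text \<open>The hypotheses on G in the form the estimates consume: nonnegative Lipschitz constants,
  and dependence on the path measured by any uniform bound d on the distance of the paths.\<close>

locale monotone_scheme = brownian N W for N :: "'w measure" and W +
  fixes T :: real and G :: "'d::finite generator" and \<mu> \<sigma> :: "'d \<Rightarrow> real" and L K :: real
  assumes T: "T > 0"
    and L: "L \<ge> 0" and G_Lipschitz: "t \<in> {0..T} \<Longrightarrow> \<omega> \<in> Omega T 0 \<Longrightarrow> \<gamma> \<in> Sym \<Longrightarrow> \<gamma>' \<in> Sym \<Longrightarrow>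
        \<bar>G t \<omega> y z \<gamma> - G t \<omega> y' z' \<gamma>'\<bar> \<le> L * (\<bar>y - y'\<bar> + norm (z - z') + norm (\<gamma> - \<gamma>'))"
    and G_differentiable: "t \<in> {0..T} \<Longrightarrow> \<omega> \<in> Omega T 0 \<Longrightarrow> \<gamma> \<in> Sym \<Longrightarrow> \<exists>c \<Gamma>. has_gradients G t \<omega> y z \<gamma> c \<Gamma>"
    and G_bounded: "bounded_proc T 0 (\<lambda>t \<omega>. G t \<omega> 0 0 0)"
    and \<mu>_pos: "\<mu> i > 0" and \<sigma>_pos: "\<sigma> i > 0"
    and monotonicity: "t \<in> {0..T} \<Longrightarrow> \<omega> \<in> Omega T 0 \<Longrightarrow> \<gamma> \<in> Sym \<Longrightarrow> has_gradients G t \<omega> y z \<gamma> c \<Gamma> \<Longrightarrow>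
        (\<forall>i. c $ i \<ge> 0) \<and> (\<forall>i j. \<Gamma> $ i $ j \<ge> 0) \<and>
        (\<forall>i. 2 * \<Gamma> $ i $ i / \<sigma> i \<ge> (\<Sum>j\<in>UNIV - {i}. (\<Gamma> $ i $ j + \<Gamma> $ j $ i) / \<sigma> j)) \<and>
        (\<Sum>i\<in>UNIV. c $ i / \<mu> i) + (\<Sum>i\<in>UNIV. 2 * \<Gamma> $ i $ i / (\<sigma> i)\<^sup>2)
          - (\<Sum>i\<in>UNIV. \<Sum>j\<in>UNIV - {i}. \<Gamma> $ i $ j / (\<sigma> i * \<sigma> j)) \<le> 1"
    and K: "K \<ge> 0" and G_path: "t \<in> {0..T} \<Longrightarrow> \<omega> \<in> Omega T 0 \<Longrightarrow> \<omega>' \<in> Omega T 0 \<Longrightarrow> \<gamma> \<in> Sym \<Longrightarrow>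
        (\<And>r. r \<in> {0..T} \<Longrightarrow> norm (\<omega> r - \<omega>' r) \<le> d) \<Longrightarrow> \<bar>G t \<omega> y z \<gamma> - G t \<omega>' y z \<gamma>\<bar> \<le> K * d"
begin

definition q1 :: real where "q1 = (\<Sum>i\<in>UNIV. 2 / \<mu> i)"

definition q2 :: real where "q2 = (\<Sum>i\<in>UNIV. \<Sum>j\<in>UNIV. 4 / (\<sigma> i * \<sigma> j))"

lemma q_nonneg: "q1 \<ge> 0" "q2 \<ge> 0"
  unfolding q1_def q2_def using less_imp_le[OF \<mu>_pos] less_imp_le[OF \<sigma>_pos] by (auto intro!: sum_nonneg)

lemma quot1_close:
  assumes "h > 0" "\<forall>(b, v)\<in>directions \<mu> \<sigma>. \<bar>E b v - F b v\<bar> \<le> e"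
  shows "norm (quot1 \<mu> h E - quot1 \<mu> h F) \<le> q1 * (e / h)"
  unfolding quot1_diff[symmetric] q1_def by (rule norm_quot1_le[OF \<mu>_pos assms(1), where \<sigma>=\<sigma>]) (rule assms(2))

lemma quot2_close:
  assumes "h > 0" "\<forall>(b, v)\<in>directions \<mu> \<sigma>. \<bar>E b v - F b v\<bar> \<le> e"
  shows "norm (quot2 \<sigma> h E - quot2 \<sigma> h F) \<le> q2 * (e / h)"
  unfolding quot2_diff[symmetric] q2_def by (rule norm_quot2_le[OF \<sigma>_pos assms(1), where \<mu>=\<mu>]) (rule assms(2))

text \<open>The arguments are changed in two stages. With y frozen at F 0 0, the mean value theorem
  linearises the change of the quotients, and the monotone combination bounds it by e together with
  the leading term. Changing y afterwards costs h L e.\<close>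

lemma quotient_step_stable:
  assumes t: "t \<in> {0..T}" and \<omega>: "\<omega> \<in> Omega T 0" and h: "h > 0"
    and e: "\<forall>(b, v)\<in>directions \<mu> \<sigma>. \<bar>E b v - F b v\<bar> \<le> e"
  shows "\<bar>quotient_step G \<mu> \<sigma> t \<omega> h E - quotient_step G \<mu> \<sigma> t \<omega> h F\<bar> \<le> (1 + L * h) * e"
proof -
  define D where "D b v = E b v - F b v" for b v
  have "\<exists>c \<Gamma>. has_gradients G t \<omega> (F 0 0) z \<gamma> c \<Gamma>" if "\<gamma> \<in> Sym" for z \<gamma>
    using G_differentiable[OF t \<omega> that] .
  then obtain z \<gamma> c \<Gamma> where g: "\<gamma> \<in> Sym" "has_gradients G t \<omega> (F 0 0) z \<gamma> c \<Gamma>"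
    "G t \<omega> (F 0 0) (quot1 \<mu> h E) (quot2 \<sigma> h E) - G t \<omega> (F 0 0) (quot1 \<mu> h F) (quot2 \<sigma> h F) =
      c \<bullet> (quot1 \<mu> h E - quot1 \<mu> h F) + \<Gamma> \<bullet> (quot2 \<sigma> h E - quot2 \<sigma> h F)"
    by (rule gradient_mean_value[OF _ quot2_Sym quot2_Sym, where ?z1.0="quot1 \<mu> h E" and ?z0.0="quot1 \<mu> h F"]) auto
  note m = monotonicity[OF t \<omega> g(1,2)]
  have 1: "\<bar>D 0 0 + h * (c \<bullet> quot1 \<mu> h D + \<Gamma> \<bullet> quot2 \<sigma> h D)\<bar> \<le> e"
    using m e unfolding D_def by (intro monotone_combination[where \<mu>=\<mu> and \<sigma>=\<sigma>] \<mu>_pos \<sigma>_pos h) auto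
  have De: "\<bar>D 0 0\<bar> \<le> e" using e directions_memb(1)[of \<mu> \<sigma>] by (auto simp: D_def)
  have "\<bar>G t \<omega> (E 0 0) (quot1 \<mu> h E) (quot2 \<sigma> h E) - G t \<omega> (F 0 0) (quot1 \<mu> h E) (quot2 \<sigma> h E)\<bar> \<le> L * \<bar>D 0 0\<bar>"
    using G_Lipschitz[OF t \<omega>, of "quot2 \<sigma> h E" "quot2 \<sigma> h E" "E 0 0" "quot1 \<mu> h E" "F 0 0" "quot1 \<mu> h E"]
    by (simp add: D_def quot2_Sym)
  also have "\<dots> \<le> L * e" using De L by (rule mult_left_mono)
  finally have 2: "\<bar>h * (G t \<omega> (E 0 0) (quot1 \<mu> h E) (quot2 \<sigma> h E) - G t \<omega> (F 0 0) (quot1 \<mu> h E) (quot2 \<sigma> h E))\<bar> \<le> h * (L * e)"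
    using h by (simp add: abs_mult)
  have "quotient_step G \<mu> \<sigma> t \<omega> h E - quotient_step G \<mu> \<sigma> t \<omega> h F =
     (D 0 0 + h * (c \<bullet> quot1 \<mu> h D + \<Gamma> \<bullet> quot2 \<sigma> h D)) +
     h * (G t \<omega> (E 0 0) (quot1 \<mu> h E) (quot2 \<sigma> h E) - G t \<omega> (F 0 0) (quot1 \<mu> h E) (quot2 \<sigma> h E))"
  proof -
    have *: "c \<bullet> quot1 \<mu> h D + \<Gamma> \<bullet> quot2 \<sigma> h D =
       G t \<omega> (F 0 0) (quot1 \<mu> h E) (quot2 \<sigma> h E) - G t \<omega> (F 0 0) (quot1 \<mu> h F) (quot2 \<sigma> h F)"
      unfolding g(3) D_def quot1_diff quot2_diff ..
    show ?thesis unfolding * by (simp add: quotient_step_def D_def algebra_simps)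
  qed
  also have "\<bar>\<dots>\<bar> \<le> e + h * (L * e)" using 1 2 by linarith
  finally show ?thesis by (simp add: algebra_simps)
qed

lemma quotient_step_path_Lipschitz:
  assumes t: "t \<in> {0..T}" and \<omega>: "\<omega> \<in> Omega T 0" "\<omega>' \<in> Omega T 0" and h: "h > 0"
    and d: "\<And>r. r \<in> {0..T} \<Longrightarrow> norm (\<omega> r - \<omega>' r) \<le> d"
    and e: "\<forall>(b, v)\<in>directions \<mu> \<sigma>. \<bar>E b v - F b v\<bar> \<le> C * d"
  shows "\<bar>quotient_step G \<mu> \<sigma> t \<omega> h E - quotient_step G \<mu> \<sigma> t \<omega>' h F\<bar> \<le> ((1 + L * h) * C + h * K) * d"
proof -
  have "\<bar>quotient_step G \<mu> \<sigma> t \<omega> h E - quotient_step G \<mu> \<sigma> t \<omega> h F\<bar> \<le> (1 + L * h) * (C * d)"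
    by (rule quotient_step_stable[OF t \<omega>(1) h e])
  moreover have "\<bar>quotient_step G \<mu> \<sigma> t \<omega> h F - quotient_step G \<mu> \<sigma> t \<omega>' h F\<bar> \<le> h * (K * d)"
    using G_path[OF t \<omega> quot2_Sym d] h
    by (simp add: quotient_step_def right_diff_distrib[symmetric] abs_mult)
  ultimately show ?thesis by (simp add: algebra_simps)
qed

lemma quotient_step_bounded:
  assumes h: "h > 0"
  shows "\<exists>B'. \<forall>t\<in>{0..T}. \<forall>\<omega>\<in>Omega T 0. \<forall>E. (\<forall>(b, v)\<in>directions \<mu> \<sigma>. \<bar>E b v\<bar> \<le> B) \<longrightarrow> \<bar>quotient_step G \<mu> \<sigma> t \<omega> h E\<bar> \<le> B'"
proof -
  obtain C where C: "\<And>t \<omega>. t \<in> {0..T} \<Longrightarrow> \<omega> \<in> Omega T 0 \<Longrightarrow> norm (G t \<omega> 0 0 0) \<le> C"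
    using bounded_procD[OF G_bounded] by blast
  have "\<bar>quotient_step G \<mu> \<sigma> t \<omega> h E\<bar> \<le> (1 + L * h) * B + h * C"
    if t: "t \<in> {0..T}" and \<omega>: "\<omega> \<in> Omega T 0" and E: "\<forall>(b, v)\<in>directions \<mu> \<sigma>. \<bar>E b v\<bar> \<le> B" for t \<omega> E
  proof -
    have z: "quot1 \<mu> h (\<lambda>b v. 0) = 0" "quot2 \<sigma> h (\<lambda>b v. 0) = 0"
      by (simp_all add: quot1_def quot2_def vec_eq_iff)
    have "\<bar>quotient_step G \<mu> \<sigma> t \<omega> h E - quotient_step G \<mu> \<sigma> t \<omega> h (\<lambda>b v. 0)\<bar> \<le> (1 + L * h) * B"
      using E by (intro quotient_step_stable t \<omega> h) simp
    moreover have "\<bar>quotient_step G \<mu> \<sigma> t \<omega> h (\<lambda>b v. 0)\<bar> \<le> h * C"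
      using C[OF t \<omega>] h by (simp add: quotient_step_def z abs_mult)
    ultimately show ?thesis by linarith
  qed
  then show ?thesis by blast
qed

text \<open>Measurability, boundedness and the Lipschitz property have to be carried together: the
  first two make the expectations of the next step meaningful and linear, and its Lipschitz estimate
  in turn yields its measurability. The constants may grow with the number of steps, as only their
  existence matters.\<close>

lemma discrete_approximation_regular:
  fixes g :: "'d path \<Rightarrow> real"
  assumes n: "n > 0" and U: "discrete_approximation G g \<mu> \<sigma> N W T n U"
    and g_bounded: "\<And>\<omega>. \<omega> \<in> Omega T 0 \<Longrightarrow> \<bar>g \<omega>\<bar> \<le> Bg"
    and g_Lipschitz: "\<And>\<omega> \<omega>'. \<omega> \<in> Omega T 0 \<Longrightarrow> \<omega>' \<in> Omega T 0 \<Longrightarrow> \<bar>g \<omega> - g \<omega>'\<bar> \<le> Cg * path_norm 0 T (\<lambda>r. \<omega> r - \<omega>' r)"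
    and k: "k \<le> n"
  shows "U (grid T n (n - k)) \<in> borel_measurable (Filt T 0 T) \<and>
    (\<exists>B. \<forall>\<omega>\<in>Omega T 0. \<bar>U (grid T n (n - k)) \<omega>\<bar> \<le> B)"
proof -
  define \<xi> where "\<xi> k = U (grid T n (n - k))" for k
  define h where "h = T / real n"
  have h: "h > 0" using T n by (simp add: h_def)
  have "\<xi> k \<in> borel_measurable (Filt T 0 T) \<and> (\<exists>B. \<forall>\<omega>\<in>Omega T 0. \<bar>\<xi> k \<omega>\<bar> \<le> B) \<and>
    (\<exists>C. \<forall>\<omega>\<in>Omega T 0. \<forall>\<omega>'\<in>Omega T 0. \<bar>\<xi> k \<omega> - \<xi> k \<omega>'\<bar> \<le> C * path_norm 0 T (\<lambda>r. \<omega> r - \<omega>' r))"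
    using k
  proof (induction k)
    case 0
    have "\<xi> 0 \<omega> = g \<omega>" if "\<omega> \<in> Omega T 0" for \<omega>
      using discrete_approximation_terminal[OF U that] by (simp add: \<xi>_def)
    then have L0: "\<bar>\<xi> 0 \<omega> - \<xi> 0 \<omega>'\<bar> \<le> Cg * path_norm 0 T (\<lambda>r. \<omega> r - \<omega>' r)" and B0: "\<bar>\<xi> 0 \<omega>\<bar> \<le> Bg"
      if "\<omega> \<in> Omega T 0" "\<omega>' \<in> Omega T 0" for \<omega> \<omega>'
      using g_Lipschitz g_bounded that by auto
    then show ?case
      using Lipschitz_imp_Filt_measurable[OF T L0] by (intro conjI exI[of _ Bg] exI[of _ Cg] ballI)
  next
    case (Suc k)
    then have "\<xi> k \<in> borel_measurable (Filt T 0 T) \<and> (\<exists>B. \<forall>\<omega>\<in>Omega T 0. \<bar>\<xi> k \<omega>\<bar> \<le> B) \<and>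
      (\<exists>C. \<forall>\<omega>\<in>Omega T 0. \<forall>\<omega>'\<in>Omega T 0. \<bar>\<xi> k \<omega> - \<xi> k \<omega>'\<bar> \<le> C * path_norm 0 T (\<lambda>r. \<omega> r - \<omega>' r))"
      by simp
    then obtain B C where \<xi>m: "\<xi> k \<in> borel_measurable (Filt T 0 T)" and B: "\<And>\<omega>. \<omega> \<in> Omega T 0 \<Longrightarrow> \<bar>\<xi> k \<omega>\<bar> \<le> B"
      and C: "\<And>\<omega> \<omega>'. \<omega> \<in> Omega T 0 \<Longrightarrow> \<omega>' \<in> Omega T 0 \<Longrightarrow> \<bar>\<xi> k \<omega> - \<xi> k \<omega>'\<bar> \<le> C * path_norm 0 T (\<lambda>r. \<omega> r - \<omega>' r)"
      by blast
    define t where "t = grid T n (n - Suc k)"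
    have i: "n - k = Suc (n - Suc k)" using Suc.prems by simp
    have t: "t \<in> {0..T}" unfolding t_def using T n by (intro grid_in) auto
    have next_t: "grid T n (n - k) = t + h" unfolding i grid_Suc t_def h_def ..
    have step: "\<xi> (Suc k) \<omega> = quotient_step G \<mu> \<sigma> t \<omega> h (expectations T t \<omega> (\<xi> k))" if \<omega>: "\<omega> \<in> Omega T 0" for \<omega>
    proof -
      have "U t \<omega> = scheme G \<mu> \<sigma> N W T t \<omega> (grid T n (n - k) - t) (shift_rv T 0 t \<omega> (U (grid T n (n - k))))"
        unfolding t_def using Suc.prems by (intro discrete_approximation_step[OF U \<omega> _ T]) simp
      then show ?thesis
        using scheme_eq_quotient_step[OF \<omega> t \<xi>m] next_t by (simp add: \<xi>_def t_def)
    qed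
    have "\<bar>\<xi> (Suc k) \<omega> - \<xi> (Suc k) \<omega>'\<bar> \<le> ((1 + L * h) * \<bar>C\<bar> + h * K) * path_norm 0 T (\<lambda>r. \<omega> r - \<omega>' r)"
      if \<omega>: "\<omega> \<in> Omega T 0" "\<omega>' \<in> Omega T 0" for \<omega> \<omega>'
    proof -
      define d where "d = path_norm 0 T (\<lambda>r. \<omega> r - \<omega>' r)"
      have d: "norm (\<omega> r - \<omega>' r) \<le> d" if "r \<in> {0..T}" for r
        unfolding d_def using that OmegaD(2)[OF \<omega>(1)] OmegaD(2)[OF \<omega>(2)]
        by (intro norm_le_path_norm[where \<omega>="\<lambda>r. \<omega> r - \<omega>' r"] continuous_on_diff)
      have "\<bar>expectations T t \<omega> (\<xi> k) b v - expectations T t \<omega>' (\<xi> k) b v\<bar> \<le> \<bar>C\<bar> * d" for b v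
      proof (rule expectations_le[OF \<omega> t \<xi>m B \<xi>m B])
        fix x assume x: "x \<in> space N"
        have pn: "path_norm 0 T (\<lambda>r. shifted_path T t \<omega> b v x r - shifted_path T t \<omega>' b v x r) \<le> d"
          using T t d by (intro path_norm_leI shifted_path_close) auto
        have so: "shifted_path T t \<omega> b v x \<in> Omega T 0" "shifted_path T t \<omega>' b v x \<in> Omega T 0"
          using shifted_path_in_Omega[OF \<omega>(1) t x] shifted_path_in_Omega[OF \<omega>(2) t x] by auto
        have "0 \<le> path_norm 0 T (\<lambda>r. shifted_path T t \<omega> b v x r - shifted_path T t \<omega>' b v x r)"
          using T OmegaD(2)[OF so(1)] OmegaD(2)[OF so(2)]
          by (intro order_trans[OF norm_ge_zero norm_le_path_norm[where r=0]] continuous_on_diff) auto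
        then have "C * path_norm 0 T (\<lambda>r. shifted_path T t \<omega> b v x r - shifted_path T t \<omega>' b v x r) \<le> \<bar>C\<bar> * d"
          using pn by (intro mult_mono) auto
        then show "\<bar>\<xi> k (shifted_path T t \<omega> b v x) - \<xi> k (shifted_path T t \<omega>' b v x)\<bar> \<le> \<bar>C\<bar> * d"
          using C[OF so] by linarith
      qed
      then show ?thesis
        unfolding step[OF \<omega>(1)] step[OF \<omega>(2)] d_def[symmetric]
        by (intro quotient_step_path_Lipschitz[OF t \<omega> h d]) auto
    qed
    note Lip = this
    obtain B' where B': "\<And>t \<omega> E. t \<in> {0..T} \<Longrightarrow> \<omega> \<in> Omega T 0 \<Longrightarrow> (\<forall>(b, v)\<in>directions \<mu> \<sigma>. \<bar>E b v\<bar> \<le> B) \<Longrightarrow>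
        \<bar>quotient_step G \<mu> \<sigma> t \<omega> h E\<bar> \<le> B'"
      using quotient_step_bounded[OF h, of B] by blast
    have "\<bar>\<xi> (Suc k) \<omega>\<bar> \<le> B'" if \<omega>: "\<omega> \<in> Omega T 0" for \<omega>
    proof -
      \<comment> \<open>Comparison with the zero functional turns the estimate for differences into
        a bound.\<close>
      have "\<bar>expectations T t \<omega> (\<xi> k) b v\<bar> \<le> B" for b v
        using expectations_le[OF \<omega> \<omega> t \<xi>m B, of "\<lambda>_. 0" 0 b v B] shifted_path_in_Omega[OF \<omega> t] B
        by (simp add: expectations_def)
      then show ?thesis unfolding step[OF \<omega>] by (intro B' t \<omega>) auto
    qed
    then show ?case
      using Lipschitz_imp_Filt_measurable[OF T Lip] Lip
      by (intro conjI exI[of _ B'] exI[of _ "(1 + L * h) * \<bar>C\<bar> + h * K"] ballI)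
  qed
  then show ?thesis by (auto simp: \<xi>_def)
qed

text \<open>The expectations are within C h^2 of F, on which the quotients are exact. The arguments
  of G are therefore off by O(h), and G enters multiplied by h.\<close>

lemma local_consistency:
  fixes u :: "('d, real) process"
  assumes C12: "C12b_derivs T 0 u a p q" and a: "a \<in> C12b T 0"
    and p: "\<And>i. (\<lambda>s \<omega>. p s \<omega> $ i) \<in> C12b T 0" and q: "\<And>i j. (\<lambda>s \<omega>. q s \<omega> $ i $ j) \<in> C12b T 0"
    and eq: "\<And>t \<omega>. t \<in> {0..<T} \<Longrightarrow> \<omega> \<in> Omega T 0 \<Longrightarrow> a t \<omega> + G t \<omega> (u t \<omega>) (p t \<omega>) (q t \<omega>) = 0"
  shows "\<exists>C\<ge>0. \<forall>t\<in>{0..<T}. \<forall>s\<in>{t<..T}. \<forall>\<omega>\<in>Omega T 0.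
    \<bar>quotient_step G \<mu> \<sigma> t \<omega> (s - t) (expectations T t \<omega> (u s)) - u t \<omega>\<bar> \<le> C * (s - t)\<^sup>2"
proof -
  have D: "path_derivs T 0 u a p q" and ba: "bounded_proc T 0 a" using C12 by (auto simp: C12b_derivs_def)
  obtain Ba where Ba: "Ba \<ge> 0" "\<And>s \<omega>. s \<in> {0..T} \<Longrightarrow> \<omega> \<in> Omega T 0 \<Longrightarrow> norm (a s \<omega>) \<le> Ba"
    using bounded_procD[OF ba] by blast
  have "\<forall>bv. \<exists>C\<ge>0. \<forall>t\<in>{0..T}. \<forall>s\<in>{t..T}. \<forall>\<omega>\<in>Omega T 0.
    \<bar>expectation (\<lambda>x. u s (shifted_path T t \<omega> (fst bv) (snd bv) x)) - u t \<omega> - (s - t) * generator_term (fst bv) (snd bv) a p q t \<omega>\<bar> \<le> C * (s - t)\<^sup>2"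
    using C24b_rate[OF T C12 a p q] by blast
  from choice[OF this] obtain R where R: "\<And>bv. R bv \<ge> 0"
    "\<And>bv t s \<omega>. t \<in> {0..T} \<Longrightarrow> s \<in> {t..T} \<Longrightarrow> \<omega> \<in> Omega T 0 \<Longrightarrow>
    \<bar>expectation (\<lambda>x. u s (shifted_path T t \<omega> (fst bv) (snd bv) x)) - u t \<omega> - (s - t) * generator_term (fst bv) (snd bv) a p q t \<omega>\<bar> \<le> R bv * (s - t)\<^sup>2"
    by blast
  \<comment> \<open>A bound for all relevant pairs at once: the sum of finitely many nonnegative
    constants dominates each of them.\<close>
  define C where "C = (\<Sum>bv\<in>directions \<mu> \<sigma>. R bv)"
  have C: "C \<ge> 0" "\<And>bv. bv \<in> directions \<mu> \<sigma> \<Longrightarrow> R bv \<le> C"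
    unfolding C_def by (intro sum_nonneg R(1)) (intro member_le_sum finite_directions R(1))
  \<comment> \<open>The first C is the error of the leading expectation. The bracket collects the
    deviations of the arguments of G per unit h: Ba + C T for y, where C h^2 \<le> C T h is used,
    and q1 C, q2 C for the quotients.\<close>
  define C' where "C' = C + L * (Ba + C * T + q1 * C + q2 * C)"
  have "C' \<ge> 0" using C Ba L T q_nonneg by (simp add: C'_def)
  moreover have "\<bar>quotient_step G \<mu> \<sigma> t \<omega> (s - t) (expectations T t \<omega> (u s)) - u t \<omega>\<bar> \<le> C' * (s - t)\<^sup>2"
    if t: "t \<in> {0..<T}" and s: "s \<in> {t<..T}" and \<omega>: "\<omega> \<in> Omega T 0" for t s \<omega>
  proof -
    define h where "h = s - t"
    have h: "h > 0" "h \<le> T" using s t by (auto simp: h_def)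
    have t': "t \<in> {0..T}" and s': "s \<in> {t..T}" using t s by auto
    define E where "E = expectations T t \<omega> (u s)"
    define F where "F b v = u t \<omega> + h * (a t \<omega> + p t \<omega> \<bullet> b + 1/2 * (q t \<omega> \<bullet> outer v))" for b v
    have qS: "q t \<omega> \<in> Sym" using D t' \<omega> by (auto simp: path_derivs_def Lambda_def)
    have EF: "\<forall>(b, v)\<in>directions \<mu> \<sigma>. \<bar>E b v - F b v\<bar> \<le> C * h\<^sup>2"
    proof safe
      fix b v assume bv: "(b, v) \<in> directions \<mu> \<sigma>"
      have "\<bar>E b v - F b v\<bar> \<le> R (b, v) * h\<^sup>2"
        using R(2)[OF t' s' \<omega>, of "(b, v)"] by (simp add: E_def F_def expectations_def generator_term_def h_def algebra_simps)
      also have "\<dots> \<le> C * h\<^sup>2" using C(2)[OF bv] by (intro mult_right_mono) auto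
      finally show "\<bar>E b v - F b v\<bar> \<le> C * h\<^sup>2" .
    qed
    have ex: "quot1 \<mu> h F = p t \<omega>" "quot2 \<sigma> h F = q t \<omega>"
      unfolding F_def using quot_exact[OF \<mu>_pos \<sigma>_pos h(1) qS] by auto
    have hh: "C * h\<^sup>2 / h = C * h" using h(1) by (simp add: power2_eq_square)
    have n1: "norm (quot1 \<mu> h E - p t \<omega>) \<le> q1 * (C * h)" and n2: "norm (quot2 \<sigma> h E - q t \<omega>) \<le> q2 * (C * h)"
      using quot1_close[OF h(1) EF] quot2_close[OF h(1) EF] by (auto simp: ex hh)
    have E0: "\<bar>E 0 0 - (u t \<omega> + h * a t \<omega>)\<bar> \<le> C * h\<^sup>2"
      using EF directions_memb(1)[of \<mu> \<sigma>] by (force simp: F_def)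
    have "C * h\<^sup>2 \<le> C * T * h" using h C(1) by (simp add: power2_eq_square mult_left_mono mult_right_mono mult.assoc)
    moreover have "\<bar>h * a t \<omega>\<bar> \<le> Ba * h" using Ba(2)[OF t' \<omega>] h(1) by (simp add: abs_mult mult.commute)
    ultimately have E0': "\<bar>E 0 0 - u t \<omega>\<bar> \<le> (Ba + C * T) * h" using E0 by (simp add: distrib_right)
    have "\<bar>G t \<omega> (E 0 0) (quot1 \<mu> h E) (quot2 \<sigma> h E) - G t \<omega> (u t \<omega>) (p t \<omega>) (q t \<omega>)\<bar> \<le>
        L * (\<bar>E 0 0 - u t \<omega>\<bar> + norm (quot1 \<mu> h E - p t \<omega>) + norm (quot2 \<sigma> h E - q t \<omega>))"
      by (rule G_Lipschitz[OF t' \<omega> quot2_Sym qS])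
    also have "\<dots> \<le> L * ((Ba + C * T) * h + q1 * (C * h) + q2 * (C * h))"
      using E0' n1 n2 L by (intro mult_left_mono add_mono) auto
    also have "\<dots> = L * (Ba + C * T + q1 * C + q2 * C) * h" by (simp add: algebra_simps)
    finally have GG: "\<bar>G t \<omega> (E 0 0) (quot1 \<mu> h E) (quot2 \<sigma> h E) - G t \<omega> (u t \<omega>) (p t \<omega>) (q t \<omega>)\<bar> * h \<le> L * (Ba + C * T + q1 * C + q2 * C) * h * h"
      using h(1) by (intro mult_right_mono) auto
    \<comment> \<open>By the equation G at the exact derivatives equals -a, so the term h a of the
      expansion cancels and two small differences remain.\<close>
    have "quotient_step G \<mu> \<sigma> t \<omega> h E - u t \<omega> = (E 0 0 - (u t \<omega> + h * a t \<omega>)) +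
        (G t \<omega> (E 0 0) (quot1 \<mu> h E) (quot2 \<sigma> h E) - G t \<omega> (u t \<omega>) (p t \<omega>) (q t \<omega>)) * h"
    proof -
      have "G t \<omega> (u t \<omega>) (p t \<omega>) (q t \<omega>) = - a t \<omega>" using eq[OF t \<omega>] by simp
      then show ?thesis by (simp add: quotient_step_def algebra_simps)
    qed
    also have "\<bar>\<dots>\<bar> \<le> C * h\<^sup>2 + L * (Ba + C * T + q1 * C + q2 * C) * h * h"
    proof -
      have "\<bar>(G t \<omega> (E 0 0) (quot1 \<mu> h E) (quot2 \<sigma> h E) - G t \<omega> (u t \<omega>) (p t \<omega>) (q t \<omega>)) * h\<bar> \<le> L * (Ba + C * T + q1 * C + q2 * C) * h * h"
        using GG h(1) by (simp add: abs_mult)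
      then show ?thesis using E0 by linarith
    qed
    also have "\<dots> = C' * h\<^sup>2" by (simp add: C'_def power2_eq_square algebra_simps)
    finally show ?thesis by (simp add: h_def E_def)
  qed
  ultimately show ?thesis by (intro exI[of _ C'] conjI ballI)
qed

text \<open>Stability and consistency give e' \<le> (1 + L h) e + C h^2 for consecutive errors.
  Measurability of the approximation is required to write its step as a \<open>quotient_step\<close>
  of expectations under N.\<close>

lemma discrete_approximation_error:
  fixes u :: "('d, real) process" and g :: "'d path \<Rightarrow> real"
  assumes u: "u \<in> C0 T 0" and Bu: "\<And>s \<omega>. s \<in> {0..T} \<Longrightarrow> \<omega> \<in> Omega T 0 \<Longrightarrow> norm (u s \<omega>) \<le> Bu" and uT: "\<And>\<omega>. \<omega> \<in> Omega T 0 \<Longrightarrow> u T \<omega> = g \<omega>"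
    and C: "C \<ge> 0" "\<And>t s \<omega>. t \<in> {0..<T} \<Longrightarrow> s \<in> {t<..T} \<Longrightarrow> \<omega> \<in> Omega T 0 \<Longrightarrow>
      \<bar>quotient_step G \<mu> \<sigma> t \<omega> (s - t) (expectations T t \<omega> (u s)) - u t \<omega>\<bar> \<le> C * (s - t)\<^sup>2"
    and n: "n > 0" and U: "discrete_approximation G g \<mu> \<sigma> N W T n U"
    and g_bounded: "\<And>\<omega>. \<omega> \<in> Omega T 0 \<Longrightarrow> \<bar>g \<omega>\<bar> \<le> Bg"
    and g_Lipschitz: "\<And>\<omega> \<omega>'. \<omega> \<in> Omega T 0 \<Longrightarrow> \<omega>' \<in> Omega T 0 \<Longrightarrow> \<bar>g \<omega> - g \<omega>'\<bar> \<le> Cg * path_norm 0 T (\<lambda>r. \<omega> r - \<omega>' r)"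
    and i: "i \<le> n" and \<omega>: "\<omega> \<in> Omega T 0"
  shows "\<bar>U (grid T n i) \<omega> - u (grid T n i) \<omega>\<bar> \<le> C * T * exp (L * T) * (T / real n)"
proof -
  define h where "h = T / real n"
  have h: "h > 0" "real n * h = T" using T n by (auto simp: h_def)
  \<comment> \<open>A closed form that dominates the recursion: k local errors, each amplified by
    the full power of 1 + L h.\<close>
  have err: "\<bar>U (grid T n (n - k)) \<omega> - u (grid T n (n - k)) \<omega>\<bar> \<le> C * h\<^sup>2 * real k * (1 + L * h) ^ k"
    if "k \<le> n" "\<omega> \<in> Omega T 0" for k \<omega>
    using that
  proof (induction k arbitrary: \<omega>)
    case 0
    then show ?case using discrete_approximation_terminal[OF U 0(2)] uT[OF 0(2)] n by simp
  next
    case (Suc k)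
    define t where "t = grid T n (n - Suc k)"
    define s where "s = grid T n (n - k)"
    define e where "e = C * h\<^sup>2 * real k * (1 + L * h) ^ k"
    have i: "n - k = Suc (n - Suc k)" using Suc.prems by simp
    have st: "s = t + h" unfolding s_def i grid_Suc t_def h_def ..
    have s0: "s \<in> {0..T}" unfolding s_def using T n by (intro grid_in) auto
    have t0: "t \<in> {0..T}" unfolding t_def using T n by (intro grid_in) auto
    have ts: "t \<in> {0..<T}" "s \<in> {t<..T}" using s0 t0 st h by auto
    have IH: "\<bar>U s \<omega> - u s \<omega>\<bar> \<le> e" if "\<omega> \<in> Omega T 0" for \<omega>
      unfolding s_def e_def using Suc that by simp
    have "U s \<in> borel_measurable (Filt T 0 T) \<and> (\<exists>B. \<forall>\<omega>\<in>Omega T 0. \<bar>U s \<omega>\<bar> \<le> B)"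
      unfolding s_def by (rule discrete_approximation_regular[OF n U g_bounded g_Lipschitz]) (use Suc.prems(1) in simp_all)
    then obtain BU where Um: "U s \<in> borel_measurable (Filt T 0 T)" and BU: "\<And>\<omega>. \<omega> \<in> Omega T 0 \<Longrightarrow> \<bar>U s \<omega>\<bar> \<le> BU"
      by blast
    have um: "u s \<in> borel_measurable (Filt T 0 T)" by (rule C0_measurable(2)[OF u s0])
    have "U t \<omega> = scheme G \<mu> \<sigma> N W T t \<omega> (s - t) (shift_rv T 0 t \<omega> (U s))"
      unfolding t_def s_def using Suc.prems(1) by (intro discrete_approximation_step[OF U Suc.prems(2) _ T]) simp
    then have Ut: "U t \<omega> = quotient_step G \<mu> \<sigma> t \<omega> h (expectations T t \<omega> (U s))"
      using scheme_eq_quotient_step[OF Suc.prems(2) t0 Um] st by simp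
    have "\<bar>expectations T t \<omega> (U s) b v - expectations T t \<omega> (u s) b v\<bar> \<le> e" for b v
    proof (rule expectations_le[OF Suc.prems(2) Suc.prems(2) t0 Um BU um])
      show "\<bar>u s \<omega>\<bar> \<le> Bu" if "\<omega> \<in> Omega T 0" for \<omega> using Bu[OF s0 that] by simp
      show "\<bar>U s (shifted_path T t \<omega> b v x) - u s (shifted_path T t \<omega> b v x)\<bar> \<le> e" if "x \<in> space N" for x
        by (intro IH shifted_path_in_Omega Suc.prems(2) t0 that)
    qed
    then have "\<bar>U t \<omega> - quotient_step G \<mu> \<sigma> t \<omega> h (expectations T t \<omega> (u s))\<bar> \<le> (1 + L * h) * e"
      unfolding Ut by (intro quotient_step_stable t0 Suc.prems(2) h) auto
    moreover have "\<bar>quotient_step G \<mu> \<sigma> t \<omega> h (expectations T t \<omega> (u s)) - u t \<omega>\<bar> \<le> C * h\<^sup>2"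
      using C(2)[OF ts Suc.prems(2)] st by simp
    ultimately have "\<bar>U t \<omega> - u t \<omega>\<bar> \<le> (1 + L * h) * e + C * h\<^sup>2" by linarith
    \<comment> \<open>The new local error is enlarged by a power that is at least 1, so that it
      merges with the k earlier ones.\<close>
    also have "\<dots> \<le> (1 + L * h) * e + C * h\<^sup>2 * (1 + L * h) ^ Suc k"
    proof -
      have "1 \<le> (1 + L * h) ^ Suc k" using L h by (intro one_le_power) auto
      then have "C * h\<^sup>2 * 1 \<le> C * h\<^sup>2 * (1 + L * h) ^ Suc k" using C(1) by (intro mult_left_mono) auto
      then show ?thesis by simp
    qed
    also have "\<dots> = C * h\<^sup>2 * real (Suc k) * (1 + L * h) ^ Suc k"
      by (simp add: e_def algebra_simps)
    finally show ?case by (simp add: t_def)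
  qed
  have "\<bar>U (grid T n i) \<omega> - u (grid T n i) \<omega>\<bar> \<le> C * h\<^sup>2 * real (n - i) * (1 + L * h) ^ (n - i)"
    using err[of "n - i" \<omega>] i \<omega> by simp
  also have "\<dots> \<le> C * h\<^sup>2 * real n * (1 + L * h) ^ n"
  proof (rule mult_mono)
    show "C * h\<^sup>2 * real (n - i) \<le> C * h\<^sup>2 * real n" using C(1) by (intro mult_left_mono) auto
    show "(1 + L * h) ^ (n - i) \<le> (1 + L * h) ^ n" using L h by (intro power_increasing) auto
  qed (use C(1) L h in simp_all)
  \<comment> \<open>From 1 + x \<le> exp x and n h = T. The number n of steps then absorbs one
    factor of h^2, and a single h is left.\<close>
  also have "\<dots> \<le> C * h\<^sup>2 * real n * exp (L * T)"
  proof (rule mult_left_mono)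
    have "(1 + L * h) ^ n \<le> exp (L * h) ^ n"
      using L h exp_ge_add_one_self[of "L * h"] by (intro power_mono) auto
    also have "\<dots> = exp (L * T)" using h(2) by (simp add: exp_of_nat_mult[symmetric] mult.commute mult.left_commute)
    finally show "(1 + L * h) ^ n \<le> exp (L * T)" .
  qed (use C(1) in simp)
  also have "\<dots> = C * (real n * h) * exp (L * T) * h" by (simp add: power2_eq_square)
  finally show ?thesis unfolding h(2) by (simp add: h_def)
qed

end

theorem theorem5p2:
  fixes T :: real
    and G :: "'d::finite generator"
    and g :: "'d path \<Rightarrow> real"
    and \<mu> \<sigma> :: "'d \<Rightarrow> real"
    and N :: "'w measure"
    and W :: "real \<Rightarrow> 'w \<Rightarrow> real"
    and u :: "('d, real) process"
    and uh :: "nat \<Rightarrow> ('d, real) process"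
    and \<epsilon>\<^sub>0 :: real
  assumes T_pos: "T > 0"
    and G_bounded: "bounded_proc T 0 (\<lambda>t \<omega>. G t \<omega> 0 0 0)"
    and g_bounded: "\<exists>C. \<forall>\<omega>\<in>Omega T 0. \<bar>g \<omega>\<bar> \<le> C"
    and G_continuous: "\<forall>y z. \<forall>\<gamma>\<in>Sym. continuous_proc T 0 (\<lambda>t \<omega>. G t \<omega> y z \<gamma>)"
    and G_Lipschitz: "\<exists>C. \<forall>(t, \<omega>)\<in>Lambda T 0. \<forall>y y' z z'. \<forall>\<gamma>\<in>Sym. \<forall>\<gamma>'\<in>Sym.
        \<bar>G t \<omega> y z \<gamma> - G t \<omega> y' z' \<gamma>'\<bar> \<le> C * (\<bar>y - y'\<bar> + norm (z - z') + norm (\<gamma> - \<gamma>'))"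
    and g_uniformly_continuous: "\<forall>\<epsilon>>0. \<exists>\<delta>>0. \<forall>\<omega>\<in>Omega T 0. \<forall>\<omega>'\<in>Omega T 0.
        path_norm 0 T (\<lambda>r. \<omega> r - \<omega>' r) < \<delta> \<longrightarrow> \<bar>g \<omega> - g \<omega>'\<bar> < \<epsilon>"
    and G_mono: "\<forall>(t, \<omega>)\<in>Lambda T 0. \<forall>y z. \<forall>\<gamma>\<in>Sym. \<forall>\<gamma>'\<in>Sym.
        psd (\<gamma>' - \<gamma>) \<longrightarrow> G t \<omega> y z \<gamma> \<le> G t \<omega> y z \<gamma>'"
    and comparison: "comparison_principle T G g"
    and G_differentiable: "\<forall>(t, \<omega>)\<in>Lambda T 0. \<forall>y z. \<forall>\<gamma>\<in>Sym. \<exists>c \<Gamma>. has_gradients G t \<omega> y z \<gamma> c \<Gamma>"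
    and \<mu>_pos: "\<forall>i. \<mu> i > 0"
    and \<sigma>_pos: "\<forall>i. \<sigma> i > 0"
    and \<epsilon>\<^sub>0: "0 < \<epsilon>\<^sub>0" "\<epsilon>\<^sub>0 < 1"
    and monotonicity: "\<forall>(t, \<omega>)\<in>Lambda T 0. \<forall>y z. \<forall>\<gamma>\<in>Sym. \<forall>c \<Gamma>. has_gradients G t \<omega> y z \<gamma> c \<Gamma> \<longrightarrow>
        (\<forall>i. c $ i \<ge> 0) \<and> (\<forall>i j. \<Gamma> $ i $ j \<ge> 0) \<and>
        (\<forall>i. 2 * \<Gamma> $ i $ i / \<sigma> i \<ge> (\<Sum>j\<in>UNIV - {i}. (\<Gamma> $ i $ j + \<Gamma> $ j $ i) / \<sigma> j)) \<and>
        (\<Sum>i\<in>UNIV. c $ i / \<mu> i) + (\<Sum>i\<in>UNIV. 2 * \<Gamma> $ i $ i / (\<sigma> i)\<^sup>2)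
          - (\<Sum>i\<in>UNIV. \<Sum>j\<in>UNIV - {i}. \<Gamma> $ i $ j / (\<sigma> i * \<sigma> j)) \<le> 1 - \<epsilon>\<^sub>0"
    and G_Lipschitz_path: "\<exists>C. \<forall>t\<in>{0..T}. \<forall>\<omega>\<in>Omega T 0. \<forall>\<omega>'\<in>Omega T 0. \<forall>y z. \<forall>\<gamma>\<in>Sym.
        \<bar>G t \<omega> y z \<gamma> - G t \<omega>' y z \<gamma>\<bar> \<le> C * path_norm 0 t (\<lambda>r. \<omega> r - \<omega>' r)"
    and g_Lipschitz_path: "\<exists>C. \<forall>\<omega>\<in>Omega T 0. \<forall>\<omega>'\<in>Omega T 0.
        \<bar>g \<omega> - g \<omega>'\<bar> \<le> C * path_norm 0 T (\<lambda>r. \<omega> r - \<omega>' r)"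
    and u_solution: "classical_solution T G u"
    and u_terminal: "\<forall>\<omega>\<in>Omega T 0. u T \<omega> = g \<omega>"
    and u_smooth: "u \<in> C24b T 0"
    and W: "brownian_motion N W"
    and uh: "\<forall>n\<ge>1. discrete_approximation G g \<mu> \<sigma> N W T n (uh n)"
  shows "\<exists>C. \<forall>n\<ge>1. \<forall>i\<le>n. \<forall>\<omega>\<in>Omega T 0.
           \<bar>uh n (grid T n i) \<omega> - u (grid T n i) \<omega>\<bar> \<le> C * (T / real n)"
proof -
  obtain L0 where L0: "\<And>t \<omega> y y' z z' \<gamma> \<gamma>'. t \<in> {0..T} \<Longrightarrow> \<omega> \<in> Omega T 0 \<Longrightarrow> \<gamma> \<in> Sym \<Longrightarrow> \<gamma>' \<in> Sym \<Longrightarrow>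
        \<bar>G t \<omega> y z \<gamma> - G t \<omega> y' z' \<gamma>'\<bar> \<le> L0 * (\<bar>y - y'\<bar> + norm (z - z') + norm (\<gamma> - \<gamma>'))"
    using G_Lipschitz unfolding Lambda_def by blast
  obtain K0 where K0: "\<And>t \<omega> \<omega>' y z \<gamma>. t \<in> {0..T} \<Longrightarrow> \<omega> \<in> Omega T 0 \<Longrightarrow> \<omega>' \<in> Omega T 0 \<Longrightarrow> \<gamma> \<in> Sym \<Longrightarrow>
        \<bar>G t \<omega> y z \<gamma> - G t \<omega>' y z \<gamma>\<bar> \<le> K0 * path_norm 0 t (\<lambda>r. \<omega> r - \<omega>' r)"
    using G_Lipschitz_path by blast
  obtain Bg where Bg: "\<And>\<omega>. \<omega> \<in> Omega T 0 \<Longrightarrow> \<bar>g \<omega>\<bar> \<le> Bg" using g_bounded by blast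
  obtain Cg where Cg: "\<And>\<omega> \<omega>'. \<omega> \<in> Omega T 0 \<Longrightarrow> \<omega>' \<in> Omega T 0 \<Longrightarrow> \<bar>g \<omega> - g \<omega>'\<bar> \<le> Cg * path_norm 0 T (\<lambda>r. \<omega> r - \<omega>' r)"
    using g_Lipschitz_path by blast
  \<comment> \<open>The constants in the hypotheses come without a sign, while the estimates
    multiply by them.\<close>
  define L where "L = max L0 0"
  define K where "K = max K0 0"
  interpret monotone_scheme N W T G \<mu> \<sigma> L K
  proof unfold_locales
    show "brownian_motion N W" by (rule W)
    show "0 < T" by (rule T_pos)
    show "0 \<le> L" "0 \<le> K" by (simp_all add: L_def K_def)
    show "bounded_proc T 0 (\<lambda>t \<omega>. G t \<omega> 0 0 0)" by (rule G_bounded)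
    show "\<mu> i > 0" "\<sigma> i > 0" for i using \<mu>_pos \<sigma>_pos by auto
  next
    fix t y y' :: real and \<omega> :: "'d path" and z z' :: "real ^ 'd" and \<gamma> \<gamma>' :: "real ^ 'd ^ 'd"
    assume "t \<in> {0..T}" "\<omega> \<in> Omega T 0" "\<gamma> \<in> Sym" "\<gamma>' \<in> Sym"
    from L0[OF this, of y z y' z']
    have "\<bar>G t \<omega> y z \<gamma> - G t \<omega> y' z' \<gamma>'\<bar> \<le> L0 * (\<bar>y - y'\<bar> + norm (z - z') + norm (\<gamma> - \<gamma>'))" .
    also have "\<dots> \<le> L * (\<bar>y - y'\<bar> + norm (z - z') + norm (\<gamma> - \<gamma>'))" by (intro mult_right_mono) (auto simp: L_def)
    finally show "\<bar>G t \<omega> y z \<gamma> - G t \<omega> y' z' \<gamma>'\<bar> \<le> L * (\<bar>y - y'\<bar> + norm (z - z') + norm (\<gamma> - \<gamma>'))" .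
  next
    fix t y :: real and \<omega> :: "'d path" and z :: "real ^ 'd" and \<gamma> :: "real ^ 'd ^ 'd"
    assume "t \<in> {0..T}" "\<omega> \<in> Omega T 0" "\<gamma> \<in> Sym"
    then show "\<exists>c \<Gamma>. has_gradients G t \<omega> y z \<gamma> c \<Gamma>" using G_differentiable unfolding Lambda_def by blast
  next
    fix t y :: real and \<omega> :: "'d path" and z c :: "real ^ 'd" and \<gamma> \<Gamma> :: "real ^ 'd ^ 'd"
    assume A: "t \<in> {0..T}" "\<omega> \<in> Omega T 0" "\<gamma> \<in> Sym" "has_gradients G t \<omega> y z \<gamma> c \<Gamma>"
    then have "(t, \<omega>) \<in> Lambda T 0" by (simp add: Lambda_def)
    from monotonicity[rule_format, OF this, unfolded split_conv, rule_format, OF A(3,4)] \<epsilon>\<^sub>0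
    show "(\<forall>i. c $ i \<ge> 0) \<and> (\<forall>i j. \<Gamma> $ i $ j \<ge> 0) \<and>
        (\<forall>i. 2 * \<Gamma> $ i $ i / \<sigma> i \<ge> (\<Sum>j\<in>UNIV - {i}. (\<Gamma> $ i $ j + \<Gamma> $ j $ i) / \<sigma> j)) \<and>
        (\<Sum>i\<in>UNIV. c $ i / \<mu> i) + (\<Sum>i\<in>UNIV. 2 * \<Gamma> $ i $ i / (\<sigma> i)\<^sup>2)
          - (\<Sum>i\<in>UNIV. \<Sum>j\<in>UNIV - {i}. \<Gamma> $ i $ j / (\<sigma> i * \<sigma> j)) \<le> 1" by auto
  next
    fix t y d :: real and \<omega> \<omega>' :: "'d path" and z :: "real ^ 'd" and \<gamma> :: "real ^ 'd ^ 'd"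
    assume A: "t \<in> {0..T}" "\<omega> \<in> Omega T 0" "\<omega>' \<in> Omega T 0" "\<gamma> \<in> Sym"
      and d: "\<And>r. r \<in> {0..T} \<Longrightarrow> norm (\<omega> r - \<omega>' r) \<le> d"
    have "path_norm 0 t (\<lambda>r. \<omega> r - \<omega>' r) \<le> d" using A(1) d by (intro path_norm_leI) auto
    moreover have "0 \<le> path_norm 0 t (\<lambda>r. \<omega> r - \<omega>' r)"
    proof -
      have "continuous_on {0..t} (\<lambda>r. \<omega> r - \<omega>' r)"
        using OmegaD(2)[OF A(2)] OmegaD(2)[OF A(3)] A(1)
        by (intro continuous_on_diff) (auto elim: continuous_on_subset)
      from norm_le_path_norm[OF this, of 0] A(1) show ?thesis by (auto intro: order_trans[OF norm_ge_zero])
    qed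
    ultimately have "K0 * path_norm 0 t (\<lambda>r. \<omega> r - \<omega>' r) \<le> K * d" by (intro mult_mono) (auto simp: K_def)
    then show "\<bar>G t \<omega> y z \<gamma> - G t \<omega>' y z \<gamma>\<bar> \<le> K * d" using K0[OF A, of y z] by linarith
  qed
  obtain a p q where C12: "C12b_derivs T 0 u a p q" and a: "a \<in> C12b T 0"
    and p: "\<And>i. (\<lambda>s \<omega>. p s \<omega> $ i) \<in> C12b T 0" and q: "\<And>i j. (\<lambda>s \<omega>. q s \<omega> $ i $ j) \<in> C12b T 0"
    using u_smooth unfolding C24b_def by blast
  then have D: "path_derivs T 0 u a p q" and u_bounded: "bounded_proc T 0 u" by (auto simp: C12b_derivs_def)
  obtain a' p' q' where D': "path_derivs T 0 u a' p' q'"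
    and eq': "\<And>t \<omega>. t \<in> {0..<T} \<Longrightarrow> \<omega> \<in> Omega T 0 \<Longrightarrow> - a' t \<omega> - G t \<omega> (u t \<omega>) (p' t \<omega>) (q' t \<omega>) = 0"
    using u_solution unfolding classical_solution_def by blast
  \<comment> \<open>The equation is stated for the derivatives from the classical solution and the
    regularity for those from \<open>C24b\<close>; uniqueness before T transfers the former to the
    latter.\<close>
  have eq: "a t \<omega> + G t \<omega> (u t \<omega>) (p t \<omega>) (q t \<omega>) = 0" if "t \<in> {0..<T}" "\<omega> \<in> Omega T 0" for t \<omega>
    using eq'[OF that] path_derivs_unique[OF T_pos D D' that] by simp
  obtain C where C: "C \<ge> 0" "\<And>t s \<omega>. t \<in> {0..<T} \<Longrightarrow> s \<in> {t<..T} \<Longrightarrow> \<omega> \<in> Omega T 0 \<Longrightarrow>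
      \<bar>quotient_step G \<mu> \<sigma> t \<omega> (s - t) (expectations T t \<omega> (u s)) - u t \<omega>\<bar> \<le> C * (s - t)\<^sup>2"
    using local_consistency[OF C12 a p q eq] by blast
  obtain Bu where Bu: "Bu \<ge> 0" "\<And>s \<omega>. s \<in> {0..T} \<Longrightarrow> \<omega> \<in> Omega T 0 \<Longrightarrow> norm (u s \<omega>) \<le> Bu"
    using bounded_procD[OF u_bounded] by blast
  have "\<bar>uh n (grid T n i) \<omega> - u (grid T n i) \<omega>\<bar> \<le> C * T * exp (L * T) * (T / real n)"
    if "n \<ge> 1" "i \<le> n" "\<omega> \<in> Omega T 0" for n i \<omega>
  proof (rule discrete_approximation_error[where g=g and Bu=Bu and Bg=Bg and Cg=Cg])
    show "u \<in> C0 T 0" by (rule path_derivs_C0(1)[OF D])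
    show "n > 0" "discrete_approximation G g \<mu> \<sigma> N W T n (uh n)" using that(1) uh by auto
    show "u T \<omega> = g \<omega>" if "\<omega> \<in> Omega T 0" for \<omega> using that u_terminal by blast
  qed (fact Bu(2) C Bg Cg that)+
  then show ?thesis by (intro exI[of _ "C * T * exp (L * T)"] allI impI ballI)
qed

end
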